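(* Suppose each value distribution $f_1,\dots,f_k$ has finite support. For any desired error $\epsilon>0$, a mechanism feasible for the original problem whose revenue is within an additive error $\epsilon$ of the revenue of the optimal mechanism can be computed in time polynomial in the size of the support of each $f_i$, the maximum value in the support of each $f_i$, the number of days $k$, and $1/\epsilon$.
   Context: Setting. Fix $k\ge 1$. A seller sells items $1,\dots,k$ to a single buyer over $k$ days. The buyer's value $v_i\ge0$ for item $i$ is drawn independently of the other values from a distribution $f_i$ (given explicitly, with finite support), and is learned by the buyer at the beginning of day $i$. Write $v_{\le i}=(v_1,\dots,v_i)$, $v_{<i}=(v_1,\dots,v_{i-1})$; $(v_{\le j},v_i')$ is $v_{\le j}$ with its $i$-th entry replaced by $v_i'$. A mechanism is a sequence of functions $x_i(v_{\le i})\in[0,1]$ (allocation probability) and $p_i(v_{\le i})\in\mathbb R$ (payment), $i=1,\dots,k$. To compute a mechanism means to compute a succinct description from which the allocation and payment on each day can be computed from the reports (the mechanism keeps a scalar state $c_i$ updated daily, and each day's allocation and payment is a function of the state and that day's report). Original problem: maximize the revenue $\mathbf E[\sum_{i=1}^k p_i(v_{\le i})]$ subject to (periodic incentive compatibility) for all $i$, $v_{\le i}$, $v_i'$: $v_ix_i(v_{\le i})-p_i(v_{\le i})+\mathbf E_{v_{i+1},\dots,v_k}[\sum_{j>i}(v_jx_j(v_{\le j})-p_j(v_{\le j}))]\ \ge\ v_ix_i(v_{<i},v_i')-p_i(v_{<i},v_i')+\mathbf E_{v_{i+1},\dots,v_k}[\sum_{j>i}(v_jx_j(v_{\le j},v_i')-p_j(v_{\le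 j},v_i'))]$; (ex-post individual rationality) $v_ix_i(v_{\le i})-p_i(v_{\le i})\ge 0$ for all $i$, $v_{\le i}$. *)

theory Defs
  imports "HOL-Probability.Product_PMF"
begin

section \<open>Sequential mechanisms\<close>

text \<open>
  Days are numbered \<open>1, \<dots>, k\<close>, and \<open>f i\<close> is the distribution of the value of item \<open>i\<close>.
  A profile \<open>v :: nat \<Rightarrow> real\<close> assigns the value \<open>v i\<close> to day \<open>i\<close>. The allocation and payment rules
  \<open>x i\<close> and \<open>p i\<close> take the list of the first \<open>i\<close> reports. As the distributions are discrete, types
  and reports range over the supports of the distributions.
\<close>

definition instance_ok :: "nat \<Rightarrow> (nat \<Rightarrow> real pmf) \<Rightarrow> bool" where
  "instance_ok k f \<longleftrightarrow>
     1 \<le> k \<and> (\<forall>i\<in>{1..k}. finite (set_pmf (f i)) \<and> (\<forall>a\<in>set_pmf (f i). 0 \<le> a))"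

type_synonym rule = "nat \<Rightarrow> real list \<Rightarrow> real"

definition hist :: "(nat \<Rightarrow> real) \<Rightarrow> nat \<Rightarrow> real list" where
  "hist v i = map v [1..<Suc i]"

definition supported :: "(nat \<Rightarrow> real pmf) \<Rightarrow> nat \<Rightarrow> (nat \<Rightarrow> real) \<Rightarrow> bool" where
  "supported f i v \<longleftrightarrow> (\<forall>j\<in>{1..i}. v j \<in> set_pmf (f j))"

text \<open>Utility on day \<open>j\<close> of a buyer with true values \<open>v\<close> who reports \<open>r\<close>.\<close>

definition day_utility :: "rule \<Rightarrow> rule \<Rightarrow> (nat \<Rightarrow> real) \<Rightarrow> (nat \<Rightarrow> real) \<Rightarrow> nat \<Rightarrow> real" where
  "day_utility x p v r j = v j * x j (hist r j) - p j (hist r j)"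

text \<open>
  Utility on day \<open>i\<close> plus expected utility on later days of a buyer with true values \<open>v\<close> who reports
  \<open>r\<close> up to day \<open>i\<close> and reports truthfully the later values, which are drawn as \<open>w\<close>.
\<close>

definition continuation_utility ::
  "nat \<Rightarrow> (nat \<Rightarrow> real pmf) \<Rightarrow> rule \<Rightarrow> rule \<Rightarrow> nat \<Rightarrow> (nat \<Rightarrow> real) \<Rightarrow> (nat \<Rightarrow> real) \<Rightarrow> real" where
  "continuation_utility k f x p i v r =
     day_utility x p v r i +
     measure_pmf.expectation (Pi_pmf {i<..k} 0 f)
       (\<lambda>w. \<Sum>j\<in>{i<..k}. day_utility x p (override_on v w {i<..k}) (override_on r w {i<..k}) j)"

definition periodic_ic :: "nat \<Rightarrow> (nat \<Rightarrow> real pmf) \<Rightarrow> rule \<Rightarrow> rule \<Rightarrow> bool" where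
  "periodic_ic k f x p \<longleftrightarrow>
     (\<forall>i\<in>{1..k}. \<forall>v. supported f i v \<longrightarrow> (\<forall>v'\<in>set_pmf (f i).
        continuation_utility k f x p i v v \<ge> continuation_utility k f x p i v (v(i := v'))))"

definition ex_post_ir :: "nat \<Rightarrow> (nat \<Rightarrow> real pmf) \<Rightarrow> rule \<Rightarrow> rule \<Rightarrow> bool" where
  "ex_post_ir k f x p \<longleftrightarrow>
     (\<forall>i\<in>{1..k}. \<forall>v. supported f i v \<longrightarrow> day_utility x p v v i \<ge> 0)"

definition feasible :: "nat \<Rightarrow> (nat \<Rightarrow> real pmf) \<Rightarrow> rule \<Rightarrow> rule \<Rightarrow> bool" where
  "feasible k f x p \<longleftrightarrow>
     (\<forall>i\<in>{1..k}. \<forall>v. supported f i v \<longrightarrow> x i (hist v i) \<in> {0..1}) \<and>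
     periodic_ic k f x p \<and> ex_post_ir k f x p"

definition revenue :: "nat \<Rightarrow> (nat \<Rightarrow> real pmf) \<Rightarrow> rule \<Rightarrow> real" where
  "revenue k f p =
     measure_pmf.expectation (Pi_pmf {1..k} 0 f) (\<lambda>v. \<Sum>i\<in>{1..k}. p i (hist v i))"


section \<open>Model of computation\<close>

text \<open>
  A structured real RAM (arithmetic model): an index memory of natural numbers and a memory of exact
  real numbers, both with indirect addressing. The operations are addition and truncated subtraction
  of indices, field arithmetic and comparison of reals, and rational constants. There is no rounding
  or conversion from reals to indices. The conventions for natural subtraction and for division by
  zero are those of HOL.
\<close>

datatype nexp =
    NConst nat
  | NMem nexp
  | NAdd nexp nexp
  | NSub nexp nexp

datatype rexp =
    RConst rat
  | ROfIndex nexp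
  | RMem nexp
  | RAdd rexp rexp
  | RSub rexp rexp
  | RMul rexp rexp
  | RDiv rexp rexp

datatype test =
    NLess nexp nexp
  | RLess rexp rexp
  | TNot test
  | TAnd test test

datatype prog =
    Skip
  | NAssign nexp nexp
  | RAssign nexp rexp
  | Seq prog prog
  | Cond test prog prog
  | While test prog

type_synonym mem = "(nat \<Rightarrow> nat) \<times> (nat \<Rightarrow> real)"

fun nval :: "nexp \<Rightarrow> mem \<Rightarrow> nat" where
  "nval (NConst n) s = n"
| "nval (NMem a) s = fst s (nval a s)"
| "nval (NAdd a b) s = nval a s + nval b s"
| "nval (NSub a b) s = nval a s - nval b s"

fun rval :: "rexp \<Rightarrow> mem \<Rightarrow> real" where
  "rval (RConst q) s = of_rat q"
| "rval (ROfIndex a) s = real (nval a s)"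
| "rval (RMem a) s = snd s (nval a s)"
| "rval (RAdd a b) s = rval a s + rval b s"
| "rval (RSub a b) s = rval a s - rval b s"
| "rval (RMul a b) s = rval a s * rval b s"
| "rval (RDiv a b) s = rval a s / rval b s"

fun tval :: "test \<Rightarrow> mem \<Rightarrow> bool" where
  "tval (NLess a b) s \<longleftrightarrow> nval a s < nval b s"
| "tval (RLess a b) s \<longleftrightarrow> rval a s < rval b s"
| "tval (TNot b) s \<longleftrightarrow> \<not> tval b s"
| "tval (TAnd b c) s \<longleftrightarrow> tval b s \<and> tval c s"

text \<open>
  \<open>exec c s t s'\<close>: started in memory \<open>s\<close>, the program \<open>c\<close> halts after time \<open>t\<close> in memory \<open>s'\<close>.
  Each executed assignment and each evaluated test costs one unit; since a program contains only
  finitely many expressions, this agrees with counting single arithmetic operations and memory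
  accesses up to a constant factor that depends on the program only.
\<close>

inductive exec :: "prog \<Rightarrow> mem \<Rightarrow> nat \<Rightarrow> mem \<Rightarrow> bool" where
  Skip: "exec Skip s 1 s"
| NAssign: "exec (NAssign a e) (N, R) 1 (N(nval a (N, R) := nval e (N, R)), R)"
| RAssign: "exec (RAssign a e) (N, R) 1 (N, R(nval a (N, R) := rval e (N, R)))"
| Seq: "exec c s t s' \<Longrightarrow> exec d s' t' s'' \<Longrightarrow> exec (Seq c d) s (t + t') s''"
| CondTrue: "tval b s \<Longrightarrow> exec c s t s' \<Longrightarrow> exec (Cond b c d) s (1 + t) s'"
| CondFalse: "\<not> tval b s \<Longrightarrow> exec d s t s' \<Longrightarrow> exec (Cond b c d) s (1 + t) s'"
| WhileFalse: "\<not> tval b s \<Longrightarrow> exec (While b c) s 1 s"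
| WhileTrue: "tval b s \<Longrightarrow> exec c s t s' \<Longrightarrow> exec (While b c) s' t' s'' \<Longrightarrow>
    exec (While b c) s (1 + t + t') s''"

text \<open>
  Inputs and outputs are pairs of a list of indices and a list of reals. Index cells 0 and 1 hold the
  two lengths; the index list starts at index cell 2 and the real list at real cell 0. All remaining
  cells are zero initially and arbitrary at the end.
\<close>

type_synonym data = "nat list \<times> real list"

definition init_mem :: "data \<Rightarrow> mem" where
  "init_mem d = (case d of (ns, rs) \<Rightarrow>
     (\<lambda>a. let l = length ns # length rs # ns in if a < length l then l ! a else 0,
      \<lambda>a. if a < length rs then rs ! a else 0))"

definition holds_output :: "mem \<Rightarrow> data \<Rightarrow> bool" where
  "holds_output s d \<longleftrightarrow> (case d of (ns, rs) \<Rightarrow>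
     map (fst s) [0..<length ns + 2] = length ns # length rs # ns \<and>
     map (snd s) [0..<length rs] = rs)"

definition computes_in :: "prog \<Rightarrow> data \<Rightarrow> real \<Rightarrow> data \<Rightarrow> bool" where
  "computes_in c d T d' \<longleftrightarrow>
     (\<exists>t s. exec c (init_mem d) t s \<and> real t \<le> T \<and> holds_output s d')"


section \<open>Computing a mechanism\<close>

text \<open>
  The explicit description of the input: \<open>k\<close>, the support sizes, the error \<open>\<epsilon>\<close>, and for each day the
  list of support points in increasing order, each followed by its probability.
\<close>

definition encode_instance :: "nat \<Rightarrow> (nat \<Rightarrow> real pmf) \<Rightarrow> real \<Rightarrow> data" where
  "encode_instance k f \<epsilon> =
     (k # map (\<lambda>i. card (set_pmf (f i))) [1..<Suc k],
      \<epsilon> # concat (map (\<lambda>i. concat (map (\<lambda>a. [a, pmf (f i) a])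
                                    (sorted_list_of_set (set_pmf (f i))))) [1..<Suc k]))"

definition instance_size :: "nat \<Rightarrow> (nat \<Rightarrow> real pmf) \<Rightarrow> real \<Rightarrow> real" where
  "instance_size k f \<epsilon> =
     real k + (\<Sum>i=1..k. real (card (set_pmf (f i))) + Max (set_pmf (f i))) + 1 / \<epsilon>"

text \<open>
  Within time \<open>T\<close>, the program \<open>P\<close> computes from the instance a description of length at most \<open>T\<close>,
  consisting of \<open>ns\<close>, \<open>rs\<close> and an initial state \<open>c []\<close>. On each day \<open>i\<close>, within time \<open>T\<close>, the
  program \<open>Q\<close> computes from the description, the day, the current scalar state and that day's report
  the allocation, the payment and the next state. The state \<open>c (hist v i)\<close> is the one reached after
  the reports \<open>v 1, \<dots>, v i\<close>.
\<close>

definition computes_mechanism ::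
  "prog \<Rightarrow> prog \<Rightarrow> nat \<Rightarrow> (nat \<Rightarrow> real pmf) \<Rightarrow> real \<Rightarrow> real \<Rightarrow> rule \<Rightarrow> rule \<Rightarrow> bool" where
  "computes_mechanism P Q k f \<epsilon> T x p \<longleftrightarrow>
     (\<exists>ns rs. \<exists>c :: real list \<Rightarrow> real.
        real (length ns + length (c [] # rs)) \<le> T \<and>
        computes_in P (encode_instance k f \<epsilon>) T (ns, c [] # rs) \<and>
        (\<forall>i\<in>{1..k}. \<forall>v. supported f i v \<longrightarrow>
           computes_in Q (i # ns, c (hist v (i - 1)) # v i # rs) T
             ([], [x i (hist v i), p i (hist v i), c (hist v i)])))"

end

(* A mechanism is described by promised utilities: once the utility promised to the buyer from day i on
   is fixed, the past is irrelevant, and revenue is welfare minus the initial promise. On one day with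
   values V_0 < V_1 < ... a mechanism is incentive compatible iff the interim utilities satisfy
   B_(j+1) - B_j = x_j (V_(j+1) - V_j) for a nondecreasing x (up to raising x, which only adds welfare), and
   ex-post individual rationality only asks that the promise made for the next day be at most B_j.

   The dynamic program goes through the days and, within a day, through the values. A cell has grid
   coordinates b (a lower bound on the interim utility), x (a lower bound on the slope) and s (the welfare still
   to be reached); its entry D is the least expected utility above b that reaches the target s. Utility is
   charged by the exact increments x_j (V_(j+1) - V_j) P(value > V_j), so that b + D is exactly the
   utility promised by the policy read off the table and feasibility is not affected by rounding. Rounding
   only costs O(h) for each value, because a slightly larger promise never lowers the attainable welfare:
   no bound on the slope of welfare as a function of the promise is needed. The grid has O((total + eps)/h)
   points in each direction, which is polynomial.

   The real RAM cannot convert reals to indices; the program therefore enumerates the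
   successors of a cell by brute force, recognises the ends of the days by probabilities adding up to 1,
   and passes the address of a cell as the scalar state. *)
theory Submission imports Defs begin

section \<open>The dynamic program for one day\<close>

text \<open>The tables store the promise as a function of the welfare target and not the converse,
  because feasibility tolerates no error: incentive constraints and promise keeping must hold
  exactly, so the promise has to be an exact quantity of the discretised policy, whereas a target
  may be rounded down at a small loss of revenue. A second obstacle is that a feasible mechanism may
  promise arbitrarily much, since payments may be negative. The comparison with it truncates
  promises at the sum of the top values of the remaining days; as slopes of interim utilities lie in
  [0,1], each day adds at most its top value to the truncation level, and a grid up to
  \<open>n * h\<close> suffices. The entry \<open>(n + 1) * h\<close> then acts as infinity. Let M
  be the number of all support points and L = 2 M + 1 the length of the real input. Rounding loses
  O(h) per support point, in welfare as well as in promise, at most 4 L h altogether; hence h =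
  \<epsilon> / (4 L). Each of M layers has K = (n + 1)^3 cells, and each cell tries K^2 pairs of
  successors.\<close>

lemma abel_sum:
  fixes c p :: "nat \<Rightarrow> real"
  shows "(\<Sum>l<m. c l * (\<Sum>j\<in>{Suc l..<m}. p j)) = (\<Sum>j<m. p j * (\<Sum>l<j. c l))"
proof (induction m)
  case (Suc m)
  have "(\<Sum>l<m. c l * (\<Sum>j\<in>{Suc l..<Suc m}. p j)) = (\<Sum>l<m. c l * (\<Sum>j\<in>{Suc l..<m}. p j) + p m * c l)"
    by (intro sum.cong refl) (simp add: sum.atLeastLessThan_Suc algebra_simps)
  then show ?case using Suc by (simp add: sum.distrib sum_distrib_left)
qed simp

text \<open>The interface between optimisation and machine code. \<open>D_upper\<close> and
  \<open>D_lower\<close> say that \<open>D\<close> solves a Bellman equation capped at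
  \<open>(real n + 1) * h\<close>: the former serves the comparison with an arbitrary mechanism, the
  latter the extraction of a policy. \<open>T j\<close> holds the cells at which value
  \<open>j\<close> is decided, \<open>ND\<close> those at which the next day may start.\<close>

locale day_dp =
  fixes m :: nat and V Pr :: "nat \<Rightarrow> real" and h :: real and n :: nat
    and b x s D :: "'e \<Rightarrow> real" and nx nd :: "'e \<Rightarrow> 'e"
    and T :: "nat \<Rightarrow> 'e set" and ND :: "'e set"
  assumes m_pos: "0 < m"
    and V_less: "\<And>i j. i < j \<Longrightarrow> j < m \<Longrightarrow> V i < V j"
    and V_nonneg: "\<And>j. j < m \<Longrightarrow> 0 \<le> V j"
    and Pr_pos: "\<And>j. j < m \<Longrightarrow> 0 < Pr j"
    and Pr_sum: "(\<Sum>j<m. Pr j) = 1"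
    and h_pos: "0 < h" and n_pos: "0 < n"
    and grid: "\<And>j e. j \<le> m \<Longrightarrow> e \<in> T j \<Longrightarrow>
      \<exists>\<beta>\<le>n. \<exists>\<xi>\<le>n. \<exists>\<sigma>\<le>n. b e = real \<beta> * h \<and> x e = real \<xi> / real n \<and> s e = real \<sigma> * h"
    and grid_ex: "\<And>j \<beta> \<xi> \<sigma>. j \<le> m \<Longrightarrow> \<beta> \<le> n \<Longrightarrow> \<xi> \<le> n \<Longrightarrow> \<sigma> \<le> n \<Longrightarrow>
      \<exists>e\<in>T j. b e = real \<beta> * h \<and> x e = real \<xi> / real n \<and> s e = real \<sigma> * h"
    and D_final: "\<And>e. e \<in> T m \<Longrightarrow> D e = (if b e = 0 \<and> s e = 0 then 0 else (real n + 1) * h)"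
    and D_upper: "\<And>j e e' e''. j < m \<Longrightarrow> e \<in> T j \<Longrightarrow> e' \<in> T (Suc j) \<Longrightarrow> e'' \<in> ND \<Longrightarrow>
      x e \<le> x e' \<Longrightarrow> b e' \<le> b e + x e' * (if Suc j < m then V (Suc j) - V j else 0) \<Longrightarrow>
      b e'' + D e'' \<le> b e \<Longrightarrow> s e \<le> Pr j * (V j * x e' + s e'') + s e' \<Longrightarrow>
      D e \<le> x e' * (if Suc j < m then V (Suc j) - V j else 0) * (\<Sum>l\<in>{Suc j..<m}. Pr l) + D e'"
    and D_lower: "\<And>j e. j < m \<Longrightarrow> e \<in> T j \<Longrightarrow> D e < (real n + 1) * h \<Longrightarrow>
      nx e \<in> T (Suc j) \<and> nd e \<in> ND \<and>
      x e \<le> x (nx e) \<and> b (nx e) \<le> b e + x (nx e) * (if Suc j < m then V (Suc j) - V j else 0) \<and>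
      b (nd e) + D (nd e) \<le> b e \<and> s e \<le> Pr j * (V j * x (nx e) + s (nd e)) + s (nx e) \<and>
      D e = x (nx e) * (if Suc j < m then V (Suc j) - V j else 0) * (\<Sum>l\<in>{Suc j..<m}. Pr l) + D (nx e)"
begin

definition gap :: "nat \<Rightarrow> real" where
  "gap j = (if Suc j < m then V (Suc j) - V j else 0)"

definition tail :: "nat \<Rightarrow> real" where
  "tail j = (\<Sum>l\<in>{Suc j..<m}. Pr l)"

lemma gap_nonneg: "0 \<le> gap j"
  using V_less[of j "Suc j"] by (auto simp: gap_def)

lemma tail_nonneg: "0 \<le> tail j"
  unfolding tail_def by (intro sum_nonneg) (auto intro: less_imp_le Pr_pos)

lemma sum_gap: "i \<le> j \<Longrightarrow> j < m \<Longrightarrow> (\<Sum>l\<in>{i..<j}. gap l) = V j - V i"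
proof (induction j)
  case (Suc j)
  then show ?case
    by (cases "i = Suc j") (auto simp: gap_def)
qed simp

text \<open>Summation by parts: an increment made at value \<open>l\<close> is received by all
  higher values, hence with probability \<open>tail l\<close>. This is why the tables can charge an
  increment at the moment it is made.\<close>

lemma expectation_increments:
  "(\<Sum>j<m. Pr j * (c + (\<Sum>l<j. d l))) = c + (\<Sum>l<m. d l * tail l)"
proof -
  have "(\<Sum>j<m. Pr j * (c + (\<Sum>l<j. d l))) = c * (\<Sum>j<m. Pr j) + (\<Sum>j<m. Pr j * (\<Sum>l<j. d l))"
    by (simp add: sum_distrib_left sum.distrib algebra_simps)
  then show ?thesis by (simp add: Pr_sum tail_def abel_sum)
qed

subsection \<open>The policy read off a table\<close>

definition cell :: "'e \<Rightarrow> nat \<Rightarrow> 'e" where "cell e j = (nx ^^ j) e"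

text \<open>The field \<open>x\<close> of a cell bounds from below all slopes still to be chosen, so
  the slope chosen at value \<open>j\<close> is the field of the successor cell.\<close>

definition alloc :: "'e \<Rightarrow> nat \<Rightarrow> real" where "alloc e j = x (cell e (Suc j))"

text \<open>Accumulated without rounding; the coordinate \<open>b\<close> of the \<open>j\<close>-th
  cell only bounds this utility from below.\<close>

definition interim :: "'e \<Rightarrow> nat \<Rightarrow> real" where
  "interim e j = b e + (\<Sum>l<j. alloc e l * gap l)"

definition succ :: "'e \<Rightarrow> nat \<Rightarrow> 'e" where "succ e j = nd (cell e j)"

lemma x_bounds: "j \<le> m \<Longrightarrow> e \<in> T j \<Longrightarrow> 0 \<le> x e \<and> x e \<le> 1"
  using grid[of j e] n_pos by auto

context
  fixes e assumes e: "e \<in> T 0" and De: "D e < (real n + 1) * h"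
begin

text \<open>Charges are nonnegative, so \<open>D\<close> can only fall along the path and finiteness
  of the first entry is inherited.\<close>

lemma cell_in: "j \<le> m \<Longrightarrow> cell e j \<in> T j \<and> D (cell e j) < (real n + 1) * h"
proof (induction j)
  case (Suc j)
  then have *: "cell e j \<in> T j" "D (cell e j) < (real n + 1) * h" by auto
  have eq: "cell e (Suc j) = nx (cell e j)" by (simp add: cell_def)
  from D_lower[OF _ *] Suc(2) have n1: "nx (cell e j) \<in> T (Suc j)"
    and D1: "D (cell e j) = x (nx (cell e j)) * gap j * tail j + D (nx (cell e j))"
    unfolding gap_def tail_def by auto
  have "0 \<le> x (nx (cell e j)) * gap j * tail j"
    using x_bounds[OF _ n1] Suc(2) gap_nonneg tail_nonneg by simp
  then show ?case using n1 D1 * eq by auto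
qed (use e De in \<open>simp add: cell_def\<close>)

lemma cell_step:
  assumes "j < m"
  shows "succ e j \<in> ND" "x (cell e j) \<le> alloc e j" "b (cell e (Suc j)) \<le> b (cell e j) + alloc e j * gap j"
    "b (succ e j) + D (succ e j) \<le> b (cell e j)"
    "s (cell e j) \<le> Pr j * (V j * alloc e j + s (succ e j)) + s (cell e (Suc j))"
    "D (cell e j) = alloc e j * gap j * tail j + D (cell e (Suc j))"
  using D_lower[OF assms, of "cell e j"] cell_in[of j] assms
  by (auto simp: alloc_def succ_def cell_def gap_def tail_def)

lemma alloc_bounds: "j < m \<Longrightarrow> 0 \<le> alloc e j \<and> alloc e j \<le> 1"
  using cell_in[of "Suc j"] x_bounds[of "Suc j"] by (auto simp: alloc_def)

lemma alloc_mono: "i \<le> j \<Longrightarrow> j < m \<Longrightarrow> alloc e i \<le> alloc e j"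
proof (induction j)
  case (Suc j)
  show ?case
  proof (cases "i = Suc j")
    case False
    then have "alloc e i \<le> alloc e j" using Suc by auto
    also have "\<dots> \<le> alloc e (Suc j)" using cell_step(2)[of "Suc j"] Suc(3) by (simp add: alloc_def)
    finally show ?thesis .
  qed simp
qed simp

lemma interim_ge_b: "j \<le> m \<Longrightarrow> b (cell e j) \<le> interim e j"
proof (induction j)
  case (Suc j)
  then show ?case using cell_step(3)[of j] by (simp add: interim_def)
qed (simp add: interim_def cell_def)

lemma succ_affordable: "j < m \<Longrightarrow> b (succ e j) + D (succ e j) \<le> interim e j"
  using cell_step(4)[of j] interim_ge_b[of j] by simp

lemma interim_diff:
  "i \<le> j \<Longrightarrow> interim e j - interim e i = (\<Sum>l\<in>{i..<j}. alloc e l * gap l)"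
  using sum_diff_nat_ivl[of 0 i j "\<lambda>l. alloc e l * gap l"]
  by (simp add: interim_def lessThan_atLeast0)

text \<open>The utility difference is a sum of gaps weighted by allocations. Replacing each weight
  by the allocation of value \<open>i\<close> errs in the right direction on both sides of
  \<open>i\<close>, because allocations are nondecreasing.\<close>

lemma interim_ic:
  assumes "i < m" "j < m"
  shows "interim e j \<ge> interim e i + (V j - V i) * alloc e i"
proof (cases "i \<le> j")
  case True
  have "(V j - V i) * alloc e i = (\<Sum>l\<in>{i..<j}. gap l * alloc e i)"
    using sum_gap[OF True] assms by (simp add: sum_distrib_right[symmetric])
  also have "\<dots> \<le> (\<Sum>l\<in>{i..<j}. alloc e l * gap l)"
    using assms by (intro sum_mono) (auto simp: mult.commute intro!: mult_left_mono alloc_mono gap_nonneg)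
  finally show ?thesis using interim_diff[OF True] by simp
next
  case False
  then have le: "j \<le> i" by simp
  have "(\<Sum>l\<in>{j..<i}. alloc e l * gap l) \<le> (\<Sum>l\<in>{j..<i}. gap l * alloc e i)"
    using assms by (intro sum_mono) (auto simp: mult.commute intro!: mult_left_mono alloc_mono gap_nonneg)
  also have "\<dots> = (V i - V j) * alloc e i"
    using sum_gap[OF le] assms by (simp add: sum_distrib_right[symmetric])
  finally show ?thesis using interim_diff[OF le] by (simp add: algebra_simps)
qed

lemma final_cell: "b (cell e m) = 0 \<and> s (cell e m) = 0 \<and> D (cell e m) = 0"
  using D_final[of "cell e m"] cell_in[of m] by (auto split: if_splits)

text \<open>Telescoping the equations for \<open>D\<close> down to the final cell leaves exactly the
  charges. Hence the promise is kept with equality, however coarse the coordinates are.\<close>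

lemma interim_expectation: "(\<Sum>j<m. Pr j * interim e j) = b e + D e"
proof -
  have "D (cell e j) = (\<Sum>l\<in>{j..<m}. alloc e l * gap l * tail l)" if "j \<le> m" for j
    using that
  proof (induction rule: inc_induct)
    case (step i)
    then show ?case using cell_step(6)[of i] by (simp add: sum.atLeast_Suc_lessThan)
  qed (simp add: final_cell)
  from this[of 0] have "D e = (\<Sum>l<m. alloc e l * gap l * tail l)"
    by (simp add: cell_def lessThan_atLeast0)
  then show ?thesis unfolding interim_def expectation_increments by simp
qed

lemma welfare_target: "s e \<le> (\<Sum>j<m. Pr j * (V j * alloc e j + s (succ e j)))"
proof -
  have "s (cell e j) \<le> (\<Sum>l\<in>{j..<m}. Pr l * (V l * alloc e l + s (succ e l)))" if "j \<le> m" for j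
    using that
  proof (induction rule: inc_induct)
    case (step i)
    then show ?case using cell_step(5)[of i] by (simp add: sum.atLeast_Suc_lessThan)
  qed (simp add: final_cell)
  from this[of 0] show ?thesis by (simp add: cell_def lessThan_atLeast0)
qed

end

subsection \<open>Near-optimality of a table\<close>

text \<open>Rounds one day of an arbitrary incentive compatible mechanism to a path through the
  table. Slopes are rounded up, the starting utility is raised by a reserve of \<open>m * h\<close>
  and the target lowered by the same amount; the roundings along the path consume these reserves, at
  most \<open>h\<close> per value. \<open>S\<close> is the truncation level of promises,
  \<open>sl\<close> the excess inherited from later days.\<close>

lemma table_upper:
  fixes X B W :: "nat \<Rightarrow> real" and N :: "nat \<Rightarrow> 'e" and S sl :: real
  assumes X: "\<And>j. j < m \<Longrightarrow> 0 \<le> X j \<and> X j \<le> 1"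
    and B_nonneg: "\<And>j. j < m \<Longrightarrow> 0 \<le> B j"
    and ic: "\<And>i j. i < m \<Longrightarrow> j < m \<Longrightarrow> B j \<ge> B i + (V j - V i) * X i"
    and N: "\<And>j. j < m \<Longrightarrow> N j \<in> ND \<and> b (N j) + D (N j) \<le> min (B j) S + sl"
    and t_nonneg: "\<And>j. j < m \<Longrightarrow> 0 \<le> s (N j)"
    and \<sigma>: "\<sigma> \<le> n" "real \<sigma> * h \<le> max 0 ((\<Sum>j<m. Pr j * (V j * X j + s (N j))) - real m * h)"
    and room: "S + sl + (real m + 1) * h \<le> real n * h" and S: "0 \<le> S" "0 \<le> sl"
  shows "\<exists>e\<in>T 0. s e = real \<sigma> * h \<and>
    b e + D e \<le> min (\<Sum>j<m. Pr j * B j) (S + V (m - 1)) + sl + (real m + 1) * h + V (m - 1) / real n"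
proof -
  \<comment> \<open>The slope of \<open>B\<close>, which incentive compatibility squeezes between
    the allocations of two adjacent values. Above the top value no increment is due, so slope 1 is
    free there.\<close>
  define xs where "xs j = (if Suc j < m then (B (Suc j) - B j) / gap j else 1)" for j
  have gap_pos: "0 < gap j" if "Suc j < m" for j
    using V_less[of j "Suc j"] that by (simp add: gap_def)
  have xs_lower: "X j \<le> xs j" if "j < m" for j
    using ic[of j "Suc j"] gap_pos[of j] X[of j] that
    by (auto simp: xs_def field_simps gap_def)
  have xs_upper: "xs j \<le> X (Suc j)" if "Suc j < m" for j
    using ic[of "Suc j" j] gap_pos[of j] that
    by (auto simp: xs_def field_simps gap_def)
  have xs_le1: "xs j \<le> 1" if "j < m" for j
    using xs_upper[of j] X[of "Suc j"] by (cases "Suc j < m") (auto simp: xs_def)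
  have xs_mono: "xs j \<le> xs (Suc j)" if "Suc j < m" for j
    using xs_upper[of j] xs_lower[of "Suc j"] that by simp
  have xs_gap: "xs j * gap j = B (Suc j) - B j" if "Suc j < m" for j
    using gap_pos[of j] that by (simp add: xs_def)
  have xs_nonneg: "0 \<le> xs j" if "j < m" for j using xs_lower[of j] X[of j] that by simp
  define \<xi> where "\<xi> j = nat \<lceil>real n * xs j\<rceil>" for j
  have \<xi>_ge: "xs j \<le> real (\<xi> j) / real n" if "j < m" for j
    using n_pos le_of_int_ceiling[of "real n * xs j"] xs_nonneg[OF that]
    by (simp add: \<xi>_def field_simps)
  have \<xi>_le: "real (\<xi> j) / real n \<le> xs j + 1 / real n" if "j < m" for j
    using n_pos xs_nonneg[OF that] of_int_ceiling_le_add_one[of "real n * xs j"]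
    by (simp add: \<xi>_def field_simps)
  have \<xi>_le_n: "\<xi> j \<le> n" if "j < m" for j
  proof -
    have "real n * xs j \<le> real n" using xs_le1[OF that] n_pos by simp
    then show ?thesis by (simp add: \<xi>_def ceiling_le_iff nat_le_iff)
  qed
  have \<xi>_mono: "\<xi> j \<le> \<xi> (Suc j)" if "Suc j < m" for j
    using xs_mono[OF that] n_pos unfolding \<xi>_def by (intro nat_mono ceiling_mono mult_left_mono) auto
  define a where "a j = real (\<xi> j) / real n" for j
  have a01: "0 \<le> a j" "j < m \<Longrightarrow> a j \<le> 1" for j using \<xi>_le_n[of j] n_pos by (auto simp: a_def)
  \<comment> \<open>\<open>min n\<close> keeps the coordinate on the grid. It does no harm: by
    \<open>room\<close>, the truncated promise with its whole reserve stays below the end of the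
    grid.\<close>
  define \<beta> where "\<beta> = rec_nat (nat \<lceil>(min (B 0) S + sl + real m * h) / h\<rceil>)
    (\<lambda>j r. min n (nat \<lfloor>(real r * h + a j * gap j) / h\<rfloor>))"
  have \<beta>0: "\<beta> 0 = nat \<lceil>(min (B 0) S + sl + real m * h) / h\<rceil>"
    and \<beta>S: "\<beta> (Suc j) = min n (nat \<lfloor>(real (\<beta> j) * h + a j * gap j) / h\<rfloor>)" for j
    by (simp_all add: \<beta>_def)
  have base_nonneg: "0 \<le> min (B 0) S + sl + real m * h"
    using B_nonneg[of 0] m_pos S h_pos by simp
  have \<beta>0_ge: "min (B 0) S + sl + real m * h \<le> real (\<beta> 0) * h"
  proof -
    have "(min (B 0) S + sl + real m * h) / h \<le> real (\<beta> 0)"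
      unfolding \<beta>0 by (rule real_nat_ceiling_ge)
    then show ?thesis using h_pos by (simp add: field_simps)
  qed
  have \<beta>0_le: "real (\<beta> 0) * h \<le> min (B 0) S + sl + (real m + 1) * h"
  proof -
    have "real (\<beta> 0) \<le> (min (B 0) S + sl + real m * h) / h + 1"
      unfolding \<beta>0 using base_nonneg h_pos of_int_ceiling_le_add_one[of "(min (B 0) S + sl + real m * h) / h"]
      by (simp add: divide_nonneg_pos)
    then show ?thesis using h_pos by (simp add: field_simps)
  qed
  have \<beta>_le: "\<beta> j \<le> n" for j
  proof (cases j)
    case 0
    have "real (\<beta> 0) * h \<le> real n * h" using \<beta>0_le room by linarith
    then show ?thesis using 0 h_pos by simp
  qed (simp add: \<beta>S)
  have \<beta>_step: "real (\<beta> (Suc j)) * h \<le> real (\<beta> j) * h + a j * gap j" for j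
  proof -
    have nn: "0 \<le> (real (\<beta> j) * h + a j * gap j) / h"
      using h_pos a01 gap_nonneg by simp
    have "real (\<beta> (Suc j)) \<le> (real (\<beta> j) * h + a j * gap j) / h"
      unfolding \<beta>S using of_nat_floor[OF nn] by (simp add: min_le_iff_disj)
    then show ?thesis using h_pos by (simp add: field_simps)
  qed
  \<comment> \<open>Rounding down costs at most \<open>h\<close> per value, so the reserve shrinks
    by \<open>h\<close> in each step and is still positive at the last value.\<close>
  have \<beta>_ge: "j < m \<Longrightarrow> min (B j) S + sl + (real m - real j) * h \<le> real (\<beta> j) * h" for j
  proof (induction j)
    case 0 then show ?case using \<beta>0_ge by simp
  next
    case (Suc j)
    show ?case
    proof (cases "\<beta> (Suc j) = n")
      case True
      have "min (B (Suc j)) S + sl + (real m - real (Suc j)) * h \<le> S + sl + (real m + 1) * h"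
        using h_pos by (intro add_mono mult_right_mono) auto
      then show ?thesis using True room by simp
    next
      case False
      define y where "y = (real (\<beta> j) * h + a j * gap j) / h"
      have "0 \<le> y" unfolding y_def using h_pos a01 gap_nonneg by simp
      then have "y - 1 \<le> real (\<beta> (Suc j))"
        using False unfolding \<beta>S y_def[symmetric] by linarith
      then have "real (\<beta> j) * h + a j * gap j - h \<le> real (\<beta> (Suc j)) * h"
        using h_pos by (simp add: y_def field_simps)
      moreover have "xs j * gap j \<le> a j * gap j"
        using \<xi>_ge[of j] Suc.prems gap_nonneg by (intro mult_right_mono) (auto simp: a_def)
      moreover have "min (B (Suc j)) S \<le> min (B j) S + xs j * gap j"
      proof -
        have "0 \<le> xs j * gap j" using xs_nonneg[of j] Suc.prems gap_nonneg by simp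
        then show ?thesis using xs_gap[OF Suc.prems] by simp
      qed
      moreover have "min (B j) S + sl + (real m - real j) * h \<le> real (\<beta> j) * h"
        using Suc by simp
      ultimately show ?thesis by (simp add: algebra_simps)
    qed
  qed
  define g where "g j = Pr j * (V j * a j + s (N j))" for j
  have g_nonneg: "0 \<le> g j" if "j < m" for j
    unfolding g_def using that Pr_pos[OF that] V_nonneg[OF that] a01 t_nonneg[OF that] by simp
  \<comment> \<open>\<open>nat\<close> stops the remaining target at 0 once it is reached. Before
    that, each ceiling overshoots by at most \<open>h\<close>, which the reserve in the assumption
    on \<open>\<sigma>\<close> absorbs.\<close>
  define \<tau> where "\<tau> = rec_nat \<sigma> (\<lambda>j r. nat \<lceil>(real r * h - g j) / h\<rceil>)"
  have \<tau>0: "\<tau> 0 = \<sigma>" and \<tau>S: "\<tau> (Suc j) = nat \<lceil>(real (\<tau> j) * h - g j) / h\<rceil>" for j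
    by (simp_all add: \<tau>_def)
  have \<tau>_step: "real (\<tau> j) * h \<le> g j + real (\<tau> (Suc j)) * h" for j
  proof -
    have "(real (\<tau> j) * h - g j) / h \<le> real (\<tau> (Suc j))"
      unfolding \<tau>S by (rule real_nat_ceiling_ge)
    then show ?thesis using h_pos by (simp add: field_simps)
  qed
  have \<tau>_le: "j \<le> m \<Longrightarrow> \<tau> j \<le> n" for j
  proof (induction j)
    case (Suc j)
    have "(real (\<tau> j) * h - g j) / h \<le> real (\<tau> j)"
      using g_nonneg[of j] Suc(2) h_pos by (simp add: field_simps)
    then have "\<tau> (Suc j) \<le> \<tau> j"
      unfolding \<tau>S by (simp add: ceiling_le_iff nat_le_iff)
    then show ?case using Suc by simp
  qed (simp add: \<tau>0 \<sigma>)
  have \<tau>_bound: "j \<le> m \<Longrightarrow> real (\<tau> j) * h \<le> max 0 ((\<Sum>l\<in>{j..<m}. g l) - (real m - real j) * h)" for j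
  proof (induction j)
    case 0
    have "(\<Sum>j<m. Pr j * (V j * X j + s (N j))) \<le> (\<Sum>l<m. g l)"
      unfolding g_def
    proof (intro sum_mono mult_left_mono add_mono order_refl)
      fix i assume i: "i \<in> {..<m}"
      show "X i \<le> a i" using xs_lower[of i] \<xi>_ge[of i] i by (simp add: a_def)
      show "0 \<le> V i" using V_nonneg[of i] i by simp
      show "0 \<le> Pr i" using Pr_pos[of i] i by simp
    qed
    then show ?case using \<sigma>(2) by (simp add: \<tau>0 lessThan_atLeast0)
  next
    case (Suc j)
    then have IH: "real (\<tau> j) * h \<le> max 0 ((\<Sum>l\<in>{j..<m}. g l) - (real m - real j) * h)" by simp
    show ?case
    proof (cases "\<tau> (Suc j) = 0")
      case False
      define y where "y = (real (\<tau> j) * h - g j) / h"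
      have "real (\<tau> (Suc j)) \<le> y + 1" using False unfolding \<tau>S y_def[symmetric] by linarith
      then have le: "real (\<tau> (Suc j)) * h \<le> real (\<tau> j) * h - g j + h"
        using h_pos by (simp add: y_def field_simps)
      have "\<not> real (\<tau> j) * h - g j \<le> 0"
      proof
        assume "real (\<tau> j) * h - g j \<le> 0"
        then have "y \<le> 0" using h_pos by (simp add: y_def divide_nonpos_pos)
        then show False using False unfolding \<tau>S y_def[symmetric] by (simp add: ceiling_le_iff)
      qed
      then have "0 < real (\<tau> j) * h" using g_nonneg[of j] Suc(2) by simp
      then have "real (\<tau> j) * h \<le> (\<Sum>l\<in>{j..<m}. g l) - (real m - real j) * h"
        using IH by linarith
      then show ?thesis using le Suc(2) by (simp add: sum.atLeast_Suc_lessThan algebra_simps)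
    qed simp
  qed
  have \<tau>m: "\<tau> m = 0"
  proof -
    have "real (\<tau> m) * h \<le> 0" using \<tau>_bound[of m] by simp
    then show ?thesis using h_pos by (simp add: mult_le_0_iff)
  qed
  \<comment> \<open>A cell stores the slope chosen one value earlier, hence the shift; the first
    cell carries the trivial bound 0.\<close>
  define xp where "xp j = (case j of 0 \<Rightarrow> 0 | Suc i \<Rightarrow> \<xi> i)" for j
  have xp_mono: "xp j \<le> \<xi> j" if "j < m" for j
    using \<xi>_mono[of "j - 1"] that by (auto simp: xp_def split: nat.split)
  \<comment> \<open>Built backwards from the last table, because the bound on an entry needs the
    bound on its successor. The final cell must have \<open>b = 0\<close>; dropping to 0 is allowed
    as \<open>b\<close> is only a lower bound.\<close>
  have path: "\<exists>e\<in>T j. b e = real (if j < m then \<beta> j else 0) * h \<and> x e = real (xp j) / real n \<and> s e = real (\<tau> j) * h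
      \<and> D e \<le> (\<Sum>l\<in>{j..<m}. a l * gap l * tail l)" if "j \<le> m" for j
    using that
  proof (induction rule: inc_induct)
    case base
    have "xp m \<le> n" using m_pos \<xi>_le_n[of "m - 1"] by (auto simp: xp_def split: nat.split)
    then obtain e where "e \<in> T m" "b e = real 0 * h" "x e = real (xp m) / real n" "s e = real 0 * h"
      using grid_ex[of m 0 "xp m" 0] by auto
    then show ?case using D_final[of e] \<tau>m by auto
  next
    case (step j)
    then obtain e' where e': "e' \<in> T (Suc j)" "b e' = real (if Suc j < m then \<beta> (Suc j) else 0) * h"
      "x e' = real (xp (Suc j)) / real n" "s e' = real (\<tau> (Suc j)) * h"
      "D e' \<le> (\<Sum>l\<in>{Suc j..<m}. a l * gap l * tail l)" by auto
    have "xp j \<le> n" using xp_mono[of j] \<xi>_le_n[of j] step by simp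
    then obtain e where e: "e \<in> T j" "b e = real (\<beta> j) * h" "x e = real (xp j) / real n"
      "s e = real (\<tau> j) * h"
      using grid_ex[of j "\<beta> j" "xp j" "\<tau> j"] \<beta>_le \<tau>_le[of j] step by auto
    have x': "x e' = a j" using e' by (simp add: xp_def a_def)
    have "D e \<le> x e' * gap j * tail j + D e'"
      unfolding gap_def tail_def
    proof (rule D_upper)
      show "j < m" "e \<in> T j" "e' \<in> T (Suc j)" "N j \<in> ND" using step e e' N by auto
      show "x e \<le> x e'" using xp_mono[of j] step x' e by (simp add: a_def divide_right_mono)
      have "b e' \<le> b e + x e' * gap j"
        using \<beta>_step[of j] e e' x' a01[of j] gap_nonneg[of j] h_pos by auto
      then show "b e' \<le> b e + x e' * (if Suc j < m then V (Suc j) - V j else 0)"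
        by (simp add: gap_def)
      have "0 \<le> (real m - real j) * h" using step h_pos by simp
      then have "min (B j) S + sl \<le> real (\<beta> j) * h" using \<beta>_ge[of j] step by linarith
      then show "b (N j) + D (N j) \<le> b e" using N[of j] step e by simp
      show "s e \<le> Pr j * (V j * x e' + s (N j)) + s e'"
        using \<tau>_step[of j] e e' x' by (simp add: g_def)
    qed
    then have "D e \<le> (\<Sum>l\<in>{j..<m}. a l * gap l * tail l)"
      using e'(5) x' step by (simp add: sum.atLeast_Suc_lessThan)
    then show ?case using e step by auto
  qed
  from path[of 0] m_pos obtain e where e: "e \<in> T 0" "b e = real (\<beta> 0) * h" "s e = real \<sigma> * h"
    "D e \<le> (\<Sum>l<m. a l * gap l * tail l)"
    by (auto simp: \<tau>0 lessThan_atLeast0)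
  have gaps: "(\<Sum>l<m. gap l * tail l) \<le> V (m - 1)"
  proof -
    have "(\<Sum>l<m. gap l * tail l) = (\<Sum>j<m. Pr j * (0 + (\<Sum>l<j. gap l)))"
      unfolding expectation_increments by simp
    also have "\<dots> \<le> (\<Sum>j<m. Pr j * V (m - 1))"
    proof (intro sum_mono mult_left_mono)
      fix j assume j: "j \<in> {..<m}"
      then have "j = m - 1 \<or> j < m - 1" by auto
      then have "V j \<le> V (m - 1)" using V_less[of j "m - 1"] m_pos by auto
      then show "0 + (\<Sum>l<j. gap l) \<le> V (m - 1)"
        using sum_gap[of 0 j] j V_nonneg[of 0] m_pos by (simp add: lessThan_atLeast0)
    qed (use Pr_pos in \<open>auto intro: less_imp_le\<close>)
    finally show ?thesis by (simp add: sum_distrib_right[symmetric] Pr_sum)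
  qed
  \<comment> \<open>\<open>c1\<close> and \<open>c2\<close> bound the charges for the two sides of
    the \<open>min\<close>: slopes are at most 1, and they exceed the true slopes by at most
    \<open>1 / real n\<close>.\<close>
  have c1: "(\<Sum>l<m. a l * gap l * tail l) \<le> V (m - 1)"
  proof -
    have "(\<Sum>l<m. a l * gap l * tail l) \<le> (\<Sum>l<m. gap l * tail l)"
      using a01 gap_nonneg tail_nonneg
      by (intro sum_mono) (auto intro!: mult_right_mono mult_left_le_one_le)
    then show ?thesis using gaps by simp
  qed
  have c2: "(\<Sum>l<m. a l * gap l * tail l) \<le> (\<Sum>j<m. Pr j * B j) - B 0 + V (m - 1) / real n"
  proof -
    have "(\<Sum>l<m. a l * gap l * tail l) \<le> (\<Sum>l<m. (xs l + 1 / real n) * gap l * tail l)"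
      using \<xi>_le gap_nonneg tail_nonneg by (intro sum_mono mult_right_mono) (auto simp: a_def)
    also have "\<dots> = (\<Sum>l<m. xs l * gap l * tail l) + (\<Sum>l<m. gap l * tail l) / real n"
      by (simp add: sum.distrib sum_divide_distrib algebra_simps)
    also have "\<dots> \<le> (\<Sum>l<m. xs l * gap l * tail l) + V (m - 1) / real n"
      using gaps by (intro add_left_mono divide_right_mono) auto
    also have "(\<Sum>l<m. xs l * gap l * tail l) = (\<Sum>j<m. Pr j * (B 0 + (\<Sum>l<j. xs l * gap l))) - B 0"
      unfolding expectation_increments by simp
    also have "(\<Sum>j<m. Pr j * (B 0 + (\<Sum>l<j. xs l * gap l))) = (\<Sum>j<m. Pr j * B j)"
    proof (intro sum.cong refl, goal_cases)
      case (1 j)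
      have "i \<le> j \<Longrightarrow> B 0 + (\<Sum>l<i. xs l * gap l) = B i" for i
      proof (induction i)
        case (Suc i)
        then show ?case using xs_gap[of i] 1 by simp
      qed simp
      then show ?case by simp
    qed
    finally show ?thesis by simp
  qed
  have V1: "0 \<le> V (m - 1) / real n" using V_nonneg[of "m - 1"] m_pos by simp
  have "b e + D e \<le> min (\<Sum>j<m. Pr j * B j) (S + V (m - 1)) + sl + (real m + 1) * h + V (m - 1) / real n"
    using e \<beta>0_le c1 c2 V1 by linarith
  then show ?thesis using e by auto
qed

text \<open>Provides a start cell of nonnegative score, so that the best start cell cannot be one
  with an infinite entry.\<close>

lemma zero_cell:
  assumes N: "N \<in> ND" "b N + D N \<le> 0" "s N = 0"
  shows "\<exists>e\<in>T 0. b e = 0 \<and> s e = 0 \<and> D e \<le> 0"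
proof -
  have "\<exists>e\<in>T j. b e = 0 \<and> x e = 0 \<and> s e = 0 \<and> D e \<le> 0" if "j \<le> m" for j
    using that
  proof (induction rule: inc_induct)
    case base
    obtain e where "e \<in> T m" "b e = real 0 * h" "x e = real 0 / real n" "s e = real 0 * h"
      using grid_ex[of m 0 0 0] by auto
    then show ?case using D_final[of e] by auto
  next
    case (step j)
    then obtain e' where e': "e' \<in> T (Suc j)" "b e' = 0" "x e' = 0" "s e' = 0" "D e' \<le> 0" by auto
    obtain e where e: "e \<in> T j" "b e = real 0 * h" "x e = real 0 / real n" "s e = real 0 * h"
      using grid_ex[of j 0 0 0] step by auto
    from D_upper[OF step(2) e(1) e'(1) N(1)] e e' N have "D e \<le> 0" by auto
    then show ?case using e by auto
  qed
  from this[of 0] show ?thesis by auto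
qed

lemma b_bounds: "j \<le> m \<Longrightarrow> e \<in> T j \<Longrightarrow> 0 \<le> b e \<and> b e \<le> real n * h"
  and s_bounds: "j \<le> m \<Longrightarrow> e \<in> T j \<Longrightarrow> 0 \<le> s e \<and> s e \<le> real n * h"
  using grid[of j e] h_pos by auto

end

section \<open>Expected utilities and state machines\<close>

lemma length_hist [simp]: "length (hist v i) = i"
  by (simp add: hist_def)

lemma hist_0 [simp]: "hist v 0 = []"
  by (simp add: hist_def)

lemma hist_Suc: "hist v (Suc i) = hist v i @ [v (Suc i)]"
  by (simp add: hist_def)

lemma hist_cong: "(\<And>j. 1 \<le> j \<Longrightarrow> j \<le> i \<Longrightarrow> v j = v' j) \<Longrightarrow> hist v i = hist v' i"
  by (auto simp: hist_def)

lemma hist_upd [simp]: "i < j \<Longrightarrow> hist (v(j := a)) i = hist v i"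
  by (rule hist_cong) auto

lemma supported_upd: "supported f i v \<Longrightarrow> a \<in> set_pmf (f (Suc i)) \<Longrightarrow> supported f (Suc i) (v(Suc i := a))"
  by (auto simp: supported_def)

lemma supported_SucD: "supported f (Suc i) v \<Longrightarrow> supported f i v \<and> v (Suc i) \<in> set_pmf (f (Suc i))"
  by (auto simp: supported_def)

text \<open>A common form for future utility, welfare and revenue, so that one recursion over the
  days serves all three.\<close>

definition later ::
  "nat \<Rightarrow> (nat \<Rightarrow> real pmf) \<Rightarrow> ((nat \<Rightarrow> real) \<Rightarrow> nat \<Rightarrow> real) \<Rightarrow> nat \<Rightarrow> (nat \<Rightarrow> real) \<Rightarrow> real" where
  "later k f g i v = measure_pmf.expectation (Pi_pmf {i<..k} 0 f)
     (\<lambda>w. \<Sum>j\<in>{i<..k}. g (override_on v w {i<..k}) j)"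

lemma later_top: "later k f g k v = 0"
  by (simp add: later_def)

lemma finite_set_Pi_pmf:
  assumes "instance_ok k f"
  shows "finite (set_pmf (Pi_pmf {i<..k} 0 f))"
  using assms by (subst set_Pi_pmf) (auto simp: instance_ok_def intro!: finite_PiE_dflt)

lemma integrable_Pi_pmf:
  fixes g :: "(nat \<Rightarrow> real) \<Rightarrow> real"
  assumes "instance_ok k f"
  shows "integrable (measure_pmf (Pi_pmf {i<..k} 0 f)) g"
  by (rule integrable_measure_pmf_finite[OF finite_set_Pi_pmf[OF assms]])

text \<open>The value of the next day is drawn first from the product distribution. By the
  assumption on \<open>g\<close>, the summand of that day ignores later values and leaves the inner
  expectation.\<close>

lemma later_step:
  assumes ok: "instance_ok k f" and i: "i < k"
    and cong: "\<And>u u' j. 1 \<le> j \<Longrightarrow> (\<And>l. 1 \<le> l \<Longrightarrow> l \<le> j \<Longrightarrow> u l = u' l) \<Longrightarrow> g u j = g u' j"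
  shows "later k f g i v = (\<Sum>a\<in>set_pmf (f (Suc i)). pmf (f (Suc i)) a *
    (g (v(Suc i := a)) (Suc i) + later k f g (Suc i) (v(Suc i := a))))"
proof -
  have ins: "{i<..k} = insert (Suc i) {Suc i<..k}" using i by auto
  have fin: "finite (set_pmf (f (Suc i)))" using ok i by (auto simp: instance_ok_def)
  have "later k f g i v = measure_pmf.expectation (f (Suc i) \<bind> (\<lambda>a. map_pmf (\<lambda>w. w(Suc i := a)) (Pi_pmf {Suc i<..k} 0 f)))
     (\<lambda>w. \<Sum>j\<in>{i<..k}. g (override_on v w {i<..k}) j)"
    unfolding later_def by (subst ins, subst Pi_pmf_insert') (auto simp: map_pmf_def)
  also have "\<dots> = (\<Sum>a\<in>set_pmf (f (Suc i)). pmf (f (Suc i)) a *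
    measure_pmf.expectation (Pi_pmf {Suc i<..k} 0 f)
      (\<lambda>w. \<Sum>j\<in>{i<..k}. g (override_on v (w(Suc i := a)) {i<..k}) j))"
    by (subst pmf_expectation_bind[OF fin]) (auto simp: finite_set_Pi_pmf[OF ok])
  also have "\<dots> = (\<Sum>a\<in>set_pmf (f (Suc i)). pmf (f (Suc i)) a *
    (g (v(Suc i := a)) (Suc i) + later k f g (Suc i) (v(Suc i := a))))"
  proof (intro sum.cong refl arg_cong2[where f = "(*)"], goal_cases)
    case (1 a)
    have ov: "override_on v (w(Suc i := a)) {i<..k} = override_on (v(Suc i := a)) w {Suc i<..k}" for w
      using i by (auto simp: override_on_def fun_eq_iff)
    have g1: "g (override_on (v(Suc i := a)) w {Suc i<..k}) (Suc i) = g (v(Suc i := a)) (Suc i)" for w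
      by (rule cong) auto
    have "(\<Sum>j\<in>{i<..k}. g (override_on v (w(Suc i := a)) {i<..k}) j) =
      g (v(Suc i := a)) (Suc i) + (\<Sum>j\<in>{Suc i<..k}. g (override_on (v(Suc i := a)) w {Suc i<..k}) j)" for w
      unfolding ov by (subst ins, subst sum.insert) (auto simp: g1)
    then show ?case
      by (simp add: later_def Bochner_Integration.integral_add integrable_Pi_pmf[OF ok])
  qed
  finally show ?thesis .
qed

lemma later_diff:
  assumes "instance_ok k f"
  shows "later k f (\<lambda>u j. g u j - g' u j) i v = later k f g i v - later k f g' i v"
  by (simp add: later_def sum_subtractf Bochner_Integration.integral_diff integrable_Pi_pmf[OF assms])

lemma day_utility_cong:
  "1 \<le> j \<Longrightarrow> (\<And>l. 1 \<le> l \<Longrightarrow> l \<le> j \<Longrightarrow> u l = u' l) \<Longrightarrow> day_utility x p u u j = day_utility x p u' u' j"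
  using hist_cong[of j u u'] by (simp add: day_utility_def)

text \<open>Utilities of later days depend on the past only through the reports. This makes the true
  history irrelevant and a promise a function of the reports.\<close>

lemma continuation_utility_later:
  "continuation_utility k f x p i v r = day_utility x p v r i + later k f (\<lambda>u. day_utility x p u u) i r"
proof -
  have "(\<Sum>j\<in>{i<..k}. day_utility x p (override_on v w {i<..k}) (override_on r w {i<..k}) j) =
    (\<Sum>j\<in>{i<..k}. day_utility x p (override_on r w {i<..k}) (override_on r w {i<..k}) j)" for w
    by (rule sum.cong) (simp_all add: day_utility_def)
  then show ?thesis by (simp only: continuation_utility_def later_def)
qed

lemma revenue_later: "revenue k f p = later k f (\<lambda>u j. p j (hist u j)) 0 v"
proof -
  have "(\<Sum>i\<in>{1..k}. p i (hist w i)) = (\<Sum>j\<in>{0<..k}. p j (hist (override_on v w {0<..k}) j))" for w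
  proof (rule sum.cong)
    fix j assume "j \<in> {0<..k}"
    then have "hist w j = hist (override_on v w {0<..k}) j" by (intro hist_cong) auto
    then show "p j (hist w j) = p j (hist (override_on v w {0<..k}) j)" by simp
  qed auto
  moreover have "{1..k} = {0<..k}" by auto
  ultimately show ?thesis by (simp only: revenue_def later_def)
qed

definition welf :: "rule \<Rightarrow> (nat \<Rightarrow> real) \<Rightarrow> nat \<Rightarrow> real" where
  "welf x u j = u j * x j (hist u j)"

lemma welf_cong:
  "1 \<le> j \<Longrightarrow> (\<And>l. 1 \<le> l \<Longrightarrow> l \<le> j \<Longrightarrow> u l = u' l) \<Longrightarrow> welf x u j = welf x u' j"
  using hist_cong[of j u u'] by (simp add: welf_def)

lemma revenue_eq:
  assumes "instance_ok k f"
  shows "revenue k f p = later k f (welf x) 0 v - later k f (\<lambda>u. day_utility x p u u) 0 v"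
  unfolding revenue_later[where v = v] later_diff[OF assms, symmetric]
  by (simp add: welf_def day_utility_def)

subsection \<open>Mechanisms given by state machines\<close>

definition run_state :: "(nat \<Rightarrow> 'e \<Rightarrow> real \<Rightarrow> 'e) \<Rightarrow> 'e \<Rightarrow> real list \<Rightarrow> 'e" where
  "run_state nxt e0 rs = snd (foldl (\<lambda>(i, e) a. (Suc i, nxt i e a)) (1, e0) rs)"

lemma run_state_Nil [simp]: "run_state nxt e0 [] = e0"
  by (simp add: run_state_def)

lemma run_state_snoc: "run_state nxt e0 (rs @ [a]) = nxt (Suc (length rs)) (run_state nxt e0 rs) a"
proof -
  have "fst (foldl (\<lambda>(i, e) a. (Suc i, nxt i e a)) (1, e0) rs) = Suc (length rs)"
    by (induction rs rule: rev_induct) (auto simp: split_beta)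
  then show ?thesis by (simp add: run_state_def split_beta)
qed

text \<open>A day-by-day certificate of a mechanism: \<open>B\<close> is the interim utility,
  \<open>u\<close> the promise that is kept with equality, \<open>w\<close> a welfare that need only
  be reached. \<open>G\<close> is a family of state sets closed under the transitions.\<close>

locale state_mechanism =
  fixes k :: nat and f :: "nat \<Rightarrow> real pmf" and G :: "nat \<Rightarrow> 'e set"
    and X B :: "nat \<Rightarrow> 'e \<Rightarrow> real \<Rightarrow> real" and nxt :: "nat \<Rightarrow> 'e \<Rightarrow> real \<Rightarrow> 'e"
    and u w :: "nat \<Rightarrow> 'e \<Rightarrow> real" and e0 :: 'e
  assumes ok: "instance_ok k f" and start: "e0 \<in> G 1"
    and step: "\<And>i e a. i \<in> {1..k} \<Longrightarrow> e \<in> G i \<Longrightarrow> a \<in> set_pmf (f i) \<Longrightarrow>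
      X i e a \<in> {0..1} \<and> nxt i e a \<in> G (Suc i) \<and> u (Suc i) (nxt i e a) \<le> B i e a"
    and ic: "\<And>i e a a'. i \<in> {1..k} \<Longrightarrow> e \<in> G i \<Longrightarrow> a \<in> set_pmf (f i) \<Longrightarrow> a' \<in> set_pmf (f i) \<Longrightarrow>
      B i e a' + (a - a') * X i e a' \<le> B i e a"
    and promise: "\<And>i e. i \<in> {1..k} \<Longrightarrow> e \<in> G i \<Longrightarrow> (\<Sum>a\<in>set_pmf (f i). pmf (f i) a * B i e a) = u i e"
    and target: "\<And>i e. i \<in> {1..k} \<Longrightarrow> e \<in> G i \<Longrightarrow>
      w i e \<le> (\<Sum>a\<in>set_pmf (f i). pmf (f i) a * (a * X i e a + w (Suc i) (nxt i e a)))"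
    and final: "\<And>e. e \<in> G (Suc k) \<Longrightarrow> u (Suc k) e = 0 \<and> w (Suc k) e = 0"
begin

abbreviation st :: "real list \<Rightarrow> 'e" where "st \<equiv> run_state nxt e0"

definition alloc_rule :: rule where
  "alloc_rule i rs = X i (st (butlast rs)) (last rs)"

text \<open>The payment leaves the buyer, on this day, the interim utility minus the promise of the
  next state; that this difference is nonnegative is ex-post individual rationality.\<close>

definition pay_rule :: rule where
  "pay_rule i rs = last rs * X i (st (butlast rs)) (last rs) -
     (B i (st (butlast rs)) (last rs) - u (Suc i) (nxt i (st (butlast rs)) (last rs)))"

lemma st_hist_Suc: "st (hist v (Suc i)) = nxt (Suc i) (st (hist v i)) (v (Suc i))"
  by (simp add: hist_Suc run_state_snoc)

lemma alloc_hist: "alloc_rule (Suc i) (hist v (Suc i)) = X (Suc i) (st (hist v i)) (v (Suc i))"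
  by (simp add: alloc_rule_def hist_Suc)

lemma pay_hist: "pay_rule (Suc i) (hist v (Suc i)) = v (Suc i) * X (Suc i) (st (hist v i)) (v (Suc i)) -
    (B (Suc i) (st (hist v i)) (v (Suc i)) - u (Suc (Suc i)) (st (hist v (Suc i))))"
  by (simp add: pay_rule_def hist_Suc run_state_snoc)

lemma st_in: "i \<le> k \<Longrightarrow> supported f i v \<Longrightarrow> st (hist v i) \<in> G (Suc i)"
proof (induction i)
  case (Suc i)
  then show ?case
    using step[of "Suc i" "st (hist v i)" "v (Suc i)"] supported_SucD[of f i v] by (auto simp: st_hist_Suc)
qed (use start in simp)

lemma later_utility:
  assumes "i \<le> k" "supported f i v"
  shows "later k f (\<lambda>u. day_utility alloc_rule pay_rule u u) i v = u (Suc i) (st (hist v i))"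
  using assms
proof (induction arbitrary: v rule: inc_induct)
  case base
  then show ?case using final st_in[of k v] by (simp add: later_top)
next
  case (step i)
  have "later k f (\<lambda>u. day_utility alloc_rule pay_rule u u) i v = (\<Sum>a\<in>set_pmf (f (Suc i)). pmf (f (Suc i)) a *
    (day_utility alloc_rule pay_rule (v(Suc i := a)) (v(Suc i := a)) (Suc i) +
     later k f (\<lambda>u. day_utility alloc_rule pay_rule u u) (Suc i) (v(Suc i := a))))"
    by (rule later_step[OF ok]) (use step in \<open>auto intro!: day_utility_cong\<close>)
  also have "\<dots> = (\<Sum>a\<in>set_pmf (f (Suc i)). pmf (f (Suc i)) a * B (Suc i) (st (hist v i)) a)"
  proof (intro sum.cong refl arg_cong2[where f = "(*)"], goal_cases)
    case (1 a)
    have "day_utility alloc_rule pay_rule (v(Suc i := a)) (v(Suc i := a)) (Suc i) =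
      B (Suc i) (st (hist v i)) a - u (Suc (Suc i)) (st (hist (v(Suc i := a)) (Suc i)))"
      by (simp add: day_utility_def alloc_hist pay_hist)
    then show ?case using step.IH[OF supported_upd[OF step.prems 1]] by linarith
  qed
  also have "\<dots> = u (Suc i) (st (hist v i))"
    using step st_in[of i v] by (intro promise) auto
  finally show ?case .
qed

lemma later_welfare:
  assumes "i \<le> k" "supported f i v"
  shows "w (Suc i) (st (hist v i)) \<le> later k f (welf alloc_rule) i v"
  using assms
proof (induction arbitrary: v rule: inc_induct)
  case base
  then show ?case using final st_in[of k v] by (simp add: later_top)
next
  case (step i)
  have "w (Suc i) (st (hist v i)) \<le> (\<Sum>a\<in>set_pmf (f (Suc i)). pmf (f (Suc i)) a *
     (a * X (Suc i) (st (hist v i)) a + w (Suc (Suc i)) (nxt (Suc i) (st (hist v i)) a)))"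
    using step st_in[of i v] by (intro target) auto
  also have "\<dots> \<le> (\<Sum>a\<in>set_pmf (f (Suc i)). pmf (f (Suc i)) a *
    (welf alloc_rule (v(Suc i := a)) (Suc i) + later k f (welf alloc_rule) (Suc i) (v(Suc i := a))))"
  proof (intro sum_mono mult_left_mono, goal_cases)
    case (1 a)
    have "welf alloc_rule (v(Suc i := a)) (Suc i) = a * X (Suc i) (st (hist v i)) a"
      by (simp add: welf_def alloc_hist)
    moreover have "st (hist (v(Suc i := a)) (Suc i)) = nxt (Suc i) (st (hist v i)) a"
      by (simp add: st_hist_Suc)
    moreover have "w (Suc (Suc i)) (st (hist (v(Suc i := a)) (Suc i))) \<le> later k f (welf alloc_rule) (Suc i) (v(Suc i := a))"
      by (rule step.IH[OF supported_upd[OF step.prems 1]])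
    ultimately show ?case by simp
  qed auto
  also have "\<dots> = later k f (welf alloc_rule) i v"
    by (rule later_step[OF ok, symmetric]) (use step in \<open>auto intro!: welf_cong\<close>)
  finally show ?case .
qed

text \<open>Since promises are kept exactly, a misreport is worth the interim utility of the
  reported value plus the value difference times its allocation. The constraint on the whole future
  thus reduces to the one-day inequality \<open>ic\<close>.\<close>

lemma mechanism_feasible: "feasible k f alloc_rule pay_rule"
  unfolding feasible_def
proof (intro conjI ballI allI impI)
  fix i v assume i: "i \<in> {1..k}" and v: "supported f i v"
  then obtain i' where i': "i = Suc i'" by (cases i) auto
  show "alloc_rule i (hist v i) \<in> {0..1}"
    using i v step[of i "st (hist v i')" "v i"] st_in[of i' v] supported_SucD[of f i' v]
    unfolding i' alloc_hist by auto
next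
  show "periodic_ic k f alloc_rule pay_rule"
    unfolding periodic_ic_def
  proof (intro ballI allI impI)
    fix i v v' assume i: "i \<in> {1..k}" and v: "supported f i v" and v': "v' \<in> set_pmf (f i)"
    then obtain i' where i': "i = Suc i'" by (cases i) auto
    have v1: "supported f i' v" "v i \<in> set_pmf (f i)" using v by (auto simp: i' supported_def)
    have s': "supported f i (v(i := v'))" using v1 v' by (auto simp: i' supported_def)
    have *: "continuation_utility k f alloc_rule pay_rule i v r =
      B i (st (hist v i')) (r i) + (v i - r i) * X i (st (hist v i')) (r i)"
      if "supported f i r" "hist r i' = hist v i'" for r
      using later_utility[of i r] that i
      by (simp add: continuation_utility_later day_utility_def alloc_hist pay_hist i' algebra_simps)
    have "continuation_utility k f alloc_rule pay_rule i v (v(i := v')) =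
      B i (st (hist v i')) v' + (v i - v') * X i (st (hist v i')) v'"
      using *[OF s'] by (simp add: i')
    also have "\<dots> \<le> B i (st (hist v i')) (v i)"
      using i v1 v' st_in[of i' v] by (intro ic) (auto simp: i')
    also have "\<dots> = continuation_utility k f alloc_rule pay_rule i v v"
      using *[OF v] by simp
    finally show "continuation_utility k f alloc_rule pay_rule i v (v(i := v'))
      \<le> continuation_utility k f alloc_rule pay_rule i v v" .
  qed
  show "ex_post_ir k f alloc_rule pay_rule"
    unfolding ex_post_ir_def
  proof (intro ballI allI impI)
    fix i v assume i: "i \<in> {1..k}" and v: "supported f i v"
    then obtain i' where i': "i = Suc i'" by (cases i) auto
    show "0 \<le> day_utility alloc_rule pay_rule v v i"
      using i v step[of i "st (hist v i')" "v i"] st_in[of i' v] supported_SucD[of f i' v]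
      unfolding day_utility_def i' alloc_hist pay_hist st_hist_Suc by auto
  qed
qed

lemma mechanism_revenue: "w 1 e0 - u 1 e0 \<le> revenue k f pay_rule"
  using later_utility[of 0 "\<lambda>_. 0"] later_welfare[of 0 "\<lambda>_. 0"]
  by (subst revenue_eq[OF ok, where x = alloc_rule and v = "\<lambda>_. 0"]) (simp add: supported_def)

end

section \<open>Composing the days\<close>

definition supp :: "(nat \<Rightarrow> real pmf) \<Rightarrow> nat \<Rightarrow> nat" where
  "supp f i = card (set_pmf (f i))"

definition val :: "(nat \<Rightarrow> real pmf) \<Rightarrow> nat \<Rightarrow> nat \<Rightarrow> real" where
  "val f i j = sorted_list_of_set (set_pmf (f i)) ! j"

definition prob :: "(nat \<Rightarrow> real pmf) \<Rightarrow> nat \<Rightarrow> nat \<Rightarrow> real" where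
  "prob f i j = pmf (f i) (val f i j)"

definition idx :: "(nat \<Rightarrow> real pmf) \<Rightarrow> nat \<Rightarrow> real \<Rightarrow> nat" where
  "idx f i a = (THE j. j < supp f i \<and> val f i j = a)"

context
  fixes k f i assumes ok: "instance_ok k f" and i: "i \<in> {1..k}"
begin

lemma fin: "finite (set_pmf (f i))"
  using ok i by (simp add: instance_ok_def)

lemma val_bij: "bij_betw (val f i) {..<supp f i} (set_pmf (f i))"
  unfolding val_def supp_def
  by (rule bij_betw_nth) (auto simp: fin)

lemma val_in: "j < supp f i \<Longrightarrow> val f i j \<in> set_pmf (f i)"
  using val_bij by (auto simp: bij_betw_def)

lemma supp_pos: "0 < supp f i"
  using fin set_pmf_not_empty[of "f i"] by (auto simp: supp_def card_gt_0_iff)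

lemma val_less: "j < j' \<Longrightarrow> j' < supp f i \<Longrightarrow> val f i j < val f i j'"
  using strict_sorted_list_of_set[of "set_pmf (f i)"]
  by (auto simp: val_def supp_def sorted_wrt_iff_nth_less)

lemma val_nonneg: "j < supp f i \<Longrightarrow> 0 \<le> val f i j"
  using val_in ok i by (auto simp: instance_ok_def)

lemma prob_pos: "j < supp f i \<Longrightarrow> 0 < prob f i j"
  using val_in[of j] by (simp add: prob_def pmf_positive)

lemma sum_support: "(\<Sum>a\<in>set_pmf (f i). g a) = (\<Sum>j<supp f i. g (val f i j))"
  using sum.reindex_bij_betw[OF val_bij, of g] by simp

lemma prob_sum: "(\<Sum>j<supp f i. prob f i j) = 1"
  using sum_support[of "pmf (f i)"] sum_pmf_eq_1[OF fin, of "f i"] by (simp add: prob_def)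

lemma idx_val: "j < supp f i \<Longrightarrow> idx f i (val f i j) = j"
  unfolding idx_def using val_bij by (intro the_equality) (auto simp: bij_betw_def inj_on_def)

lemma supportE:
  assumes "a \<in> set_pmf (f i)"
  obtains j where "j < supp f i" "a = val f i j" "idx f i a = j"
  using assms val_bij idx_val by (auto simp: bij_betw_def image_iff)

end

text \<open>One table \<open>T0\<close> is the end of every day and also the start of the fictitious
  day \<open>k + 1\<close>: in both roles nothing may be left to pay or to reach.
  \<open>room\<close> makes the grid wide enough for all values plus the total error.\<close>

locale dp_tables =
  fixes k :: nat and f :: "nat \<Rightarrow> real pmf" and h :: real and n :: nat
    and b x s D :: "'e \<Rightarrow> real" and nx nd :: "'e \<Rightarrow> 'e"
    and T :: "nat \<Rightarrow> nat \<Rightarrow> 'e set" and T0 :: "'e set"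
  assumes ok: "instance_ok k f"
    and day: "\<And>i. i \<in> {1..k} \<Longrightarrow> day_dp (supp f i) (val f i) (prob f i) h n b x s D nx nd
      (\<lambda>j. if j = supp f i then T0 else T i j) (if i = k then T0 else T (Suc i) 0)"
    and h_pos: "0 < h" and n_pos: "0 < n"
    and room: "(\<Sum>i\<in>{1..k}. \<Sum>a\<in>set_pmf (f i). a) + 4 * (1 + 2 * real (\<Sum>i\<in>{1..k}. supp f i)) * h \<le> real n * h"
begin

text \<open>Indexed by the number of days already over: \<open>first 0\<close> is the start table,
  \<open>first k\<close> the terminal one.\<close>

definition first :: "nat \<Rightarrow> 'e set" where
  "first i = (if i = k then T0 else T (Suc i) 0)"

definition types :: real where
  "types = real (\<Sum>i\<in>{1..k}. supp f i)"

text \<open>Welfare lost after day \<open>i\<close>: one \<open>h\<close> for each value processed,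
  and one more per day for rounding the targets handed to the next day.\<close>

definition err :: "nat \<Rightarrow> real" where
  "err i = (\<Sum>l\<in>{i<..k}. real (supp f l) + 1) * h"

definition top_val :: "nat \<Rightarrow> real" where
  "top_val i = (\<Sum>l\<in>{i<..k}. val f l (supp f l - 1))"

text \<open>Promise in excess of the true utility. Its first part is the reserve and the rounding of
  the starting utility of each day, its second part the rounding of slopes to multiples of
  \<open>1 / real n\<close>.\<close>

definition slack :: "nat \<Rightarrow> real" where
  "slack i = err i + top_val i / real n"

lemma types_nonneg: "0 \<le> types * h"
  using h_pos by (simp add: types_def sum_nonneg)

lemma room': "(\<Sum>i\<in>{1..k}. \<Sum>a\<in>set_pmf (f i). a) + 4 * h + 8 * (types * h) \<le> real n * h"
  using room by (simp add: types_def algebra_simps del: of_nat_sum)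

lemma k_pos: "1 \<le> k" using ok by (simp add: instance_ok_def)

lemma day': "i < k \<Longrightarrow> day_dp (supp f (Suc i)) (val f (Suc i)) (prob f (Suc i)) h n b x s D nx nd
      (\<lambda>j. if j = supp f (Suc i) then T0 else T (Suc i) j) (first (Suc i))"
  using day[of "Suc i"] by (simp add: first_def)

lemma insert_day: "i < k \<Longrightarrow> {i<..k} = insert (Suc i) {Suc i<..k}"
  by auto

lemma err_step: "i < k \<Longrightarrow> err i = err (Suc i) + (real (supp f (Suc i)) + 1) * h"
  by (simp add: err_def insert_day distrib_right)

lemma top_step: "i < k \<Longrightarrow> top_val i = top_val (Suc i) + val f (Suc i) (supp f (Suc i) - 1)"
  by (simp add: top_val_def insert_day)

lemma top_nonneg: "0 \<le> top_val i"
  unfolding top_val_def by (intro sum_nonneg val_nonneg[OF ok]) (use supp_pos[OF ok] in auto)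

lemma err_nonneg: "0 \<le> err i"
  unfolding err_def using h_pos by (intro mult_nonneg_nonneg sum_nonneg) auto

lemma slack_nonneg: "0 \<le> slack i"
  unfolding slack_def using err_nonneg top_nonneg by simp

lemma top_le: "top_val i \<le> (\<Sum>i\<in>{1..k}. \<Sum>a\<in>set_pmf (f i). a)"
proof -
  have "top_val i \<le> (\<Sum>l\<in>{i<..k}. \<Sum>a\<in>set_pmf (f l). a)"
    unfolding top_val_def
  proof (intro sum_mono)
    fix l assume "l \<in> {i<..k}"
    then have l: "l \<in> {1..k}" by auto
    have "val f l (supp f l - 1) \<in> set_pmf (f l)" using val_in[OF ok l] supp_pos[OF ok l] by simp
    then show "val f l (supp f l - 1) \<le> (\<Sum>a\<in>set_pmf (f l). a)"
      using ok l fin[OF ok l] by (intro member_le_sum) (auto simp: instance_ok_def)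
  qed
  also have "\<dots> \<le> (\<Sum>l\<in>{1..k}. \<Sum>a\<in>set_pmf (f l). a)"
    using ok by (intro sum_mono2) (auto simp: instance_ok_def intro!: sum_nonneg)
  finally show ?thesis .
qed

lemma err_le: "err i \<le> 2 * types * h"
proof -
  have "(\<Sum>l\<in>{i<..k}. real (supp f l) + 1) \<le> (\<Sum>l\<in>{1..k}. real (supp f l) + 1)"
    by (intro sum_mono2) auto
  also have "\<dots> \<le> (\<Sum>l\<in>{1..k}. 2 * real (supp f l))"
    using supp_pos[OF ok] by (intro sum_mono) (auto simp: Suc_le_eq)
  finally show ?thesis unfolding err_def using h_pos
    by (intro mult_right_mono) (auto simp: sum_distrib_left types_def)
qed

text \<open>The grid, of width \<open>real n * h\<close>, covers all values, so a slope error of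
  \<open>1 / real n\<close> costs at most \<open>h\<close> in promise.\<close>

lemma slack_le: "slack i \<le> err i + h"
proof -
  have "top_val i \<le> real n * h" using top_le[of i] room' types_nonneg h_pos by linarith
  then show ?thesis using n_pos by (simp add: slack_def field_simps)
qed

lemma total_error: "err i + slack i + h \<le> 4 * (1 + 2 * types) * h"
  using err_le[of i] slack_le[of i] h_pos types_nonneg by (simp add: algebra_simps)

lemma welfare_step: "i < k \<Longrightarrow> later k f (welf y) i v = (\<Sum>j<supp f (Suc i). prob f (Suc i) j *
    (val f (Suc i) j * y (Suc i) (hist (v(Suc i := val f (Suc i) j)) (Suc i)) +
     later k f (welf y) (Suc i) (v(Suc i := val f (Suc i) j))))"
  by (subst later_step[OF ok _ welf_cong]) (auto simp: sum_support[OF ok] prob_def welf_def)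

lemma utility_step: "i < k \<Longrightarrow> later k f (\<lambda>u. day_utility y p u u) i v = (\<Sum>j<supp f (Suc i). prob f (Suc i) j *
    (day_utility y p (v(Suc i := val f (Suc i) j)) (v(Suc i := val f (Suc i) j)) (Suc i) +
     later k f (\<lambda>u. day_utility y p u u) (Suc i) (v(Suc i := val f (Suc i) j))))"
  by (subst later_step[OF ok _ day_utility_cong]) (auto simp: sum_support[OF ok] prob_def)

section \<open>Comparison of the tables with an arbitrary feasible mechanism\<close>

context
  fixes y p :: rule assumes feas: "feasible k f y p"
begin

lemma y_bounds: "i < k \<Longrightarrow> supported f (Suc i) v \<Longrightarrow> 0 \<le> y (Suc i) (hist v (Suc i)) \<and> y (Suc i) (hist v (Suc i)) \<le> 1"
  using feas by (auto simp: feasible_def)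

lemma welfare_le: "i \<le> k \<Longrightarrow> supported f i v \<Longrightarrow> later k f (welf y) i v \<le> top_val i"
proof (induction arbitrary: v rule: inc_induct)
  case base
  then show ?case by (simp add: later_top top_val_def)
next
  case (step i)
  have i: "Suc i \<in> {1..k}" using step by auto
  have "later k f (welf y) i v \<le> (\<Sum>j<supp f (Suc i). prob f (Suc i) j * (val f (Suc i) (supp f (Suc i) - 1) + top_val (Suc i)))"
    unfolding welfare_step[OF step(2)]
  proof (intro sum_mono mult_left_mono add_mono)
    fix j assume j: "j \<in> {..<supp f (Suc i)}"
    let ?v = "v(Suc i := val f (Suc i) j)"
    have v: "supported f (Suc i) ?v" using step.prems val_in[OF ok i, of j] j by (intro supported_upd) auto
    show "later k f (welf y) (Suc i) ?v \<le> top_val (Suc i)" by (rule step.IH[OF v])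
    have "j = supp f (Suc i) - 1 \<or> j < supp f (Suc i) - 1" using j by auto
    then have "val f (Suc i) j \<le> val f (Suc i) (supp f (Suc i) - 1)"
      using val_less[OF ok i, of j "supp f (Suc i) - 1"] supp_pos[OF ok i] by auto
    moreover have "val f (Suc i) j * y (Suc i) (hist ?v (Suc i)) \<le> val f (Suc i) j"
      using y_bounds[OF step(2) v] val_nonneg[OF ok i, of j] j by (intro mult_left_le) auto
    ultimately show "val f (Suc i) j * y (Suc i) (hist ?v (Suc i)) \<le> val f (Suc i) (supp f (Suc i) - 1)" by simp
    show "0 \<le> prob f (Suc i) j" using prob_pos[OF ok i, of j] j by simp
  qed
  also have "\<dots> = top_val i"
    using prob_sum[OF ok i] step(2) by (simp add: sum_distrib_right[symmetric] top_step)
  finally show ?case .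
qed

lemma utility_nonneg: "i \<le> k \<Longrightarrow> supported f i v \<Longrightarrow> 0 \<le> later k f (\<lambda>u. day_utility y p u u) i v"
proof (induction arbitrary: v rule: inc_induct)
  case base
  then show ?case by (simp add: later_top)
next
  case (step i)
  have i: "Suc i \<in> {1..k}" using step by auto
  show ?case
    unfolding utility_step[OF step(2)]
  proof (intro sum_nonneg mult_nonneg_nonneg add_nonneg_nonneg)
    fix j assume j: "j \<in> {..<supp f (Suc i)}"
    let ?v = "v(Suc i := val f (Suc i) j)"
    have v: "supported f (Suc i) ?v" using step.prems val_in[OF ok i, of j] j by (intro supported_upd) auto
    show "0 \<le> later k f (\<lambda>u. day_utility y p u u) (Suc i) ?v" by (rule step.IH[OF v])
    show "0 \<le> day_utility y p ?v ?v (Suc i)" using feas i v unfolding feasible_def ex_post_ir_def by blast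
    show "0 \<le> prob f (Suc i) j" using prob_pos[OF ok i, of j] j by simp
  qed
qed

text \<open>Backward induction over the days, for all histories at once. The target may be any grid
  value that stays \<open>err i\<close> below the welfare of the mechanism. The truncation at
  \<open>top_val i\<close> is part of the induction because utilities themselves are unbounded and
  would leave the grid.\<close>

lemma table_bound:
  assumes "i \<le> k" "supported f i v" "\<sigma> \<le> n" "real \<sigma> * h \<le> max 0 (later k f (welf y) i v - err i)"
  shows "\<exists>e\<in>first i. s e = real \<sigma> * h \<and>
    b e + D e \<le> min (later k f (\<lambda>u. day_utility y p u u) i v) (top_val i) + slack i"
  using assms
proof (induction arbitrary: v \<sigma> rule: inc_induct)
  case base
  have k: "k \<in> {1..k}" using k_pos by simp
  interpret d: day_dp "supp f k" "val f k" "prob f k" h n b x s D nx nd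
    "\<lambda>j. if j = supp f k then T0 else T k j" "if k = k then T0 else T (Suc k) 0"
    by (rule day[OF k])
  have "\<sigma> = 0" using base h_pos by (simp add: later_top err_def mult_le_0_iff)
  obtain e where "e \<in> T0" "b e = 0" "s e = 0" using d.grid_ex[of "supp f k" 0 0 0] by auto
  then show ?case using d.D_final[of e] \<open>\<sigma> = 0\<close>
    by (auto simp: first_def later_top top_val_def slack_def err_def)
next
  case (step i)
  have i: "Suc i \<in> {1..k}" using step by auto
  note ik = step(2)
  interpret d: day_dp "supp f (Suc i)" "val f (Suc i)" "prob f (Suc i)" h n b x s D nx nd
    "\<lambda>j. if j = supp f (Suc i) then T0 else T (Suc i) j" "first (Suc i)"
    by (rule day'[OF ik])
  define m where "m = supp f (Suc i)"
  define vj where "vj j = v(Suc i := val f (Suc i) j)" for j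
  define U where "U j = later k f (\<lambda>u. day_utility y p u u) (Suc i) (vj j)" for j
  define W where "W j = later k f (welf y) (Suc i) (vj j)" for j
  define X where "X j = y (Suc i) (hist (vj j) (Suc i))" for j
  define B where "B j = day_utility y p (vj j) (vj j) (Suc i) + U j" for j
  have vj: "supported f (Suc i) (vj j)" if "j < m" for j
    using step.prems(1) val_in[OF ok i] that unfolding vj_def m_def by (intro supported_upd) auto
  have W_le: "W j \<le> top_val (Suc i)" if "j < m" for j
    unfolding W_def using ik by (intro welfare_le vj that) auto
  have U_nonneg: "0 \<le> U j" if "j < m" for j
    unfolding U_def using ik by (intro utility_nonneg vj that) auto
  have UB: "U j \<le> B j" if "j < m" for j
    using feas i vj[OF that] unfolding B_def feasible_def ex_post_ir_def by auto
  \<comment> \<open>Targets for the next day, rounded down to the grid; a welfare below the error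
    bound gets the target 0.\<close>
  define \<tau> where "\<tau> j = nat \<lfloor>max 0 (W j - err (Suc i)) / h\<rfloor>" for j
  have \<tau>_le: "real (\<tau> j) * h \<le> max 0 (W j - err (Suc i))" for j
  proof -
    have "real (\<tau> j) \<le> max 0 (W j - err (Suc i)) / h"
      unfolding \<tau>_def using h_pos by (intro of_nat_floor) auto
    then show ?thesis using h_pos by (simp add: field_simps)
  qed
  have \<tau>_ge: "W j - err (Suc i) - h \<le> real (\<tau> j) * h" for j
  proof -
    have "max 0 (W j - err (Suc i)) / h - 1 \<le> real (\<tau> j)"
      unfolding \<tau>_def by linarith
    then have "max 0 (W j - err (Suc i)) - h \<le> real (\<tau> j) * h" using h_pos by (simp add: field_simps)
    then show ?thesis by linarith
  qed
  have gap_room: "top_val (Suc i) + slack (Suc i) + (real m + 1) * h \<le> real n * h"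
  proof -
    have "top_val (Suc i) + slack (Suc i) + (real m + 1) * h \<le> top_val (Suc i) + err i + h"
      using slack_le[of "Suc i"] err_step[OF ik] by (simp add: m_def)
    also have "\<dots> \<le> real n * h" using top_le[of "Suc i"] err_le[of i] room' h_pos types_nonneg
      by linarith
    finally show ?thesis .
  qed
  have \<tau>_n: "\<tau> j \<le> n" if "j < m" for j
  proof -
    have "max 0 (W j - err (Suc i)) \<le> top_val (Suc i)"
      using W_le[OF that] err_nonneg[of "Suc i"] top_nonneg[of "Suc i"] by linarith
    also have "\<dots> \<le> real n * h" using gap_room slack_nonneg[of "Suc i"] h_pos
      by (smt (verit) mult_nonneg_nonneg of_nat_0_le_iff)
    finally show ?thesis using \<tau>_le[of j] h_pos by (smt (verit) mult_le_cancel_right_pos of_nat_le_iff)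
  qed
  have "\<exists>N. \<forall>j<m. N j \<in> first (Suc i) \<and> s (N j) = real (\<tau> j) * h \<and>
      b (N j) + D (N j) \<le> min (U j) (top_val (Suc i)) + slack (Suc i)"
  proof -
    have "\<forall>j. \<exists>e. j < m \<longrightarrow> e \<in> first (Suc i) \<and> s e = real (\<tau> j) * h \<and>
      b e + D e \<le> min (U j) (top_val (Suc i)) + slack (Suc i)"
      using step.IH[OF vj \<tau>_n] \<tau>_le unfolding W_def U_def by blast
    then show ?thesis by metis
  qed
  then obtain N where N: "\<And>j. j < m \<Longrightarrow> N j \<in> first (Suc i)" "\<And>j. j < m \<Longrightarrow> s (N j) = real (\<tau> j) * h"
    "\<And>j. j < m \<Longrightarrow> b (N j) + D (N j) \<le> min (U j) (top_val (Suc i)) + slack (Suc i)" by blast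
  have Ws: "later k f (welf y) i v = (\<Sum>j<m. prob f (Suc i) j * (val f (Suc i) j * X j + W j))"
    unfolding welfare_step[OF ik] m_def X_def W_def vj_def ..
  have Us: "later k f (\<lambda>u. day_utility y p u u) i v = (\<Sum>j<m. prob f (Suc i) j * B j)"
    unfolding utility_step[OF ik] m_def B_def U_def vj_def ..
  have "\<exists>e\<in>(if 0 = supp f (Suc i) then T0 else T (Suc i) 0). s e = real \<sigma> * h \<and>
    b e + D e \<le> min (\<Sum>j<supp f (Suc i). prob f (Suc i) j * B j) (top_val (Suc i) + val f (Suc i) (supp f (Suc i) - 1)) +
      slack (Suc i) + (real (supp f (Suc i)) + 1) * h + val f (Suc i) (supp f (Suc i) - 1) / real n"
  proof (rule d.table_upper[where X = X and N = N])
    fix j assume "j < supp f (Suc i)"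
    then have j: "j < m" by (simp add: m_def)
    show "0 \<le> X j \<and> X j \<le> 1" unfolding X_def using y_bounds[OF ik vj[OF j]] .
    show "0 \<le> B j" using UB[OF j] U_nonneg[OF j] by simp
    show "N j \<in> first (Suc i) \<and> b (N j) + D (N j) \<le> min (B j) (top_val (Suc i)) + slack (Suc i)"
      using N(1,3)[OF j] UB[OF j] by auto
    show "0 \<le> s (N j)" using N(2)[OF j] h_pos by simp
    fix l assume "l < supp f (Suc i)"
    then have l: "l < m" by (simp add: m_def)
    have "(vj j)(Suc i := val f (Suc i) l) = vj l" by (simp add: vj_def)
    \<comment> \<open>True value \<open>j\<close>, reported value \<open>l\<close>: the reported
      history is \<open>vj l\<close>, so the later utility is \<open>U l\<close>.\<close>
    moreover have "continuation_utility k f y p (Suc i) (vj j) ((vj j)(Suc i := val f (Suc i) l)) \<le>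
      continuation_utility k f y p (Suc i) (vj j) (vj j)"
      using feas i vj[OF j] val_in[OF ok i, of l] l unfolding feasible_def periodic_ic_def m_def by blast
    ultimately show "B l + (val f (Suc i) j - val f (Suc i) l) * X l \<le> B j"
      by (simp add: continuation_utility_later B_def U_def X_def day_utility_def vj_def algebra_simps)
  next
    show "\<sigma> \<le> n" by fact
    show "top_val (Suc i) + slack (Suc i) + (real (supp f (Suc i)) + 1) * h \<le> real n * h"
      using gap_room by (simp add: m_def)
    show "0 \<le> top_val (Suc i)" "0 \<le> slack (Suc i)" by (rule top_nonneg slack_nonneg)+
    have "later k f (welf y) i v - err (Suc i) - h \<le> (\<Sum>j<m. prob f (Suc i) j * (val f (Suc i) j * X j + s (N j)))"
    proof -
      have "later k f (welf y) i v - err (Suc i) - h =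
        (\<Sum>j<m. prob f (Suc i) j * (val f (Suc i) j * X j + W j)) - (\<Sum>j<m. prob f (Suc i) j) * (err (Suc i) + h)"
        using prob_sum[OF ok i] by (simp add: Ws m_def)
      also have "\<dots> = (\<Sum>j<m. prob f (Suc i) j * (val f (Suc i) j * X j + (W j - err (Suc i) - h)))"
        unfolding sum_distrib_right sum_subtractf[symmetric] by (intro sum.cong) (auto simp: algebra_simps)
      also have "\<dots> \<le> (\<Sum>j<m. prob f (Suc i) j * (val f (Suc i) j * X j + s (N j)))"
        using \<tau>_ge N(2) prob_pos[OF ok i]
        by (intro sum_mono mult_left_mono add_left_mono) (auto simp: m_def intro: less_imp_le)
      finally show ?thesis .
    qed
    then show "real \<sigma> * h \<le> max 0 ((\<Sum>j<supp f (Suc i). prob f (Suc i) j * (val f (Suc i) j * X j + s (N j))) - real (supp f (Suc i)) * h)"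
      using step.prems(3) err_step[OF ik] by (simp add: m_def algebra_simps)
  qed
  then obtain e where e: "e \<in> (if 0 = supp f (Suc i) then T0 else T (Suc i) 0)" "s e = real \<sigma> * h"
    "b e + D e \<le> min (\<Sum>j<supp f (Suc i). prob f (Suc i) j * B j) (top_val (Suc i) + val f (Suc i) (supp f (Suc i) - 1)) +
      slack (Suc i) + (real (supp f (Suc i)) + 1) * h + val f (Suc i) (supp f (Suc i) - 1) / real n" by blast
  have "e \<in> first i" using e(1) ik supp_pos[OF ok i] by (simp add: first_def split: if_splits)
  moreover have "b e + D e \<le> min (later k f (\<lambda>u. day_utility y p u u) i v) (top_val i) + slack i"
    using e(3) Us top_step[OF ik] err_step[OF ik]
    by (simp add: m_def slack_def add_divide_distrib)
  ultimately show ?case using e(2) by blast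
qed

text \<open>The score of a start cell is a guaranteed revenue. Rounding the initial target costs
  \<open>err 0 + h\<close> and the promise exceeds the utility by \<open>slack 0\<close>;
  \<open>total_error\<close> bounds the sum.\<close>

lemma start_bound:
  assumes "\<And>e. e \<in> first 0 \<Longrightarrow> s e - b e - D e \<le> R"
  shows "revenue k f p - 4 * (1 + 2 * types) * h \<le> R"
proof -
  define W where "W = later k f (welf y) 0 (\<lambda>_. 0)"
  define \<sigma> where "\<sigma> = nat \<lfloor>max 0 (W - err 0) / h\<rfloor>"
  have sup: "supported f 0 (\<lambda>_. 0)" by (simp add: supported_def)
  have le: "real \<sigma> * h \<le> max 0 (W - err 0)"
  proof -
    have "real \<sigma> \<le> max 0 (W - err 0) / h"
      unfolding \<sigma>_def using h_pos by (intro of_nat_floor) auto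
    then show ?thesis using h_pos by (simp add: field_simps)
  qed
  have ge: "W - err 0 - h \<le> real \<sigma> * h"
  proof -
    have "max 0 (W - err 0) / h - 1 \<le> real \<sigma>"
      unfolding \<sigma>_def by linarith
    then have "max 0 (W - err 0) - h \<le> real \<sigma> * h" using h_pos by (simp add: field_simps)
    then show ?thesis by linarith
  qed
  have "max 0 (W - err 0) \<le> top_val 0"
    using welfare_le[OF _ sup] err_nonneg[of 0] top_nonneg[of 0] by (simp add: W_def)
  also have "\<dots> \<le> real n * h"
    using room' top_le[of 0] h_pos types_nonneg by linarith
  finally have "\<sigma> \<le> n" using le h_pos by (smt (verit) mult_le_cancel_right_pos of_nat_le_iff)
  from table_bound[OF _ sup this] le obtain e where "e \<in> first 0" "s e = real \<sigma> * h"
    "b e + D e \<le> later k f (\<lambda>u. day_utility y p u u) 0 (\<lambda>_. 0) + slack 0"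
    by (auto simp: W_def)
  moreover have "revenue k f p = W - later k f (\<lambda>u. day_utility y p u u) 0 (\<lambda>_. 0)"
    unfolding W_def by (rule revenue_eq[OF ok])
  ultimately show ?thesis using assms[of e] ge total_error[of 0] by linarith
qed

end

section \<open>The policy of the tables as a state machine\<close>

definition pol_alloc :: "nat \<Rightarrow> 'e \<Rightarrow> real \<Rightarrow> real" where
  "pol_alloc i e a = x ((nx ^^ Suc (idx f i a)) e)"

definition pol_interim :: "nat \<Rightarrow> 'e \<Rightarrow> real \<Rightarrow> real" where
  "pol_interim i e a = b e + (\<Sum>l<idx f i a. x ((nx ^^ Suc l) e) * (val f i (Suc l) - val f i l))"

definition pol_next :: "nat \<Rightarrow> 'e \<Rightarrow> real \<Rightarrow> 'e" where
  "pol_next i e a = nd ((nx ^^ idx f i a) e)"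

text \<open>Restricted to finite entries, since the successors stored at an infinite entry carry no
  information.\<close>

definition good :: "nat \<Rightarrow> 'e set" where
  "good i = {e \<in> first (i - 1). D e < (real n + 1) * h}"

lemma zero_start: "i \<le> k \<Longrightarrow> \<exists>e\<in>first i. b e = 0 \<and> s e = 0 \<and> D e \<le> 0"
proof (induction rule: inc_induct)
  case base
  have k: "k \<in> {1..k}" using k_pos by simp
  interpret d: day_dp "supp f k" "val f k" "prob f k" h n b x s D nx nd
    "\<lambda>j. if j = supp f k then T0 else T k j" "if k = k then T0 else T (Suc k) 0"
    by (rule day[OF k])
  obtain e where "e \<in> T0" "b e = 0" "s e = 0" using d.grid_ex[of "supp f k" 0 0 0] by auto
  then show ?case using d.D_final[of e] by (auto simp: first_def)
next
  case (step i)
  interpret d: day_dp "supp f (Suc i)" "val f (Suc i)" "prob f (Suc i)" h n b x s D nx nd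
    "\<lambda>j. if j = supp f (Suc i) then T0 else T (Suc i) j" "first (Suc i)"
    by (rule day'[OF step(2)])
  from step obtain N where "N \<in> first (Suc i)" "b N = 0" "s N = 0" "D N \<le> 0" by auto
  then have "\<exists>e\<in>(if 0 = supp f (Suc i) then T0 else T (Suc i) 0). b e = 0 \<and> s e = 0 \<and> D e \<le> 0"
    by (intro d.zero_cell[of N]) auto
  then show ?case using step(2) supp_pos[OF ok, of "Suc i"] by (simp add: first_def)
qed

context
  fixes e0 assumes e0: "e0 \<in> first 0" and best: "\<And>e. e \<in> first 0 \<Longrightarrow> s e - b e - D e \<le> s e0 - b e0 - D e0"
begin

text \<open>The zero cell has nonnegative score, hence so has the best cell; its entry is then at
  most its target, a grid value, and so below infinity.\<close>

lemma start_good: "e0 \<in> good 1"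
proof -
  interpret d: day_dp "supp f (Suc 0)" "val f (Suc 0)" "prob f (Suc 0)" h n b x s D nx nd
    "\<lambda>j. if j = supp f (Suc 0) then T0 else T (Suc 0) j" "first (Suc 0)"
    using k_pos by (intro day') auto
  have e0': "e0 \<in> (if 0 = supp f (Suc 0) then T0 else T (Suc 0) 0)"
    using e0 k_pos supp_pos[OF ok, of "Suc 0"] by (auto simp: first_def)
  obtain e where "e \<in> first 0" "b e = 0" "s e = 0" "D e \<le> 0" using zero_start[of 0] by auto
  then have "D e0 \<le> s e0 - b e0" using best[of e] by simp
  also have "\<dots> \<le> real n * h" using d.b_bounds[OF _ e0'] d.s_bounds[OF _ e0'] by simp
  finally show ?thesis using e0 h_pos by (simp add: good_def distrib_right)
qed

lemma policy: "state_mechanism k f good pol_alloc pol_interim pol_next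
    (\<lambda>i e. b e + D e) (\<lambda>i e. s e) e0"
proof
  show "instance_ok k f" by (rule ok)
  show "e0 \<in> good 1" by (rule start_good)
next
  fix i e assume i: "i \<in> {1..k}" and e: "e \<in> good i"
  interpret d: day_dp "supp f i" "val f i" "prob f i" h n b x s D nx nd
    "\<lambda>j. if j = supp f i then T0 else T i j" "first i"
    using day[OF i] by (simp add: first_def)
  have e1: "e \<in> (if 0 = supp f i then T0 else T i 0)" and De: "D e < (real n + 1) * h"
    using e i supp_pos[OF ok i] by (auto simp: good_def first_def split: if_splits)
  have pa: "pol_alloc i e (val f i j) = d.alloc e j" and pn: "pol_next i e (val f i j) = d.succ e j"
    and pi: "pol_interim i e (val f i j) = d.interim e j" if "j < supp f i" for j
    using that by (auto simp: pol_alloc_def pol_next_def pol_interim_def idx_val[OF ok i] d.alloc_def d.cell_def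
        d.succ_def d.interim_def d.gap_def intro!: sum.cong)
  note cs = d.cell_step[OF e1 De]
  {
    fix a assume "a \<in> set_pmf (f i)"
    then obtain j where j: "j < supp f i" "a = val f i j" using supportE[OF ok i] by metis
    have c: "b (d.cell e j) \<le> real n * h"
      using d.b_bounds[of j] d.cell_in[OF e1 De, of j] j by (auto split: if_splits)
    have "d.succ e j \<in> first i" using cs(1)[OF j(1)] .
    have "0 \<le> b (d.succ e j)"
    proof (cases "i = k")
      case True
      then show ?thesis using \<open>d.succ e j \<in> first i\<close> d.b_bounds[of "supp f i" "d.succ e j"] by (simp add: first_def)
    next
      case False
      then have ik: "i < k" using i by simp
      interpret d': day_dp "supp f (Suc i)" "val f (Suc i)" "prob f (Suc i)" h n b x s D nx nd
        "\<lambda>j. if j = supp f (Suc i) then T0 else T (Suc i) j" "first (Suc i)" by (rule day'[OF ik])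
      show ?thesis using \<open>d.succ e j \<in> first i\<close> d'.b_bounds[of 0 "d.succ e j"] False d'.m_pos by (simp add: first_def)
    qed
    \<comment> \<open>Affordability bounds the promise of the next state by a grid coordinate, so
      finiteness passes from day to day.\<close>
    then have "d.succ e j \<in> good (Suc i)"
      using cs(1,4)[OF j(1)] c h_pos by (simp add: good_def distrib_right)
    then show "pol_alloc i e a \<in> {0..1} \<and> pol_next i e a \<in> good (Suc i) \<and>
      b (pol_next i e a) + D (pol_next i e a) \<le> pol_interim i e a"
      using d.alloc_bounds[OF e1 De j(1)] d.succ_affordable[OF e1 De j(1)] j by (simp add: pa pn pi)
    fix a' assume "a' \<in> set_pmf (f i)"
    then obtain j' where j': "j' < supp f i" "a' = val f i j'" using supportE[OF ok i] by metis
    show "pol_interim i e a' + (a - a') * pol_alloc i e a' \<le> pol_interim i e a"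
      using d.interim_ic[OF e1 De j'(1) j(1)] j j' by (simp add: pa pi)
  }
  show "(\<Sum>a\<in>set_pmf (f i). pmf (f i) a * pol_interim i e a) = b e + D e"
    using d.interim_expectation[OF e1 De] by (simp add: sum_support[OF ok i] pi prob_def)
  show "s e \<le> (\<Sum>a\<in>set_pmf (f i). pmf (f i) a * (a * pol_alloc i e a + s (pol_next i e a)))"
    using d.welfare_target[OF e1 De] by (simp add: sum_support[OF ok i] pa pn prob_def)
next
  fix e assume e: "e \<in> good (Suc k)"
  have k: "k \<in> {1..k}" using k_pos by simp
  interpret d: day_dp "supp f k" "val f k" "prob f k" h n b x s D nx nd
    "\<lambda>j. if j = supp f k then T0 else T k j" "if k = k then T0 else T (Suc k) 0"
    by (rule day[OF k])
  show "b e + D e = 0 \<and> s e = 0"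
    using e d.D_final[of e] by (auto simp: good_def first_def split: if_splits)
qed

end

end

section \<open>Timed triples and the relaxation step\<close>

definition triple :: "(mem \<Rightarrow> bool) \<Rightarrow> prog \<Rightarrow> nat \<Rightarrow> (mem \<Rightarrow> bool) \<Rightarrow> bool" where
  "triple P c T Q \<longleftrightarrow> (\<forall>s. P s \<longrightarrow> (\<exists>t s'. exec c s t s' \<and> t \<le> T \<and> Q s'))"

lemma triple_weaken:
  assumes "triple P c T Q" "\<And>s. P' s \<Longrightarrow> P s" "\<And>s. Q s \<Longrightarrow> Q' s" "T \<le> T'"
  shows "triple P' c T' Q'"
  using assms unfolding triple_def by (meson le_trans)

lemma triple_Seq:
  assumes "triple P c T Q" "triple Q d T' U"
  shows "triple P (Seq c d) (T + T') U"
  using assms unfolding triple_def by (meson exec.Seq add_mono)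

text \<open>The number of iterations is known in advance in every use, so the index of the invariant
  also serves as the variant.\<close>

lemma triple_While:
  assumes body: "\<And>j. j < n \<Longrightarrow> triple (I j) c T (I (Suc j))"
    and cont: "\<And>j s. j < n \<Longrightarrow> I j s \<Longrightarrow> tval b s"
    and stop: "\<And>s. I n s \<Longrightarrow> \<not> tval b s"
  shows "triple (I 0) (While b c) (n * (T + 1) + 1) (I n)"
proof -
  have "triple (I j) (While b c) ((n - j) * (T + 1) + 1) (I n)" if "j \<le> n" for j
    using that
  proof (induction rule: inc_induct)
    case base
    show ?case using stop unfolding triple_def by (fastforce intro: exec.WhileFalse)
  next
    case (step j)
    show ?case
      unfolding triple_def
    proof (intro allI impI)
      fix s assume s: "I j s"
      obtain t s' where t: "exec c s t s'" "t \<le> T" "I (Suc j) s'"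
        using body[OF step(2)] s unfolding triple_def by blast
      obtain t' s'' where t': "exec (While b c) s' t' s''" "t' \<le> (n - Suc j) * (T + 1) + 1" "I n s''"
        using step.IH t(3) unfolding triple_def by blast
      have "exec (While b c) s (1 + t + t') s''"
        using cont[OF step(2) s] t(1) t'(1) by (rule exec.WhileTrue)
      moreover have "1 + t + t' \<le> (n - j) * (T + 1) + 1"
      proof -
        have "n - j = Suc (n - Suc j)" using step(2) by simp
        then show ?thesis using t(2) t'(2) by simp
      qed
      ultimately show "\<exists>t s'. exec (While b c) s t s' \<and> t \<le> (n - j) * (T + 1) + 1 \<and> I n s'"
        using t'(3) by blast
    qed
  qed
  from this[of 0] show ?thesis by simp
qed

text \<open>Freezes the initial memory, so that postconditions can be stated relative to it.\<close>

lemma triple_point: "(\<And>s. P s \<Longrightarrow> triple (\<lambda>s'. s' = s) c T Q) \<Longrightarrow> triple P c T Q"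
  by (auto simp: triple_def)

section \<open>Symbolic evaluation of loop-free programs\<close>

fun straight :: "prog \<Rightarrow> bool" where
  "straight (Seq c d) \<longleftrightarrow> straight c \<and> straight d"
| "straight (Cond b c d) \<longleftrightarrow> straight c \<and> straight d"
| "straight (While b c) \<longleftrightarrow> False"
| "straight _ \<longleftrightarrow> True"

text \<open>The value at \<open>While\<close> is arbitrary, as \<open>exec_run\<close> speaks of
  \<open>straight\<close> programs only. For these, the simplifier computes the final memory
  directly.\<close>

fun run :: "prog \<Rightarrow> mem \<Rightarrow> mem" where
  "run Skip s = s"
| "run (NAssign a e) s = ((fst s)(nval a s := nval e s), snd s)"
| "run (RAssign a e) s = (fst s, (snd s)(nval a s := rval e s))"
| "run (Seq c d) s = run d (run c s)"
| "run (Cond b c d) s = (if tval b s then run c s else run d s)"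
| "run (While b c) s = s"

fun cost :: "prog \<Rightarrow> nat" where
  "cost (Seq c d) = cost c + cost d"
| "cost (Cond b c d) = 1 + max (cost c) (cost d)"
| "cost _ = 1"

lemma exec_run: "straight c \<Longrightarrow> \<exists>t\<le>cost c. exec c s t (run c s)"
proof (induction c arbitrary: s)
  case Skip
  then show ?case using exec.Skip[of s] by auto
next
  case (NAssign a e)
  then show ?case using exec.NAssign[of a e "fst s" "snd s"] by auto
next
  case (RAssign a e)
  then show ?case using exec.RAssign[of a e "fst s" "snd s"] by auto
next
  case (Seq c d)
  obtain t where t: "t \<le> cost c" "exec c s t (run c s)" using Seq.IH(1)[of s] Seq.prems by auto
  obtain t' where t': "t' \<le> cost d" "exec d (run c s) t' (run d (run c s))"
    using Seq.IH(2)[of "run c s"] Seq.prems by auto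
  show ?case using exec.Seq[OF t(2) t'(2)] t(1) t'(1) by (auto intro!: exI[of _ "t + t'"])
next
  case (Cond b c d)
  show ?case
  proof (cases "tval b s")
    case True
    obtain t where t: "t \<le> cost c" "exec c s t (run c s)" using Cond.IH(1)[of s] Cond.prems by auto
    show ?thesis using exec.CondTrue[OF True t(2), of d] t(1) True by (auto intro!: exI[of _ "1 + t"])
  next
    case False
    obtain t where t: "t \<le> cost d" "exec d s t (run d s)" using Cond.IH(2)[of s] Cond.prems by auto
    show ?thesis using exec.CondFalse[OF False t(2), of c] t(1) False by (auto intro!: exI[of _ "1 + t"])
  qed
qed auto

lemma triple_straight:
  assumes "straight c" "cost c \<le> T" "\<And>N R. P (N, R) \<Longrightarrow> Q (run c (N, R))"
  shows "triple P c T Q"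
  unfolding triple_def
proof (intro allI impI)
  fix s assume "P s"
  then have "Q (run c s)" using assms(3)[of "fst s" "snd s"] by simp
  then show "\<exists>t s'. exec c s t s' \<and> t \<le> T \<and> Q s'"
    using exec_run[OF assms(1), of s] assms(2) by (meson le_trans)
qed

abbreviation reg :: "nat \<Rightarrow> nexp" where "reg c \<equiv> NMem (NConst c)"
abbreviation fld :: "nat \<Rightarrow> nat \<Rightarrow> rexp" where "fld c d \<equiv> RMem (NAdd (reg c) (NConst d))"
abbreviation set_reg :: "nat \<Rightarrow> nexp \<Rightarrow> prog" where "set_reg c e \<equiv> NAssign (NConst c) e"
abbreviation set_fld :: "nat \<Rightarrow> nat \<Rightarrow> rexp \<Rightarrow> prog" where
  "set_fld c d e \<equiv> RAssign (NAdd (reg c) (NConst d)) e"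
abbreviation incr :: "nat \<Rightarrow> nat \<Rightarrow> prog" where "incr c d \<equiv> set_reg c (NAdd (reg c) (NConst d))"
abbreviation big_exp :: rexp where
  "big_exp \<equiv> RMul (RAdd (ROfIndex (reg 3)) (RConst 1)) (fld 1 0)"

text \<open>
  A cell at address \<open>a\<close> has the real fields \<open>b, x, s, D\<close> and the value of its layer at \<open>a, \<dots>, a + 4\<close>, and
  the chosen next cell of the same day and first cell of the next day at the index cells \<open>a, a + 1\<close>.
  Index registers: 1 holds the length \<open>L\<close> of the input, 2 the input position of the layer, 3 the grid size \<open>n\<close>,
  4 the first table, 5 the cell being filled, 7 and 8 the two candidates, 9 and 10 the tables they range
  over up to 14 and 13, 11 the last table, 12 the length of a table. The real cells
  \<open>L, \<dots>, L + 3\<close> hold \<open>h\<close>, the sum of all values, the tail probability and the gap to the next value.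
\<close>

definition relax :: prog where
  "relax =
    Cond (TAnd (TNot (RLess (fld 7 1) (fld 5 1)))
         (TAnd (TNot (RLess (RAdd (fld 5 0) (RMul (fld 7 1) (fld 1 3))) (fld 7 0)))
         (TAnd (TNot (RLess (fld 5 0) (RAdd (fld 8 0) (fld 8 3))))
         (TAnd (TNot (RLess (RAdd (RMul (fld 2 1) (RAdd (RMul (fld 2 0) (fld 7 1)) (fld 8 2))) (fld 7 2)) (fld 5 2)))
               (RLess (RAdd (RMul (RMul (fld 7 1) (fld 1 3)) (fld 1 2)) (fld 7 3)) (fld 5 3))))))
      (Seq (set_fld 5 3 (RAdd (RMul (RMul (fld 7 1) (fld 1 3)) (fld 1 2)) (fld 7 3)))
      (Seq (NAssign (reg 5) (reg 7)) (NAssign (NAdd (reg 5) (NConst 1)) (reg 8))))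
      Skip"

definition search_row :: prog where
  "search_row = Seq (set_reg 7 (reg 10)) (While (NLess (reg 7) (reg 13))
     (Seq (Seq (set_reg 8 (reg 9)) (While (NLess (reg 8) (reg 14)) (Seq relax (incr 8 5)))) (incr 7 5)))"

definition valid :: "(nat \<Rightarrow> real) \<Rightarrow> real \<Rightarrow> real \<Rightarrow> real \<Rightarrow> nat \<Rightarrow> nat \<Rightarrow> nat \<Rightarrow> bool" where
  "valid R g p v e e' e'' \<longleftrightarrow> R (e + 1) \<le> R (e' + 1) \<and> R e' \<le> R e + R (e' + 1) * g \<and>
     R e'' + R (e'' + 3) \<le> R e \<and> R (e + 2) \<le> p * (v * R (e' + 1) + R (e'' + 2)) + R (e' + 2)"

definition through :: "(nat \<Rightarrow> real) \<Rightarrow> real \<Rightarrow> real \<Rightarrow> nat \<Rightarrow> real" where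
  "through R g z e' = R (e' + 1) * g * z + R (e' + 3)"

text \<open>Loop invariant for a minimum capped at \<open>big\<close>: \<open>d\<close> is a lower
  bound over the pairs seen so far, and if it is finite it is attained at the pair recorded in the
  index cells of \<open>e\<close>. Once \<open>Z\<close> is the full range, \<open>d\<close> is the
  capped minimum with its argument.\<close>

definition best_of :: "nat \<Rightarrow> real \<Rightarrow> (nat \<Rightarrow> nat) \<Rightarrow> (nat \<Rightarrow> real) \<Rightarrow> real \<Rightarrow> real \<Rightarrow> real \<Rightarrow> real \<Rightarrow> nat \<Rightarrow> nat \<Rightarrow> nat \<Rightarrow>
    (nat \<times> nat) set \<Rightarrow> real \<Rightarrow> bool" where
  "best_of K big N R g z p v a1 a2 e Z d \<longleftrightarrow> d \<le> big \<and>
     (\<forall>(i, j)\<in>Z. valid R g p v e (a1 + 5 * i) (a2 + 5 * j) \<longrightarrow> d \<le> through R g z (a1 + 5 * i)) \<and>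
     (d < big \<longrightarrow> (\<exists>i<K. \<exists>j<K. N e = a1 + 5 * i \<and> N (e + 1) = a2 + 5 * j \<and>
        valid R g p v e (a1 + 5 * i) (a2 + 5 * j) \<and> d = through R g z (a1 + 5 * i)))"

text \<open>Both candidate tables end at or before \<open>e\<close>, and of the real cells only the
  entry at \<open>e + 3\<close> is written. Validity and cost of a pair are therefore constant
  during the search and can be stated for the initial \<open>R\<close>.\<close>

lemma search_row_exec:
  fixes N R :: "nat \<Rightarrow> _"
  assumes e: "N 5 = e" "20 < e" and L: "N 1 + 4 \<le> e" "N 2 + 2 \<le> N 1"
    and a1: "N 10 = a1" "N 13 = a1 + 5 * K" "a1 + 5 * K \<le> e"
    and a2: "N 9 = a2" "N 14 = a2 + 5 * K" "a2 + 5 * K \<le> e"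
    and g: "R (N 1 + 3) = g" "R (N 1 + 2) = z" "R (N 2) = v" "R (N 2 + 1) = p"
    and big: "R (e + 3) = big"
  shows "triple (\<lambda>s. s = (N, R)) search_row (11 * (K + 1) * (K + 1))
    (\<lambda>(N', R'). (\<forall>a. a \<notin> {7, 8, e, e + 1} \<longrightarrow> N' a = N a) \<and> (\<forall>a. a \<noteq> e + 3 \<longrightarrow> R' a = R a) \<and>
       best_of K big N' R g z p v a1 a2 e ({..<K} \<times> {..<K}) (R' (e + 3)))"
proof -
  define J where "J i j = (\<lambda>(N' :: nat \<Rightarrow> nat, R' :: nat \<Rightarrow> real).
     (\<forall>a. a \<notin> {7, 8, e, e + 1} \<longrightarrow> N' a = N a) \<and> (\<forall>a. a \<noteq> e + 3 \<longrightarrow> R' a = R a) \<and>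
     N' 7 = a1 + 5 * i \<and> N' 8 = a2 + 5 * j \<and>
     best_of K big N' R g z p v a1 a2 e ({..<i} \<times> {..<K} \<union> {i} \<times> {..<j}) (R' (e + 3)))" for i j
  have inner_body: "triple (J i j) (Seq relax (incr 8 5)) 5 (J i (Suc j))" if i: "i < K" and j: "j < K" for i j
  proof (rule triple_straight)
    fix N' R' assume J: "J i j (N', R')"
    have N': "\<And>a. a \<notin> {7, 8, e, e + 1} \<Longrightarrow> N' a = N a" and R': "\<And>a. a \<noteq> e + 3 \<Longrightarrow> R' a = R a"
      and N7: "N' 7 = a1 + 5 * i" and N8: "N' 8 = a2 + 5 * j"
      and best: "best_of K big N' R g z p v a1 a2 e ({..<i} \<times> {..<K} \<union> {i} \<times> {..<j}) (R' (e + 3))"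
      using J unfolding J_def by auto
    have N5: "N' 5 = e" and N1: "N' 1 = N 1" and N2: "N' 2 = N 2" using N' e by auto
    define e' where "e' = a1 + 5 * i"
    define e'' where "e'' = a2 + 5 * j"
    have lt: "e' + 5 \<le> e" "e'' + 5 \<le> e" using a1 a2 i j by (auto simp: e'_def e''_def)
    have Rs: "R' e = R e" "R' (e + 1) = R (e + 1)" "R' (e + 2) = R (e + 2)"
       "R' e' = R e'" "R' (e' + 1) = R (e' + 1)" "R' (e' + 2) = R (e' + 2)" "R' (e' + 3) = R (e' + 3)"
       "R' e'' = R e''" "R' (e'' + 1) = R (e'' + 1)" "R' (e'' + 2) = R (e'' + 2)" "R' (e'' + 3) = R (e'' + 3)"
       "R' (N 1 + 3) = g" "R' (N 1 + 2) = z" "R' (N 2) = v" "R' (N 2 + 1) = p"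
      using lt L g by (auto intro: R')
    have run_eq: "run relax (N', R') =
      (if valid R g p v e e' e'' \<and> through R g z e' < R' (e + 3)
       then (N'(e := e', e + 1 := e''), R'(e + 3 := through R g z e')) else (N', R'))"
    proof -
      have "N' 7 = e'" "N' 8 = e''" using N7 N8 by (auto simp: e'_def e''_def)
      moreover have "(N'(e := e')) 5 = e" "(N'(e := e')) 8 = e''" using e N5 calculation by auto
      ultimately show ?thesis
        using N5 N1 N2 Rs by (simp add: relax_def valid_def through_def not_less)
    qed
    have Z: "{..<i} \<times> {..<K} \<union> {i} \<times> {..<Suc j} = insert (i, j) ({..<i} \<times> {..<K} \<union> {i} \<times> {..<j})" by auto
    show "J i (Suc j) (run (Seq relax (incr 8 5)) (N', R'))"
    proof (cases "valid R g p v e e' e'' \<and> through R g z e' < R' (e + 3)")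
      case True
      have "best_of K big (N'(e := e', e + 1 := e'', 8 := Suc (Suc (Suc (Suc (Suc e''))))) ) R g z p v a1 a2 e
        ({..<i} \<times> {..<K} \<union> {i} \<times> {..<Suc j}) (through R g z e')"
        using best True e i j unfolding best_of_def Z
        by (force simp: e'_def e''_def)
      then show ?thesis
        using True e N7 N8 N' R' unfolding J_def
        by (auto simp: run_eq e''_def e'_def eval_nat_numeral)
    next
      case False
      have "best_of K big (N'(8 := Suc (Suc (Suc (Suc (Suc e''))))) ) R g z p v a1 a2 e
        ({..<i} \<times> {..<K} \<union> {i} \<times> {..<Suc j}) (R' (e + 3))"
        using best False e i j unfolding best_of_def Z
        by (force simp: e'_def e''_def)
      then show ?thesis
        using False e N7 N8 N' R' unfolding J_def
        by (auto simp: run_eq e''_def e'_def eval_nat_numeral)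
    qed
  qed (auto simp: relax_def)
  have inner: "triple (J i 0) (While (NLess (reg 8) (reg 14)) (Seq relax (incr 8 5))) (K * (5 + 1) + 1) (J i K)"
    if i: "i < K" for i
  proof (rule triple_While)
    show "triple (J i j) (Seq relax (incr 8 5)) 5 (J i (Suc j))" if "j < K" for j by (rule inner_body[OF i that])
    show "tval (NLess (reg 8) (reg 14)) s" if "j < K" "J i j s" for j s
      using that a2 e by (auto simp: J_def)
    show "\<not> tval (NLess (reg 8) (reg 14)) s" if "J i K s" for s
      using that a2 e by (auto simp: J_def)
  qed
  \<comment> \<open>Between two rows register 8 is stale; overwriting it in the invariant yields the
    state in which the next inner loop starts.\<close>
  define Out where "Out i = (\<lambda>(N', R'). J i 0 (N'(8 := a2), R'))" for i
  have outer: "triple (Out 0) (While (NLess (reg 7) (reg 13))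
     (Seq (Seq (set_reg 8 (reg 9)) (While (NLess (reg 8) (reg 14)) (Seq relax (incr 8 5)))) (incr 7 5)))
     (K * (1 + (K * (5 + 1) + 1) + 1 + 1) + 1) (Out K)"
  proof (rule triple_While)
    fix i assume i: "i < K"
    show "triple (Out i) (Seq (Seq (set_reg 8 (reg 9)) (While (NLess (reg 8) (reg 14)) (Seq relax (incr 8 5)))) (incr 7 5))
      (1 + (K * (5 + 1) + 1) + 1) (Out (Suc i))"
    proof (intro triple_Seq[OF triple_Seq[OF _ inner[OF i]]])
      show "triple (Out i) (set_reg 8 (reg 9)) 1 (J i 0)"
      proof (rule triple_straight)
        fix N' R' assume Out: "Out i (N', R')"
        then have "N' 9 = a2" using e a2 by (auto simp: Out_def J_def)
        then show "J i 0 (run (set_reg 8 (reg 9)) (N', R'))" using Out by (simp add: Out_def)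
      qed auto
      show "triple (J i K) (incr 7 5) 1 (Out (Suc i))"
      proof (rule triple_straight)
        fix N' R' assume J: "J i K (N', R')"
        have "{..<Suc i} \<times> {..<K} = {..<i} \<times> {..<K} \<union> {i} \<times> {..<K}" by auto
        then show "Out (Suc i) (run (incr 7 5) (N', R'))"
          using J e by (auto simp: Out_def J_def best_of_def)
      qed auto
    qed
  next
    show "tval (NLess (reg 7) (reg 13)) s" if "i < K" "Out i s" for i s
      using that a1 e by (auto simp: Out_def J_def split: prod.splits)
    show "\<not> tval (NLess (reg 7) (reg 13)) s" if "Out K s" for s
      using that a1 e by (auto simp: Out_def J_def split: prod.splits)
  qed
  show ?thesis
    unfolding search_row_def
  proof (rule triple_weaken[OF triple_Seq[OF _ outer]])
    show "triple (\<lambda>s. s = (N, R)) (set_reg 7 (reg 10)) 1 (Out 0)"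
      by (rule triple_straight) (use a1 e big in \<open>auto simp: Out_def J_def best_of_def\<close>)
    show "1 + (K * (1 + (K * (5 + 1) + 1) + 1 + 1) + 1) \<le> 11 * (K + 1) * (K + 1)"
      by (simp add: algebra_simps)
    fix s assume "Out K s"
    then show "case s of (N', R') \<Rightarrow> (\<forall>a. a \<notin> {7, 8, e, e + 1} \<longrightarrow> N' a = N a) \<and> (\<forall>a. a \<noteq> e + 3 \<longrightarrow> R' a = R a) \<and>
       best_of K big N' R g z p v a1 a2 e ({..<K} \<times> {..<K}) (R' (e + 3))"
      using e by (auto simp: Out_def J_def best_of_def split: prod.splits if_splits)
  qed simp
qed

section \<open>The planner\<close>

definition copy_cell :: prog where
  "copy_cell = Seq (set_fld 5 0 (fld 6 0)) (Seq (set_fld 5 1 (fld 6 1)) (Seq (set_fld 5 2 (fld 6 2))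
     (Seq (set_fld 5 3 big_exp) (set_fld 5 4 (fld 2 0)))))"

definition fill_table :: prog where
  "fill_table = While (NLess (reg 6) (reg 15)) (Seq (Seq copy_cell search_row) (Seq (incr 5 5) (incr 6 5)))"

lemma best_of_cong:
  assumes "\<And>a. l \<le> a \<Longrightarrow> a < e + 3 \<Longrightarrow> R a = R' a" "N e = N' e" "N (e + 1) = N' (e + 1)"
    "a1 + 5 * K \<le> e" "a2 + 5 * K \<le> e" "l \<le> a1" "l \<le> a2"
  shows "best_of K big N R g z p v a1 a2 e ({..<K} \<times> {..<K}) d \<longleftrightarrow>
    best_of K big N' R' g z p v a1 a2 e ({..<K} \<times> {..<K}) d"
proof -
  have "valid R g p v e (a1 + 5 * i) (a2 + 5 * j) = valid R' g p v e (a1 + 5 * i) (a2 + 5 * j)"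
    "through R g z (a1 + 5 * i) = through R' g z (a1 + 5 * i)"
    if "i < K" "j < K" for i j
    using assms(4-7) that by (simp_all add: valid_def through_def assms(1))
  then show ?thesis unfolding best_of_def using assms(2,3) by (auto; blast)
qed

section \<open>Memory layout and the order of the layers\<close>

locale layers =
  fixes M L n :: nat and R0 :: "nat \<Rightarrow> real" and h :: real
  assumes L: "L = Suc (2 * M)"
begin

definition K :: nat where "K = (n + 1) * (n + 1) * (n + 1)"

text \<open>The addresses below \<open>L + 20\<close> are reserved for the real input, the constants
  stored behind it and the index registers.\<close>

definition ad :: "nat \<Rightarrow> nat \<Rightarrow> nat" where "ad r q = L + 20 + 5 * (K * r + q)"

definition big :: real where "big = (real n + 1) * h"

text \<open>The three digits of the cell number in base \<open>n + 1\<close> are its grid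
  coordinates.\<close>

definition bi :: "nat \<Rightarrow> nat" where "bi q = q div (n + 1) div (n + 1)"
definition xi :: "nat \<Rightarrow> nat" where "xi q = q div (n + 1) mod (n + 1)"
definition si :: "nat \<Rightarrow> nat" where "si q = q mod (n + 1)"

text \<open>Layer 1 is the top value of the last day. As \<open>L\<close> is odd, values sit at odd
  cells and probabilities at the even cells after cell 0.\<close>

definition lval :: "nat \<Rightarrow> real" where "lval r = R0 (L - 2 * r)"
definition lprob :: "nat \<Rightarrow> real" where "lprob r = R0 (L - 2 * r + 1)"

text \<open>Layer \<open>r\<close> is the \<open>r\<close>-th support point counted from the end of the input.
  A day is exhausted exactly when the probabilities read so far add up to 1.\<close>

primrec mass :: "nat \<Rightarrow> real" where
  "mass 0 = 1"
| "mass (Suc r) = (if mass r < 1 then mass r else 0) + lprob (Suc r)"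

text \<open>Layers are filled in reverse time, so layer \<open>r - 1\<close> is the next higher
  value if its day is still incomplete. \<open>mass 0 = 1\<close> makes the first layer open a new
  day.\<close>

definition ltail :: "nat \<Rightarrow> real" where
  "ltail r = (if mass (r - 1) < 1 then mass (r - 1) else 0)"

definition lgap :: "nat \<Rightarrow> real" where
  "lgap r = (if mass (r - 1) < 1 then lval (r - 1) - lval r else 0)"

definition lnext :: "nat \<Rightarrow> nat" where
  "lnext r = (if mass (r - 1) < 1 then r - 1 else 0)"

text \<open>The latest layer that completed a day in the backward pass, which in time is the first
  layer of the following day, or 0 for the last day.\<close>

primrec lday :: "nat \<Rightarrow> nat" where
  "lday 0 = 0"
| "lday (Suc r) = (if mass r < 1 then lday r else r)"

lemma lnext_less: "0 < r \<Longrightarrow> lnext r < r"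
  by (simp add: lnext_def)

lemma lday_less: "0 < r \<Longrightarrow> lday r < r"
proof (induction r)
  case (Suc r)
  then show ?case by (cases "r = 0") (auto simp: less_Suc_eq)
qed simp

lemma ad_table: "r < r' \<Longrightarrow> ad r 0 + 5 * K \<le> ad r' 0"
proof -
  assume "r < r'"
  then have "K * (r + 1) \<le> K * r'" by (intro mult_le_mono) auto
  then show ?thesis by (simp add: ad_def algebra_simps)
qed

lemma ad_q: "ad r q = ad r 0 + 5 * q"
  by (simp add: ad_def)

lemma ad_ge: "L + 20 \<le> ad r q"
  by (simp add: ad_def)

definition grid_ok :: "(nat \<Rightarrow> real) \<Rightarrow> bool" where
  "grid_ok R \<longleftrightarrow> (\<forall>q<K. R (ad 0 q) = real (bi q) * h \<and> R (ad 0 q + 1) = real (xi q) / real n \<and>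
     R (ad 0 q + 2) = real (si q) * h \<and> R (ad 0 q + 3) = (if bi q + si q = 0 then 0 else big))"

definition row_ok :: "(nat \<Rightarrow> nat) \<Rightarrow> (nat \<Rightarrow> real) \<Rightarrow> nat \<Rightarrow> nat \<Rightarrow> bool" where
  "row_ok N R r q \<longleftrightarrow> R (ad r q) = real (bi q) * h \<and> R (ad r q + 1) = real (xi q) / real n \<and>
     R (ad r q + 2) = real (si q) * h \<and> R (ad r q + 4) = lval r \<and>
     best_of K big N R (lgap r) (ltail r) (lprob r) (lval r) (ad (lnext r) 0) (ad (lday r) 0) (ad r q)
       ({..<K} \<times> {..<K}) (R (ad r q + 3))"

text \<open>A finished row depends on no cell above itself, so filling later cells and reusing
  registers preserves it.\<close>

lemma row_ok_cong:
  assumes "row_ok N R r q" "0 < r" "\<And>a. L + 20 \<le> a \<Longrightarrow> a < ad r q + 5 \<Longrightarrow> R' a = R a"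
    "N' (ad r q) = N (ad r q)" "N' (ad r q + 1) = N (ad r q + 1)"
  shows "row_ok N' R' r q"
proof -
  have "ad (lnext r) 0 + 5 * K \<le> ad r q" "ad (lday r) 0 + 5 * K \<le> ad r q"
    using ad_table[OF lnext_less[OF assms(2)]] ad_table[OF lday_less[OF assms(2)]] ad_q[of r q] by auto
  then have "best_of K big N' R' (lgap r) (ltail r) (lprob r) (lval r) (ad (lnext r) 0) (ad (lday r) 0) (ad r q)
       ({..<K} \<times> {..<K}) (R (ad r q + 3)) \<longleftrightarrow> best_of K big N R (lgap r) (ltail r) (lprob r) (lval r) (ad (lnext r) 0) (ad (lday r) 0) (ad r q)
       ({..<K} \<times> {..<K}) (R (ad r q + 3))"
    using ad_ge[of "lnext r" 0] ad_ge[of "lday r" 0]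
    by (intro best_of_cong[where l = "L + 20"]) (auto simp: assms(3,4) assms(5)[simplified])
  then show ?thesis using assms(1) ad_ge[of r q] by (simp add: row_ok_def assms(3))
qed

text \<open>The coordinates are copied cell by cell from the terminal table, and each search reads
  only strictly lower tables. Rows are thus final as soon as they are written.\<close>

lemma fill_table_exec:
  fixes N :: "nat \<Rightarrow> nat" and R :: "nat \<Rightarrow> real"
  assumes r: "0 < r" "r \<le> M"
    and N: "N 1 = L" "N 2 = L - 2 * r" "N 3 = n" "N 5 = ad r 0" "N 6 = ad 0 0" "N 15 = ad 0 K"
      "N 10 = ad (lnext r) 0" "N 13 = ad (lnext r) 0 + 5 * K" "N 9 = ad (lday r) 0" "N 14 = ad (lday r) 0 + 5 * K"
    and R: "R L = h" "R (L + 3) = lgap r" "R (L + 2) = ltail r" "R (L - 2 * r) = lval r" "R (L - 2 * r + 1) = lprob r"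
    and grid: "grid_ok R"
  shows "triple (\<lambda>s. s = (N, R)) fill_table (K * (11 * (K + 1) * (K + 1) + 8) + 1)
    (\<lambda>(N', R'). (\<forall>a. a \<notin> {5, 6, 7, 8} \<and> a < ad r 0 \<longrightarrow> N' a = N a) \<and> (\<forall>a<ad r 0. R' a = R a) \<and>
       N' 5 = ad (Suc r) 0 \<and> (\<forall>q<K. row_ok N' R' r q))"
proof -
  define J where "J q = (\<lambda>(N' :: nat \<Rightarrow> nat, R' :: nat \<Rightarrow> real).
     (\<forall>a. a \<notin> {5, 6, 7, 8} \<and> a < ad r 0 \<longrightarrow> N' a = N a) \<and> (\<forall>a<ad r 0. R' a = R a) \<and>
     N' 5 = ad r q \<and> N' 6 = ad 0 q \<and> (\<forall>q'<q. row_ok N' R' r q'))" for q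
  have base: "ad 0 0 + 5 * K \<le> ad r 0" using ad_table[OF r(1)] .
  have base20: "L + 20 \<le> ad r 0" by (rule ad_ge)
  have L0: "L - 2 * r + 2 \<le> L" using r L by simp
  have body: "triple (J q) (Seq (Seq copy_cell search_row) (Seq (incr 5 5) (incr 6 5)))
      (11 * (K + 1) * (K + 1) + 7) (J (Suc q))" if q: "q < K" for q
  proof (rule triple_point)
    fix s assume "J q s"
    then obtain N1 R1 where s: "s = (N1, R1)" and
      N1: "\<And>a. a \<notin> {5, 6, 7, 8} \<Longrightarrow> a < ad r 0 \<Longrightarrow> N1 a = N a" and R1: "\<And>a. a < ad r 0 \<Longrightarrow> R1 a = R a"
      and N15: "N1 5 = ad r q" and N16: "N1 6 = ad 0 q" and rows: "\<And>q'. q' < q \<Longrightarrow> row_ok N1 R1 r q'"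
      by (cases s) (auto simp: J_def)
    define e where "e = ad r q"
    have e: "ad r 0 \<le> e" "20 < e" using base20 ad_q[of r q] L by (auto simp: e_def)
    have src: "ad 0 q + 5 \<le> ad r 0" using base q ad_q[of 0 q] by simp
    have N1s: "N1 1 = L" "N1 2 = L - 2 * r" "N1 3 = n" "N1 10 = ad (lnext r) 0" "N1 13 = ad (lnext r) 0 + 5 * K"
      "N1 9 = ad (lday r) 0" "N1 14 = ad (lday r) 0 + 5 * K"
      using N base20 by (auto simp: N1)
    define R2 where "R2 = (snd (run copy_cell (N1, R1)))"
    have R2_eq: "R2 = R1(e := real (bi q) * h, e + 1 := real (xi q) / real n, e + 2 := real (si q) * h,
      e + 3 := big, e + 4 := lval r)"
    proof -
      have g: "R1 (ad 0 q) = real (bi q) * h" "R1 (ad 0 q + 1) = real (xi q) / real n"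
        "R1 (ad 0 q + 2) = real (si q) * h"
        using grid q src by (auto simp: R1 grid_ok_def)
      have l: "R1 L = h" "R1 (L - 2 * r) = lval r" using R base20 by (auto simp: R1)
      have ne: "ad 0 q + 2 < e" "L + 20 \<le> e" "L - 2 * r < e" using src e base20 by auto
      show ?thesis
        unfolding R2_def copy_cell_def using ne N15 N16 N1s g l
        by (simp add: e_def[symmetric] big_def)
    qed
    have run: "run copy_cell s = (N1, R2)" by (simp add: s R2_def copy_cell_def)
    have R2: "R2 a = R1 a" if "a < e" for a using that by (simp add: R2_eq)
    have low: "R2 a = R a" if "a < ad r 0" for a using that e R1 R2 by simp
    have copy: "triple (\<lambda>s'. s' = s) copy_cell 5 (\<lambda>s'. s' = (N1, R2))"
      by (rule triple_straight) (auto simp: run, auto simp: copy_cell_def)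
    have search: "triple (\<lambda>s. s = (N1, R2)) search_row (11 * (K + 1) * (K + 1))
      (\<lambda>(N', R'). (\<forall>a. a \<notin> {7, 8, e, e + 1} \<longrightarrow> N' a = N1 a) \<and> (\<forall>a. a \<noteq> e + 3 \<longrightarrow> R' a = R2 a) \<and>
       best_of K big N' R2 (lgap r) (ltail r) (lprob r) (lval r) (ad (lnext r) 0) (ad (lday r) 0) e
         ({..<K} \<times> {..<K}) (R' (e + 3)))"
    proof (rule search_row_exec)
      show "N1 5 = e" using N15 by (simp add: e_def)
      show "20 < e" by (rule e)
      show "N1 1 + 4 \<le> e" "N1 2 + 2 \<le> N1 1" using N1s base20 e L0 by auto
      show "ad (lnext r) 0 + 5 * K \<le> e" "ad (lday r) 0 + 5 * K \<le> e"
        using ad_table[OF lnext_less[OF r(1)]] ad_table[OF lday_less[OF r(1)]] e by auto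
      show "R2 (N1 1 + 3) = lgap r" "R2 (N1 1 + 2) = ltail r" "R2 (N1 2) = lval r" "R2 (N1 2 + 1) = lprob r"
        using R N1s base20 L0 by (auto simp: low)
      show "R2 (e + 3) = big" by (simp add: R2_eq)
    qed (use N1s in auto)
    have post: "triple (\<lambda>(N', R'). (\<forall>a. a \<notin> {7, 8, e, e + 1} \<longrightarrow> N' a = N1 a) \<and> (\<forall>a. a \<noteq> e + 3 \<longrightarrow> R' a = R2 a) \<and>
       best_of K big N' R2 (lgap r) (ltail r) (lprob r) (lval r) (ad (lnext r) 0) (ad (lday r) 0) e
         ({..<K} \<times> {..<K}) (R' (e + 3))) (Seq (incr 5 5) (incr 6 5)) 2 (J (Suc q))"
    proof (rule triple_straight)
      fix N' R'
      assume "case (N', R') of (N', R') \<Rightarrow> (\<forall>a. a \<notin> {7, 8, e, e + 1} \<longrightarrow> N' a = N1 a) \<and> (\<forall>a. a \<noteq> e + 3 \<longrightarrow> R' a = R2 a) \<and>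
       best_of K big N' R2 (lgap r) (ltail r) (lprob r) (lval r) (ad (lnext r) 0) (ad (lday r) 0) e
         ({..<K} \<times> {..<K}) (R' (e + 3))"
      then have N': "\<And>a. a \<notin> {7, 8, e, e + 1} \<Longrightarrow> N' a = N1 a" and R': "\<And>a. a \<noteq> e + 3 \<Longrightarrow> R' a = R2 a"
        and best: "best_of K big N' R2 (lgap r) (ltail r) (lprob r) (lval r) (ad (lnext r) 0) (ad (lday r) 0) e
         ({..<K} \<times> {..<K}) (R' (e + 3))" by auto
      define N'' where "N'' = N'(5 := ad r (Suc q), 6 := ad 0 (Suc q))"
      have run': "run (Seq (incr 5 5) (incr 6 5)) (N', R') = (N'', R')"
        using N' N15 N16 e by (simp add: N''_def ad_def)
      have "best_of K big N'' R' (lgap r) (ltail r) (lprob r) (lval r) (ad (lnext r) 0) (ad (lday r) 0) e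
         ({..<K} \<times> {..<K}) (R' (e + 3))"
        using best e ad_table[OF lnext_less[OF r(1)]] ad_table[OF lday_less[OF r(1)]]
        by (subst best_of_cong[where R' = R2 and N' = N' and l = 0]) (auto simp: R' N''_def)
      then have new: "row_ok N'' R' r q"
        by (simp add: row_ok_def e_def[symmetric] R', simp add: R2_eq)
      have old: "row_ok N'' R' r q'" if q': "q' < q" for q'
      proof (rule row_ok_cong[OF rows[OF q'] r(1)])
        have le: "ad r q' + 5 \<le> e" using q' ad_q[of r q'] ad_q[of r q] by (simp add: e_def)
        then show "\<And>a. a < ad r q' + 5 \<Longrightarrow> R' a = R1 a" by (simp add: R' R2)
        have "20 < ad r q'" using ad_ge[of r q'] L by simp
        then show "N'' (ad r q') = N1 (ad r q')" "N'' (ad r q' + 1) = N1 (ad r q' + 1)"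
          using le by (auto simp: N''_def N')
      qed
      show "J (Suc q) (run (Seq (incr 5 5) (incr 6 5)) (N', R'))"
        unfolding run' J_def using new old e
        by (auto simp: less_Suc_eq R' low N' N1 N''_def)
    qed auto
    show "triple (\<lambda>s'. s' = s) (Seq (Seq copy_cell search_row) (Seq (incr 5 5) (incr 6 5)))
      (11 * (K + 1) * (K + 1) + 7) (J (Suc q))"
      using triple_Seq[OF triple_Seq[OF copy search] post] by (simp add: ac_simps)
  qed
  have "triple (J 0) fill_table (K * (11 * (K + 1) * (K + 1) + 7 + 1) + 1) (J K)"
    unfolding fill_table_def
  proof (rule triple_While[where I = J, OF body])
    show "tval (NLess (reg 6) (reg 15)) s" if "q < K" "J q s" for q s
      using that N base20 by (auto simp: J_def ad_def)
    show "\<not> tval (NLess (reg 6) (reg 15)) s" if "J K s" for s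
      using that N base20 by (auto simp: J_def ad_def)
  qed
  then show ?thesis
  proof (rule triple_weaken)
    show "J 0 s" if "s = (N, R)" for s using that N by (simp add: J_def)
    show "case s of (N', R') \<Rightarrow> (\<forall>a. a \<notin> {5, 6, 7, 8} \<and> a < ad r 0 \<longrightarrow> N' a = N a) \<and> (\<forall>a<ad r 0. R' a = R a) \<and>
       N' 5 = ad (Suc r) 0 \<and> (\<forall>q<K. row_ok N' R' r q)" if "J K s" for s
      using that by (auto simp: J_def ad_def algebra_simps)
  qed auto
qed

end

section \<open>The stages of the planner\<close>

definition setup_sum :: prog where
  "setup_sum = Seq (Seq (set_fld 1 0 (RDiv (RMem (NConst 0)) (RMul (RConst 4) (ROfIndex (reg 1)))))
     (Seq (set_fld 1 1 (RConst 0)) (set_reg 2 (NConst 1))))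
   (While (NLess (reg 2) (reg 1)) (Seq (set_fld 1 1 (RAdd (fld 1 1) (fld 2 0))) (incr 2 2)))"

text \<open>Reals cannot be converted to indices, so the grid size is found by counting.\<close>

definition setup_size :: prog where
  "setup_size = Seq (set_reg 3 (NConst 1))
    (While (RLess (RMul (ROfIndex (reg 3)) (fld 1 0)) (RAdd (fld 1 1) (RMem (NConst 0)))) (incr 3 1))"

text \<open>Indices admit no division, so the three digits are advanced like an odometer in
  registers 6, 7 and 8.\<close>

definition grid_step :: prog where
  "grid_step = Seq (Seq (set_fld 5 0 (RMul (ROfIndex (reg 6)) (fld 1 0)))
     (Seq (set_fld 5 1 (RDiv (ROfIndex (reg 7)) (ROfIndex (reg 3))))
     (Seq (set_fld 5 2 (RMul (ROfIndex (reg 8)) (fld 1 0)))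
     (Cond (NLess (NConst 0) (NAdd (reg 6) (reg 8))) (set_fld 5 3 big_exp) (set_fld 5 3 (RConst 0))))))
   (Seq (incr 5 5)
     (Cond (NLess (reg 8) (reg 3)) (incr 8 1)
       (Seq (set_reg 8 (NConst 0))
         (Cond (NLess (reg 7) (reg 3)) (incr 7 1) (Seq (set_reg 7 (NConst 0)) (incr 6 1))))))"

definition make_grid :: prog where
  "make_grid = Seq (Seq (set_reg 4 (NAdd (reg 1) (NConst 20))) (Seq (set_reg 5 (reg 4))
     (Seq (set_reg 6 (NConst 0)) (Seq (set_reg 7 (NConst 0)) (set_reg 8 (NConst 0))))))
   (While (NLess (reg 6) (NAdd (reg 3) (NConst 1))) grid_step)"

text \<open>While a day continues, the table just filled supplies the same-day successors. Once the
  day is complete, that table becomes the start of the next day, and the terminal table supplies the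
  successors.\<close>

definition prepare_layer :: prog where
  "prepare_layer = Seq (set_reg 2 (NSub (reg 2) (NConst 2)))
   (Seq (Cond (RLess (fld 1 2) (RConst 1))
      (Seq (set_reg 10 (reg 11)) (set_fld 1 3 (RSub (fld 2 2) (fld 2 0))))
      (Seq (set_reg 10 (reg 4)) (Seq (set_reg 9 (reg 11)) (Seq (set_fld 1 2 (RConst 0)) (set_fld 1 3 (RConst 0))))))
   (Seq (set_reg 11 (reg 5)) (Seq (set_reg 6 (reg 4)) (Seq (set_reg 13 (NAdd (reg 10) (reg 12)))
   (Seq (set_reg 14 (NAdd (reg 9) (reg 12))) (set_reg 15 (NAdd (reg 4) (reg 12))))))))"

definition layer_loop :: prog where
  "layer_loop = Seq (Seq (set_reg 12 (NSub (reg 5) (reg 4))) (Seq (set_reg 2 (reg 1)) (Seq (set_fld 1 2 (RConst 1))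
     (Seq (set_reg 9 (reg 4)) (set_reg 11 (reg 4))))))
   (While (NLess (NConst 1) (reg 2))
     (Seq (Seq prepare_layer fill_table) (set_fld 1 2 (RAdd (fld 1 2) (fld 2 1)))))"

text \<open>The score is target minus exact promise. The final registers declare the whole memory
  below the free address to be the output; the index list starts at cell 2, so it is shorter by
  2.\<close>

definition choose_start :: prog where
  "choose_start = Seq (Seq (Seq (set_reg 6 (reg 11)) (set_reg 7 (reg 11)))
   (While (NLess (reg 7) (reg 5))
     (Seq (Cond (RLess (RSub (RSub (fld 6 2) (fld 6 0)) (fld 6 3)) (RSub (RSub (fld 7 2) (fld 7 0)) (fld 7 3)))
       (set_reg 6 (reg 7)) Skip) (incr 7 5))))
   (Seq (RAssign (NConst 0) (ROfIndex (reg 6)))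
     (Seq (set_reg 0 (NSub (reg 5) (NConst 2))) (set_reg 1 (reg 5))))"

definition planner :: prog where
  "planner = Seq (Seq (Seq (Seq setup_sum setup_size) make_grid) layer_loop) choose_start"

section \<open>Correctness and running time of the planner\<close>

locale layers_run = layers +
  assumes M_pos: "0 < M" and h: "h = R0 0 / (4 * real L)" and h_pos: "0 < h" and n_pos: "0 < n"
    and n_large: "(\<Sum>l<M. R0 (Suc (2 * l))) + R0 0 \<le> real n * h"
    and n_least: "\<And>j. 0 < j \<Longrightarrow> j < n \<Longrightarrow> real j * h < (\<Sum>l<M. R0 (Suc (2 * l))) + R0 0"
begin

lemma K_pos: "0 < K" by (simp add: K_def)

definition input_kept :: "mem \<Rightarrow> bool" where
  "input_kept s \<longleftrightarrow> fst s 1 = L \<and> (\<forall>a<L. snd s a = R0 a) \<and> snd s L = h"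

lemma L_ge3: "3 \<le> L" using L M_pos by simp

lemma setup_sum_exec:
  "triple (\<lambda>(N, R). N 1 = L \<and> (\<forall>a<L. R a = R0 a)) setup_sum (3 + (M * 3 + 1))
    (\<lambda>(N, R). input_kept (N, R) \<and> R (L + 1) = (\<Sum>l<M. R0 (Suc (2 * l))))"
proof -
  define J where "J j = (\<lambda>(N, R). input_kept (N, R) \<and> N 2 = Suc (2 * j) \<and> R (L + 1) = (\<Sum>l<j. R0 (Suc (2 * l))))" for j
  have "triple (J 0) (While (NLess (reg 2) (reg 1)) (Seq (set_fld 1 1 (RAdd (fld 1 1) (fld 2 0))) (incr 2 2)))
    (M * (2 + 1) + 1) (J M)"
  proof (rule triple_While)
    fix j assume j: "j < M"
    show "triple (J j) (Seq (set_fld 1 1 (RAdd (fld 1 1) (fld 2 0))) (incr 2 2)) 2 (J (Suc j))"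
    proof (rule triple_straight)
      fix N R assume J: "J j (N, R)"
      have lt: "Suc (2 * j) < L" using j L by simp
      then show "J (Suc j) (run (Seq (set_fld 1 1 (RAdd (fld 1 1) (fld 2 0))) (incr 2 2)) (N, R))"
        using J unfolding J_def input_kept_def by simp
    qed auto
    show "tval (NLess (reg 2) (reg 1)) s" if "J j s" for s
      using that j L unfolding J_def input_kept_def by (cases s) simp
  next
    show "\<not> tval (NLess (reg 2) (reg 1)) s" if "J M s" for s
      using that L unfolding J_def input_kept_def by (cases s) simp
  qed
  note loop = this
  have init: "triple (\<lambda>(N, R). N 1 = L \<and> (\<forall>a<L. R a = R0 a)) (Seq (set_fld 1 0 (RDiv (RMem (NConst 0)) (RMul (RConst 4) (ROfIndex (reg 1)))))
     (Seq (set_fld 1 1 (RConst 0)) (set_reg 2 (NConst 1)))) 3 (J 0)"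
    using L_ge3 unfolding J_def input_kept_def
    by (intro triple_straight) (simp_all add: h)
  show ?thesis
    unfolding setup_sum_def
    by (rule triple_weaken[OF triple_Seq[OF init loop]]) (auto simp: J_def)
qed

lemma setup_size_exec:
  "triple (\<lambda>(N, R). input_kept (N, R) \<and> R (L + 1) = (\<Sum>l<M. R0 (Suc (2 * l)))) setup_size (1 + ((n - 1) * 2 + 1))
    (\<lambda>(N, R). input_kept (N, R) \<and> N 3 = n)"
proof -
  define J where "J j = (\<lambda>(N, R). input_kept (N, R) \<and> N 3 = Suc j \<and> R (L + 1) = (\<Sum>l<M. R0 (Suc (2 * l))))" for j
  have "triple (J 0) (While (RLess (RMul (ROfIndex (reg 3)) (fld 1 0)) (RAdd (fld 1 1) (RMem (NConst 0)))) (incr 3 1))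
    ((n - 1) * (1 + 1) + 1) (J (n - 1))"
  proof (rule triple_While)
    fix j assume j: "j < n - 1"
    show "triple (J j) (incr 3 1) 1 (J (Suc j))"
      by (intro triple_straight) (auto simp: J_def input_kept_def)
    fix s assume "J j s"
    then show "tval (RLess (RMul (ROfIndex (reg 3)) (fld 1 0)) (RAdd (fld 1 1) (RMem (NConst 0)))) s"
      using n_least[of "Suc j"] j L_ge3 by (auto simp: J_def input_kept_def)
  next
    fix s assume "J (n - 1) s"
    then show "\<not> tval (RLess (RMul (ROfIndex (reg 3)) (fld 1 0)) (RAdd (fld 1 1) (RMem (NConst 0)))) s"
      using n_large n_pos L_ge3 by (auto simp: J_def input_kept_def)
  qed
  note loop = this
  have init: "triple (\<lambda>(N, R). input_kept (N, R) \<and> R (L + 1) = (\<Sum>l<M. R0 (Suc (2 * l)))) (set_reg 3 (NConst 1)) 1 (J 0)"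
    by (intro triple_straight) (auto simp: J_def input_kept_def)
  show ?thesis
    unfolding setup_size_def
    by (rule triple_weaken[OF triple_Seq[OF init loop]]) (use n_pos in \<open>auto simp: J_def\<close>)
qed

lemma odometer:
  "si (Suc q) = (if si q < n then Suc (si q) else 0)"
  "xi (Suc q) = (if si q < n then xi q else if xi q < n then Suc (xi q) else 0)"
  "bi (Suc q) = (if si q < n then bi q else if xi q < n then bi q else Suc (bi q))"
proof -
  have s: "si q < n \<or> si q = n" and x: "xi q < n \<or> xi q = n"
    unfolding le_less[symmetric] by (simp_all add: si_def xi_def less_Suc_eq_le[symmetric])
  show "si (Suc q) = (if si q < n then Suc (si q) else 0)"
    using s by (auto simp: si_def mod_Suc)
  have d: "Suc q div (n + 1) = (if si q < n then q div (n + 1) else Suc (q div (n + 1)))"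
    using s by (auto simp: si_def div_Suc mod_Suc)
  show "xi (Suc q) = (if si q < n then xi q else if xi q < n then Suc (xi q) else 0)"
    using x unfolding xi_def d by (auto simp: mod_Suc)
  show "bi (Suc q) = (if si q < n then bi q else if xi q < n then bi q else Suc (bi q))"
    using x unfolding bi_def xi_def d by (auto simp: div_Suc mod_Suc)
qed

lemma coords_0: "bi 0 = 0" "xi 0 = 0" "si 0 = 0"
  by (simp_all add: bi_def xi_def si_def)

lemma bi_le: "q < K \<Longrightarrow> bi q \<le> n"
  by (simp add: bi_def K_def less_mult_imp_div_less less_Suc_eq_le[symmetric] mult.assoc)

text \<open>The leading digit overflows exactly at \<open>K\<close>, which ends the loop that writes
  the grid.\<close>

lemma bi_K: "bi K = n + 1"
  unfolding bi_def K_def by (simp only: nonzero_mult_div_cancel_right)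

lemma make_grid_exec:
  "triple (\<lambda>(N, R). input_kept (N, R) \<and> N 3 = n) make_grid (5 + (K * 12 + 1))
    (\<lambda>(N, R). input_kept (N, R) \<and> N 3 = n \<and> N 4 = ad 0 0 \<and> N 5 = ad 0 K \<and> grid_ok R)"
proof -
  define J where "J q = (\<lambda>(N, R). input_kept (N, R) \<and> N 3 = n \<and> N 4 = ad 0 0 \<and> N 5 = ad 0 q \<and>
    N 6 = bi q \<and> N 7 = xi q \<and> N 8 = si q \<and> (\<forall>i<q. R (ad 0 i) = real (bi i) * h \<and> R (ad 0 i + 1) = real (xi i) / real n \<and>
     R (ad 0 i + 2) = real (si i) * h \<and> R (ad 0 i + 3) = (if bi i + si i = 0 then 0 else big)))" for q
  have "triple (J 0) (While (NLess (reg 6) (NAdd (reg 3) (NConst 1))) grid_step) (K * (11 + 1) + 1) (J K)"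
  proof (rule triple_While)
    fix q assume q: "q < K"
    show "triple (J q) grid_step 11 (J (Suc q))"
    proof (rule triple_straight)
      fix N R assume J: "J q (N, R)"
      define e where "e = ad 0 q"
      define R' where "R' = R(e := real (bi q) * h, e + 1 := real (xi q) / real n, e + 2 := real (si q) * h,
        e + 3 := if bi q + si q = 0 then 0 else big)"
      define N' where "N' = N(5 := ad 0 (Suc q), 8 := si (Suc q), 7 := xi (Suc q), 6 := bi (Suc q))"
      have J': "N 1 = L" "N 3 = n" "N 4 = ad 0 0" "N 5 = e" "N 6 = bi q" "N 7 = xi q" "N 8 = si q" "R L = h"
        using J by (auto simp: J_def input_kept_def e_def)
      have e: "L + 20 \<le> e" "ad 0 (Suc q) = e + 5" by (simp_all add: e_def ad_def)
      have "run grid_step (N, R) = (N', R')"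
        using J' e by (auto simp: grid_step_def R'_def N'_def odometer big_def)
      moreover have "J (Suc q) (N', R')"
      proof -
        have old: "R' (ad 0 i) = R (ad 0 i)" "R' (ad 0 i + 1) = R (ad 0 i + 1)" "R' (ad 0 i + 2) = R (ad 0 i + 2)"
          "R' (ad 0 i + 3) = R (ad 0 i + 3)" if "i < q" for i
        proof -
          have "ad 0 i + 5 \<le> e" using that by (simp add: ad_def e_def)
          then show "R' (ad 0 i) = R (ad 0 i)" "R' (ad 0 i + 1) = R (ad 0 i + 1)" "R' (ad 0 i + 2) = R (ad 0 i + 2)"
            "R' (ad 0 i + 3) = R (ad 0 i + 3)" by (simp_all add: R'_def)
        qed
        have "input_kept (N', R')"
          using J J' e(1) unfolding J_def input_kept_def by (simp add: N'_def R'_def)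
        moreover have "R' (ad 0 i) = real (bi i) * h \<and> R' (ad 0 i + 1) = real (xi i) / real n \<and>
          R' (ad 0 i + 2) = real (si i) * h \<and> R' (ad 0 i + 3) = (if bi i + si i = 0 then 0 else big)"
          if "i < Suc q" for i
        proof (cases "i = q")
          case True
          then show ?thesis by (simp add: e_def[symmetric], simp add: R'_def)
        next
          case False
          then have "i < q" using that by simp
          then show ?thesis using J unfolding old[OF \<open>i < q\<close>] J_def by simp
        qed
        ultimately show ?thesis using J' by (simp add: J_def N'_def)
      qed
      ultimately show "J (Suc q) (run grid_step (N, R))" by simp
    qed (auto simp: grid_step_def)
  qed (use bi_le bi_K in \<open>auto simp: J_def less_Suc_eq_le\<close>)
  note loop = this
  have init: "triple (\<lambda>(N, R). input_kept (N, R) \<and> N 3 = n) (Seq (set_reg 4 (NAdd (reg 1) (NConst 20))) (Seq (set_reg 5 (reg 4))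
     (Seq (set_reg 6 (NConst 0)) (Seq (set_reg 7 (NConst 0)) (set_reg 8 (NConst 0)))))) 5 (J 0)"
    by (intro triple_straight) (auto simp: J_def input_kept_def coords_0 ad_def)
  show ?thesis
    unfolding make_grid_def
    by (rule triple_weaken[OF triple_Seq[OF init loop]]) (simp_all add: J_def grid_ok_def split_beta)
qed

lemma prepare_layer_run:
  assumes N: "N 1 = L" "N 2 = P + 2" "N 4 = ad 0 0" "N 5 = ad (Suc r) 0" "N 9 = ad (lday r) 0" "N 11 = ad r 0"
      "N 12 = 5 * K"
    and R: "R (L + 2) = mass r" "R P = lval (Suc r)" "mass r < 1 \<Longrightarrow> R (P + 2) = lval r" and P: "P < L"
  shows "\<exists>N' R'. run prepare_layer (N, R) = (N', R') \<and>
    (\<forall>a. a \<notin> {2, 6, 9, 10, 11, 13, 14, 15} \<longrightarrow> N' a = N a) \<and> (\<forall>a. a \<notin> {L + 2, L + 3} \<longrightarrow> R' a = R a) \<and>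
    N' 2 = P \<and> N' 6 = ad 0 0 \<and> N' 9 = ad (lday (Suc r)) 0 \<and> N' 10 = ad (lnext (Suc r)) 0 \<and>
    N' 11 = ad (Suc r) 0 \<and> N' 13 = ad (lnext (Suc r)) 0 + 5 * K \<and> N' 14 = ad (lday (Suc r)) 0 + 5 * K \<and>
    N' 15 = ad 0 K \<and> R' (L + 2) = ltail (Suc r) \<and> R' (L + 3) = lgap (Suc r)"
proof -
  have K5: "ad 0 K = ad 0 0 + 5 * K" by (rule ad_q)
  show ?thesis
  proof (cases "mass r < 1")
    case True
    have "run prepare_layer (N, R) = (N(2 := P, 10 := ad r 0, 11 := ad (Suc r) 0,
      6 := ad 0 0, 13 := ad r 0 + 5 * K, 14 := ad (lday r) 0 + 5 * K, 15 := ad 0 K),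
      R(L + 3 := lval r - lval (Suc r)))"
      using N R(1,2) R(3)[OF True] True unfolding prepare_layer_def K5 by simp
    then show ?thesis
      using N R(1) True by (simp add: ltail_def lgap_def lnext_def K5)
  next
    case False
    have "run prepare_layer (N, R) = (N(2 := P, 10 := ad 0 0, 9 := ad r 0, 11 := ad (Suc r) 0,
      6 := ad 0 0, 13 := ad 0 0 + 5 * K, 14 := ad r 0 + 5 * K, 15 := ad 0 K), R(L + 2 := 0, L + 3 := 0))"
      using N R(1,2) False unfolding prepare_layer_def K5 by simp
    then show ?thesis
      using N R(1) False by (simp add: ltail_def lgap_def lnext_def K5)
  qed
qed

definition tables_ok :: "nat \<Rightarrow> mem \<Rightarrow> bool" where
  "tables_ok r s \<longleftrightarrow> grid_ok (snd s) \<and> (\<forall>r'\<in>{1..r}. \<forall>q<K. row_ok (fst s) (snd s) r' q)"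

text \<open>Frame rule for everything outside the filled tables: input, constants, registers and the
  memory not yet in use.\<close>

lemma tables_ok_cong:
  assumes "tables_ok r (N, R)" "\<And>a. L + 20 \<le> a \<Longrightarrow> a < ad (Suc r) 0 \<Longrightarrow> R' a = R a"
    "\<And>a. L + 20 \<le> a \<Longrightarrow> a < ad (Suc r) 0 \<Longrightarrow> N' a = N a"
  shows "tables_ok r (N', R')"
proof -
  have le: "ad r' q + 5 \<le> ad (Suc r) 0" if "r' \<le> r" "q < K" for r' q
  proof -
    have "ad r' q + 5 \<le> ad r' 0 + 5 * K" using that by (simp add: ad_q[of r' q])
    also have "\<dots> \<le> ad (Suc r) 0" using that by (intro ad_table) simp
    finally show ?thesis .
  qed
  have "row_ok N' R' r' q" if r': "r' \<in> {1..r}" "q < K" for r' q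
  proof -
    have l: "ad r' q + 5 \<le> ad (Suc r) 0" using le r' by simp
    show ?thesis
    proof (rule row_ok_cong)
      show "row_ok N R r' q" using assms(1) r' by (simp add: tables_ok_def)
      show "0 < r'" using r' by simp
      show "R' a = R a" if "L + 20 \<le> a" "a < ad r' q + 5" for a
        using assms(2)[OF that(1)] that(2) l by simp
      show "N' (ad r' q) = N (ad r' q)" "N' (ad r' q + 1) = N (ad r' q + 1)"
        using assms(3)[of "ad r' q"] assms(3)[of "ad r' q + 1"] l ad_ge[of r' q] by simp_all
    qed
  qed
  moreover have "grid_ok R'"
  proof -
    have "R' (ad 0 q + c) = R (ad 0 q + c)" if "q < K" "c < 5" for q c
      using assms(2)[of "ad 0 q + c"] le[of 0 q] ad_ge[of 0 q] that by simp
    from this[of _ 0] this[of _ 1] this[of _ 2] this[of _ 3]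
    show ?thesis using assms(1) unfolding tables_ok_def grid_ok_def by simp
  qed
  ultimately show ?thesis by (simp add: tables_ok_def)
qed

definition at_layer :: "nat \<Rightarrow> mem \<Rightarrow> bool" where
  "at_layer r s \<longleftrightarrow> input_kept s \<and> fst s 2 = L - 2 * r \<and> fst s 3 = n \<and> fst s 4 = ad 0 0 \<and> fst s 5 = ad (Suc r) 0 \<and>
     fst s 9 = ad (lday r) 0 \<and> fst s 11 = ad r 0 \<and> fst s 12 = 5 * K \<and> snd s (L + 2) = mass r \<and> tables_ok r s"

lemma layer_step:
  assumes r: "r < M"
  shows "triple (at_layer r) (Seq (Seq prepare_layer fill_table) (set_fld 1 2 (RAdd (fld 1 2) (fld 2 1))))
    (K * (11 * (K + 1) * (K + 1) + 8) + 13) (at_layer (Suc r))"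
proof (rule triple_point)
  fix s assume s: "at_layer r s"
  obtain N R where NR: "s = (N, R)" by (cases s)
  define P where "P = L - 2 * Suc r"
  have P: "L - 2 * r = P + 2" "P + 1 < L" "P = L - 2 * Suc r" "0 < r \<Longrightarrow> P + 2 < L"
    using r L by (auto simp: P_def)
  have N: "N 1 = L" "N 2 = P + 2" "N 3 = n" "N 4 = ad 0 0" "N 5 = ad (Suc r) 0" "N 9 = ad (lday r) 0" "N 11 = ad r 0"
    "N 12 = 5 * K" and R: "R L = h" "R (L + 2) = mass r" "\<forall>a<L. R a = R0 a" and ok: "tables_ok r (N, R)"
    using s P(1) unfolding NR at_layer_def input_kept_def by simp_all
  have v: "R P = lval (Suc r)" "R (P + 1) = lprob (Suc r)"
    using R(3) P(2) by (simp_all add: lval_def lprob_def P_def)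
  \<comment> \<open>\<open>mass 0 = 1\<close> excludes layer 0, so the value of the previous layer
    is read inside the input.\<close>
  have v': "R (P + 2) = lval r" if "mass r < 1"
  proof -
    have "0 < r" using that by (cases r) auto
    then show ?thesis using R(3) P by (simp add: lval_def)
  qed
  have "P < L" using P by simp
  from prepare_layer_run[OF N(1,2,4,5,6,7,8) R(2) v(1) v' this]
  obtain N1 R1 where run: "run prepare_layer (N, R) = (N1, R1)"
    and N1: "\<And>a. a \<notin> {2, 6, 9, 10, 11, 13, 14, 15} \<Longrightarrow> N1 a = N a" and R1: "\<And>a. a \<notin> {L + 2, L + 3} \<Longrightarrow> R1 a = R a"
    and N1s: "N1 2 = P" "N1 6 = ad 0 0" "N1 9 = ad (lday (Suc r)) 0" "N1 10 = ad (lnext (Suc r)) 0"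
      "N1 11 = ad (Suc r) 0" "N1 13 = ad (lnext (Suc r)) 0 + 5 * K" "N1 14 = ad (lday (Suc r)) 0 + 5 * K"
      "N1 15 = ad 0 K" and R1s: "R1 (L + 2) = ltail (Suc r)" "R1 (L + 3) = lgap (Suc r)" by blast
  have N1': "N1 1 = L" "N1 3 = n" "N1 4 = ad 0 0" "N1 5 = ad (Suc r) 0" "N1 12 = 5 * K"
    using N by (simp_all add: N1)
  have R1': "R1 L = h" "\<And>a. a < L \<Longrightarrow> R1 a = R0 a" using R by (simp_all add: R1)
  have ok1: "tables_ok r (N1, R1)"
    using ok by (rule tables_ok_cong) (use L_ge3 in \<open>auto intro!: R1 N1\<close>)
  have grid1: "grid_ok R1" using ok1 by (simp add: tables_ok_def)
  have prep: "triple (\<lambda>s'. s' = s) prepare_layer 11 (\<lambda>s'. s' = (N1, R1))"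
    by (rule triple_straight) (simp_all add: NR run, simp_all add: prepare_layer_def)
  have fill: "triple (\<lambda>s. s = (N1, R1)) fill_table (K * (11 * (K + 1) * (K + 1) + 8) + 1)
    (\<lambda>(N', R'). (\<forall>a. a \<notin> {5, 6, 7, 8} \<and> a < ad (Suc r) 0 \<longrightarrow> N' a = N1 a) \<and> (\<forall>a<ad (Suc r) 0. R' a = R1 a) \<and>
       N' 5 = ad (Suc (Suc r)) 0 \<and> (\<forall>q<K. row_ok N' R' (Suc r) q))"
  proof (rule fill_table_exec)
    show "N1 2 = L - 2 * Suc r" "R1 (L - 2 * Suc r) = lval (Suc r)" "R1 (L - 2 * Suc r + 1) = lprob (Suc r)"
      unfolding P(3)[symmetric] using N1s(1) v P(2) by (simp_all add: R1)
  qed (use r N1' N1s R1' R1s grid1 in simp_all)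
  have post: "triple (\<lambda>(N', R'). (\<forall>a. a \<notin> {5, 6, 7, 8} \<and> a < ad (Suc r) 0 \<longrightarrow> N' a = N1 a) \<and> (\<forall>a<ad (Suc r) 0. R' a = R1 a) \<and>
       N' 5 = ad (Suc (Suc r)) 0 \<and> (\<forall>q<K. row_ok N' R' (Suc r) q))
     (set_fld 1 2 (RAdd (fld 1 2) (fld 2 1))) 1 (at_layer (Suc r))"
  proof (rule triple_straight)
    fix N' R'
    assume "case (N', R') of (N', R') \<Rightarrow> (\<forall>a. a \<notin> {5, 6, 7, 8} \<and> a < ad (Suc r) 0 \<longrightarrow> N' a = N1 a) \<and> (\<forall>a<ad (Suc r) 0. R' a = R1 a) \<and>
       N' 5 = ad (Suc (Suc r)) 0 \<and> (\<forall>q<K. row_ok N' R' (Suc r) q)"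
    then have N': "\<And>a. a \<notin> {5, 6, 7, 8} \<Longrightarrow> a < ad (Suc r) 0 \<Longrightarrow> N' a = N1 a" and R': "\<And>a. a < ad (Suc r) 0 \<Longrightarrow> R' a = R1 a"
      and N'5: "N' 5 = ad (Suc (Suc r)) 0" and rows: "\<And>q. q < K \<Longrightarrow> row_ok N' R' (Suc r) q" by auto
    have big_ad: "L + 20 \<le> ad (Suc r) 0" by (rule ad_ge)
    have N's: "N' 1 = L" "N' 2 = P" "N' 3 = n" "N' 4 = ad 0 0" "N' 9 = ad (lday (Suc r)) 0" "N' 11 = ad (Suc r) 0" "N' 12 = 5 * K"
      using N1' N1s(1,3,5) big_ad by (simp_all add: N')
    have R's: "R' L = h" "\<And>a. a < L \<Longrightarrow> R' a = R0 a" "R' (L + 2) = ltail (Suc r)"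
      using R1' R1s(1) big_ad by (simp_all add: R')
    have R'P: "R' (P + 1) = lprob (Suc r)"
      using R's(2)[OF P(2)] by (simp add: lprob_def P_def)
    have "tables_ok r (N', R')"
      using ok1 by (rule tables_ok_cong) (use L_ge3 in \<open>auto intro!: R' N'\<close>)
    then have "tables_ok (Suc r) (N', R')"
      using rows by (auto simp: tables_ok_def le_Suc_eq)
    then have ok': "tables_ok (Suc r) (N', R'(L + 2 := mass (Suc r)))"
      by (rule tables_ok_cong) auto
    have run': "run (set_fld 1 2 (RAdd (fld 1 2) (fld 2 1))) (N', R') = (N', R'(L + 2 := mass (Suc r)))"
      using N's R's(3) R'P by (simp add: ltail_def)
    show "at_layer (Suc r) (run (set_fld 1 2 (RAdd (fld 1 2) (fld 2 1))) (N', R'))"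
      unfolding run' at_layer_def input_kept_def
      using N's R's(1,2) ok' N'5 P(3) by simp
  qed simp_all
  show "triple (\<lambda>s'. s' = s) (Seq (Seq prepare_layer fill_table) (set_fld 1 2 (RAdd (fld 1 2) (fld 2 1))))
    (K * (11 * (K + 1) * (K + 1) + 8) + 13) (at_layer (Suc r))"
    by (rule triple_weaken[OF triple_Seq[OF triple_Seq[OF prep fill] post]]) simp_all
qed

lemma layer_loop_exec:
  "triple (\<lambda>(N, R). input_kept (N, R) \<and> N 3 = n \<and> N 4 = ad 0 0 \<and> N 5 = ad 0 K \<and> grid_ok R) layer_loop
    (5 + (M * (K * (11 * (K + 1) * (K + 1) + 8) + 13 + 1) + 1)) (at_layer M)"
proof -
  have loop: "triple (at_layer 0) (While (NLess (NConst 1) (reg 2))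
     (Seq (Seq prepare_layer fill_table) (set_fld 1 2 (RAdd (fld 1 2) (fld 2 1)))))
     (M * (K * (11 * (K + 1) * (K + 1) + 8) + 13 + 1) + 1) (at_layer M)"
  proof (rule triple_While)
    show "triple (at_layer r) (Seq (Seq prepare_layer fill_table) (set_fld 1 2 (RAdd (fld 1 2) (fld 2 1))))
      (K * (11 * (K + 1) * (K + 1) + 8) + 13) (at_layer (Suc r))" if "r < M" for r by (rule layer_step[OF that])
    show "tval (NLess (NConst 1) (reg 2)) s" if "r < M" "at_layer r s" for r s
      using that L unfolding at_layer_def by simp
    show "\<not> tval (NLess (NConst 1) (reg 2)) s" if "at_layer M s" for s
      using that L unfolding at_layer_def by simp
  qed
  have init: "triple (\<lambda>(N, R). input_kept (N, R) \<and> N 3 = n \<and> N 4 = ad 0 0 \<and> N 5 = ad 0 K \<and> grid_ok R)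
    (Seq (set_reg 12 (NSub (reg 5) (reg 4))) (Seq (set_reg 2 (reg 1)) (Seq (set_fld 1 2 (RConst 1))
     (Seq (set_reg 9 (reg 4)) (set_reg 11 (reg 4)))))) 5 (at_layer 0)"
  proof (rule triple_straight)
    fix N :: "nat \<Rightarrow> nat" and R :: "nat \<Rightarrow> real"
    assume "case (N, R) of (N, R) \<Rightarrow> input_kept (N, R) \<and> N 3 = n \<and> N 4 = ad 0 0 \<and> N 5 = ad 0 K \<and> grid_ok R"
    then have N: "N 1 = L" "N 3 = n" "N 4 = ad 0 0" "N 5 = ad 0 K" "R L = h" "\<forall>a<L. R a = R0 a" "grid_ok R"
      by (simp_all add: input_kept_def)
    have d: "ad 0 K - ad 0 0 = 5 * K" "ad 0 K = ad (Suc 0) 0" by (simp_all add: ad_def)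
    have t: "tables_ok 0 (N, R)" using N by (simp add: tables_ok_def)
    have t': "tables_ok 0 (N(12 := 5 * K, 2 := L, 9 := ad 0 0, 11 := ad 0 0), R(L + 2 := 1))"
      using t by (rule tables_ok_cong) auto
    have "run (Seq (set_reg 12 (NSub (reg 5) (reg 4))) (Seq (set_reg 2 (reg 1)) (Seq (set_fld 1 2 (RConst 1))
      (Seq (set_reg 9 (reg 4)) (set_reg 11 (reg 4)))))) (N, R) =
      (N(12 := 5 * K, 2 := L, 9 := ad 0 0, 11 := ad 0 0), R(L + 2 := 1))"
      using N(1-4) d(1) by simp
    then show "at_layer 0 (run (Seq (set_reg 12 (NSub (reg 5) (reg 4))) (Seq (set_reg 2 (reg 1)) (Seq (set_fld 1 2 (RConst 1))
      (Seq (set_reg 9 (reg 4)) (set_reg 11 (reg 4)))))) (N, R))"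
      using N t' d(2) by (simp add: at_layer_def input_kept_def)
  qed simp_all
  show ?thesis unfolding layer_loop_def by (rule triple_Seq[OF init loop])
qed

section \<open>Choice of the start cell\<close>

definition score :: "(nat \<Rightarrow> real) \<Rightarrow> nat \<Rightarrow> real" where
  "score R e = R (e + 2) - R e - R (e + 3)"

definition planned :: "mem \<Rightarrow> bool" where
  "planned s \<longleftrightarrow> tables_ok M s \<and> (\<forall>a. 0 < a \<and> a < L \<longrightarrow> snd s a = R0 a) \<and>
     fst s 0 = ad (Suc M) 0 - 2 \<and> fst s 1 = ad (Suc M) 0 \<and>
     (\<exists>q<K. snd s 0 = real (ad M q) \<and> (\<forall>q'<K. score (snd s) (ad M q') \<le> score (snd s) (ad M q)))"

lemma choose_start_exec: "triple (at_layer M) choose_start (2 + (K * 4 + 1) + 3) planned"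
proof (rule triple_point)
  fix s assume s: "at_layer M s"
  obtain N R where NR: "s = (N, R)" by (cases s)
  have N: "N 5 = ad (Suc M) 0" "N 11 = ad M 0" and R: "\<forall>a<L. R a = R0 a" and ok: "tables_ok M (N, R)"
    using s unfolding NR at_layer_def input_kept_def by simp_all
  define J where "J j = (\<lambda>(N', R'). R' = R \<and> (\<forall>a. a \<notin> {6, 7} \<longrightarrow> N' a = N a) \<and> N' 7 = ad M j \<and>
    (\<exists>q<K. N' 6 = ad M q \<and> (\<forall>q'<j. score R (ad M q') \<le> score R (ad M q))))" for j
  have end_ad: "ad (Suc M) 0 = ad M K" by (simp add: ad_def)
  have init: "triple (\<lambda>s'. s' = s) (Seq (set_reg 6 (reg 11)) (set_reg 7 (reg 11))) 2 (J 0)"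
    by (rule triple_straight) (use N K_pos in \<open>auto simp: NR J_def\<close>)
  have loop: "triple (J 0) (While (NLess (reg 7) (reg 5))
     (Seq (Cond (RLess (RSub (RSub (fld 6 2) (fld 6 0)) (fld 6 3)) (RSub (RSub (fld 7 2) (fld 7 0)) (fld 7 3)))
       (set_reg 6 (reg 7)) Skip) (incr 7 5))) (K * (3 + 1) + 1) (J K)"
  proof (rule triple_While)
    fix j assume j: "j < K"
    show "triple (J j) (Seq (Cond (RLess (RSub (RSub (fld 6 2) (fld 6 0)) (fld 6 3)) (RSub (RSub (fld 7 2) (fld 7 0)) (fld 7 3)))
       (set_reg 6 (reg 7)) Skip) (incr 7 5)) 3 (J (Suc j))"
    proof (rule triple_straight)
      fix N' R' assume J: "J j (N', R')"
      then obtain q where q: "q < K" "N' 6 = ad M q" "\<And>q'. q' < j \<Longrightarrow> score R (ad M q') \<le> score R (ad M q)"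
        and N': "R' = R" "\<And>a. a \<notin> {6, 7} \<Longrightarrow> N' a = N a" "N' 7 = ad M j" by (auto simp: J_def)
      let ?c = "Seq (Cond (RLess (RSub (RSub (fld 6 2) (fld 6 0)) (fld 6 3)) (RSub (RSub (fld 7 2) (fld 7 0)) (fld 7 3)))
       (set_reg 6 (reg 7)) Skip) (incr 7 5)"
      have a5: "ad M (Suc j) = ad M j + 5" by (simp add: ad_def)
      have run: "run ?c (N', R') = (if score R (ad M q) < score R (ad M j)
          then (N'(6 := ad M j, 7 := ad M (Suc j)), R) else (N'(7 := ad M (Suc j)), R))"
        using q(2) N'(1,3) by (simp add: score_def a5)
      show "J (Suc j) (run ?c (N', R'))"
      proof (cases "score R (ad M q) < score R (ad M j)")
        case True
        have "score R (ad M q') \<le> score R (ad M j)" if "q' < Suc j" for q'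
          using q(3)[of q'] True that by (cases "q' = j") auto
        then show ?thesis unfolding run J_def using True j N'(2) by auto
      next
        case False
        have "score R (ad M q') \<le> score R (ad M q)" if "q' < Suc j" for q'
          using q(3)[of q'] False that by (cases "q' = j") auto
        then show ?thesis unfolding run J_def using False q(1,2) N'(2) by auto
      qed
    qed simp_all
    show "tval (NLess (reg 7) (reg 5)) s" if "J j s" for s
      using that j N by (cases s) (auto simp: J_def ad_def)
  next
    show "\<not> tval (NLess (reg 7) (reg 5)) s" if "J K s" for s
      using that N by (cases s) (auto simp: J_def ad_def)
  qed
  have fin: "triple (J K) (Seq (RAssign (NConst 0) (ROfIndex (reg 6)))
     (Seq (set_reg 0 (NSub (reg 5) (NConst 2))) (set_reg 1 (reg 5)))) 3 planned"
  proof (rule triple_straight)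
    fix N' R' assume J: "J K (N', R')"
    then obtain q where q: "q < K" "N' 6 = ad M q" "\<And>q'. q' < K \<Longrightarrow> score R (ad M q') \<le> score R (ad M q)"
      and N': "R' = R" "\<And>a. a \<notin> {6, 7} \<Longrightarrow> N' a = N a" by (auto simp: J_def)
    have run: "run (Seq (RAssign (NConst 0) (ROfIndex (reg 6)))
     (Seq (set_reg 0 (NSub (reg 5) (NConst 2))) (set_reg 1 (reg 5)))) (N', R') =
      (N'(0 := ad (Suc M) 0 - 2, 1 := ad (Suc M) 0), R(0 := real (ad M q)))"
      using N N' q(2) by simp
    have "tables_ok M (N'(0 := ad (Suc M) 0 - 2, 1 := ad (Suc M) 0), R(0 := real (ad M q)))"
      using ok by (rule tables_ok_cong) (auto simp: N')
    moreover have "score (R(0 := real (ad M q))) (ad M q') = score R (ad M q')" for q'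
      using ad_ge[of M q'] by (simp add: score_def)
    ultimately show "planned (run (Seq (RAssign (NConst 0) (ROfIndex (reg 6)))
     (Seq (set_reg 0 (NSub (reg 5) (NConst 2))) (set_reg 1 (reg 5)))) (N', R'))"
      unfolding run planned_def using q R by auto
  qed simp_all
  show "triple (\<lambda>s'. s' = s) choose_start (2 + (K * 4 + 1) + 3) planned"
    unfolding choose_start_def
    by (rule triple_weaken[OF triple_Seq[OF triple_Seq[OF init loop] fin]]) simp_all
qed

text \<open>The dominant term is the search: \<open>M\<close> layers, \<open>K\<close> cells in
  each, and \<open>K * K\<close> pairs of successors per cell.\<close>

lemma planner_exec:
  "triple (\<lambda>(N, R). N 1 = L \<and> (\<forall>a<L. R a = R0 a)) planner (100 * (M + 1) * (K + 1) ^ 3) planned"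
  unfolding planner_def
proof (rule triple_weaken[OF triple_Seq[OF triple_Seq[OF triple_Seq[OF triple_Seq[OF setup_sum_exec setup_size_exec]
    make_grid_exec] layer_loop_exec] choose_start_exec]])
  define z where "z = (M + 1) * (K + 1) ^ 3"
  have nK: "n \<le> K" by (simp add: K_def)
  have c1: "M * (K + 1) ^ 3 \<le> z" "(K + 1) ^ 3 \<le> z" by (simp_all add: z_def)
  have c2: "K + 1 \<le> (K + 1) ^ 3" using self_le_power[of "K + 1" 3] by simp
  have c3: "M \<le> M * (K + 1) ^ 3" by simp
  have c4: "K * (11 * (K + 1) * (K + 1) + 8) \<le> 19 * (K + 1) ^ 3"
  proof -
    have "K * (11 * (K + 1) * (K + 1) + 8) \<le> (K + 1) * (11 * (K + 1) * (K + 1) + 8 * (K + 1) * (K + 1))"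
      by (intro mult_le_mono add_mono) auto
    also have "\<dots> = 19 * (K + 1) ^ 3" by (simp add: power3_eq_cube algebra_simps)
    finally show ?thesis .
  qed
  have "M * (K * (11 * (K + 1) * (K + 1) + 8) + 13 + 1) \<le> M * (33 * (K + 1) ^ 3)"
    using c4 c2 by (intro mult_le_mono order_refl) linarith
  then have c5: "M * (K * (11 * (K + 1) * (K + 1) + 8) + 13 + 1) \<le> 33 * z" using c1 by linarith
  have "3 + (M * 3 + 1) + (1 + ((n - 1) * 2 + 1)) + (5 + (K * 12 + 1)) +
    (5 + (M * (K * (11 * (K + 1) * (K + 1) + 8) + 13 + 1) + 1)) + (2 + (K * 4 + 1) + 3) \<le> 100 * z"
    using c1 c2 c3 c5 nK by linarith
  then show "3 + (M * 3 + 1) + (1 + ((n - 1) * 2 + 1)) + (5 + (K * 12 + 1)) +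
    (5 + (M * (K * (11 * (K + 1) * (K + 1) + 8) + 13 + 1) + 1)) + (2 + (K * 4 + 1) + 3) \<le> 100 * (M + 1) * (K + 1) ^ 3"
    by (simp only: z_def mult.assoc)
qed simp_all

end

section \<open>The executor\<close>

text \<open>Offsets are one larger than in the planner, because the day is inserted in front of the
  indices and the report behind the state. Real cell 2 accumulates the interim utility, adding the
  chosen slope times the difference of the layer values.\<close>

definition walk_step :: prog where
  "walk_step = Seq (set_reg 1 (NMem (NAdd (reg 0) (NConst 1))))
     (Seq (RAssign (NConst 2) (RAdd (RMem (NConst 2)) (RMul (fld 1 2) (RSub (fld 1 5) (fld 0 5)))))
       (set_reg 0 (reg 1)))"

text \<open>The allocation replaces the state in real cell 0 before the payment uses it. The promise
  subtracted from the interim utility is \<open>b + D\<close> of the first cell of the next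
  day.\<close>

definition emit :: prog where
  "emit = Seq (set_reg 1 (NMem (NAdd (reg 0) (NConst 1)))) (Seq (set_reg 2 (NMem (NAdd (reg 0) (NConst 2))))
     (Seq (RAssign (NConst 0) (fld 1 2))
     (Seq (RAssign (NConst 1) (RSub (RMul (RMem (NConst 1)) (RMem (NConst 0)))
        (RSub (RMem (NConst 2)) (RAdd (fld 2 1) (fld 2 4)))))
     (Seq (RAssign (NConst 2) (ROfIndex (reg 2)))
     (Seq (set_reg 0 (NConst 0)) (set_reg 1 (NConst 3)))))))"

text \<open>The state is the address of a cell as a real number; since there is no conversion from reals to
  indices, it is recovered by counting. All cells of the planner's memory appear shifted by one.\<close>

definition executor :: prog where
  "executor = Seq (Seq (Seq (Seq (set_reg 0 (NConst 0)) (While (RLess (ROfIndex (reg 0)) (RMem (NConst 0))) (incr 0 1)))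
     (RAssign (NConst 2) (fld 0 1)))
     (While (TNot (TAnd (TNot (RLess (fld 0 5) (RMem (NConst 1)))) (TNot (RLess (RMem (NConst 1)) (fld 0 5))))) walk_step))
     emit"

text \<open>\<open>e\<close> is the chain of same-day successors and \<open>J\<close> the rank of
  the report in the support: the walk stops at the first layer whose value equals the report. The
  term \<open>2 * e 0\<close> pays for recovering the address by counting.\<close>

lemma executor_exec:
  fixes N :: "nat \<Rightarrow> nat" and R :: "nat \<Rightarrow> real" and e :: "nat \<Rightarrow> nat"
  assumes e: "\<And>j. j \<le> Suc J \<Longrightarrow> 20 < e j" and next_cell: "\<And>j. j \<le> J \<Longrightarrow> N (e j + 1) = e (Suc j)"
    and d: "N (e J + 2) = d" "20 < d"
    and state: "R 0 = real (e 0)" and rep: "R 1 = a"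
    and miss: "\<And>j. j < J \<Longrightarrow> R (e j + 5) \<noteq> a" and hit: "R (e J + 5) = a"
  shows "triple (\<lambda>s. s = (N, R)) executor (2 * e 0 + 4 * J + 11) (\<lambda>(N', R'). N' 0 = 0 \<and> N' 1 = 3 \<and>
    R' 0 = R (e (Suc J) + 2) \<and>
    R' 1 = a * R (e (Suc J) + 2) - (R (e 0 + 1) + (\<Sum>l<J. R (e (Suc l) + 2) * (R (e (Suc l) + 5) - R (e l + 5))) -
      (R (d + 1) + R (d + 4))) \<and>
    R' 2 = real d)"
proof -
  define I where "I i = (\<lambda>(N', R'). N' 0 = i \<and> (\<forall>a>20. N' a = N a) \<and> R' = R)" for i :: nat
  define acc where "acc j = R (e 0 + 1) + (\<Sum>l<j. R (e (Suc l) + 2) * (R (e (Suc l) + 5) - R (e l + 5)))" for j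
  define W where "W j = (\<lambda>(N', R'). N' 0 = e j \<and> (\<forall>a>20. N' a = N a) \<and> R' 1 = a \<and> R' 2 = acc j \<and> (\<forall>a>20. R' a = R a))" for j
  have start: "triple (\<lambda>s. s = (N, R)) (set_reg 0 (NConst 0)) 1 (I 0)"
    by (rule triple_straight) (auto simp: I_def)
  have scan: "triple (I 0) (While (RLess (ROfIndex (reg 0)) (RMem (NConst 0))) (incr 0 1)) (e 0 * (1 + 1) + 1) (I (e 0))"
  proof (rule triple_While)
    show "triple (I i) (incr 0 1) 1 (I (Suc i))" for i
      by (rule triple_straight) (auto simp: I_def)
  qed (auto simp: I_def state)
  have begin_walk: "triple (I (e 0)) (RAssign (NConst 2) (fld 0 1)) 1 (W 0)"
    by (rule triple_straight) (auto simp: I_def W_def acc_def rep[simplified])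
  have walk: "triple (W 0) (While (TNot (TAnd (TNot (RLess (fld 0 5) (RMem (NConst 1)))) (TNot (RLess (RMem (NConst 1)) (fld 0 5))))) walk_step)
     (J * (3 + 1) + 1) (W J)"
  proof (rule triple_While)
    fix j assume j: "j < J"
    show "triple (W j) walk_step 3 (W (Suc j))"
    proof (rule triple_straight)
      fix N' R' assume W: "W j (N', R')"
      have E: "20 < e j" "20 < e (Suc j)" using e[of j] e[of "Suc j"] j by auto
      have n: "N (Suc (e j)) = e (Suc j)" using next_cell[of j] j by simp
      have acc: "acc (Suc j) = acc j + R (e (Suc j) + 2) * (R (e (Suc j) + 5) - R (e j + 5))"
        by (simp add: acc_def)
      show "W (Suc j) (run walk_step (N', R'))"
        using W E n unfolding W_def walk_step_def acc by simp
    qed (simp_all add: walk_step_def)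
    show "tval (TNot (TAnd (TNot (RLess (fld 0 5) (RMem (NConst 1)))) (TNot (RLess (RMem (NConst 1)) (fld 0 5))))) s"
      if "W j s" for s
      using that e[of j] j miss[of j] by (auto simp: W_def)
  next
    show "\<not> tval (TNot (TAnd (TNot (RLess (fld 0 5) (RMem (NConst 1)))) (TNot (RLess (RMem (NConst 1)) (fld 0 5))))) s"
      if "W J s" for s
      using that e[of J] hit by (auto simp: W_def)
  qed
  have finish: "triple (W J) emit 7 (\<lambda>(N', R'). N' 0 = 0 \<and> N' 1 = 3 \<and>
    R' 0 = R (e (Suc J) + 2) \<and> R' 1 = a * R (e (Suc J) + 2) - (acc J - (R (d + 1) + R (d + 4))) \<and> R' 2 = real d)"
  proof (rule triple_straight)
    fix N' R' assume W: "W J (N', R')"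
    have E: "20 < e J" "20 < e (Suc J)" using e[of J] e[of "Suc J"] by auto
    have n: "N (Suc (e J)) = e (Suc J)" "N (Suc (Suc (e J))) = d" using next_cell[of J] d by simp_all
    show "case run emit (N', R') of (N', R') \<Rightarrow> N' 0 = 0 \<and> N' 1 = 3 \<and>
      R' 0 = R (e (Suc J) + 2) \<and> R' 1 = a * R (e (Suc J) + 2) - (acc J - (R (d + 1) + R (d + 4))) \<and> R' 2 = real d"
      using W E n d(2) unfolding W_def emit_def by simp
  qed (simp_all add: emit_def)
  show ?thesis
    unfolding executor_def
    by (rule triple_weaken[OF triple_Seq[OF triple_Seq[OF triple_Seq[OF triple_Seq[OF start scan] begin_walk] walk] finish]])
       (simp_all add: acc_def)
qed

section \<open>The planner computes the tables of an instance\<close>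

lemma length_concat_pairs: "length (concat (map (\<lambda>a. [a, g a]) xs)) = 2 * length xs"
  by (induction xs) auto

lemma nth_concat_pairs:
  "j < length xs \<Longrightarrow> concat (map (\<lambda>a. [a, g a]) xs) ! (2 * j) = xs ! j \<and>
    concat (map (\<lambda>a. [a, g a]) xs) ! Suc (2 * j) = g (xs ! j)"
proof (induction xs arbitrary: j)
  case (Cons a xs)
  then show ?case by (cases j) auto
qed simp

lemma concat_blocks:
  "length (concat (map B [1..<Suc k])) = (\<Sum>i\<in>{1..k}. length (B i)) \<and>
   (\<forall>i\<in>{1..k}. \<forall>t<length (B i). concat (map B [1..<Suc k]) ! ((\<Sum>l\<in>{1..<i}. length (B l)) + t) = B i ! t)"
proof (induction k)
  case (Suc k)
  define c where "c = concat (map B [1..<Suc k])"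
  have split: "concat (map B [1..<Suc (Suc k)]) = c @ B (Suc k)" by (simp add: c_def)
  have c: "length c = (\<Sum>i\<in>{1..k}. length (B i))"
    "\<And>i t. i \<in> {1..k} \<Longrightarrow> t < length (B i) \<Longrightarrow> c ! ((\<Sum>l\<in>{1..<i}. length (B l)) + t) = B i ! t"
    using Suc unfolding c_def by blast+
  have len: "(\<Sum>l\<in>{1..<i}. length (B l)) + t < (\<Sum>l\<in>{1..k}. length (B l))" if "i \<in> {1..k}" "t < length (B i)" for i t
  proof -
    have "(\<Sum>l\<in>{1..<i}. length (B l)) + t < (\<Sum>l\<in>insert i {1..<i}. length (B l))" using that by simp
    also have "\<dots> \<le> (\<Sum>l\<in>{1..k}. length (B l))" using that by (intro sum_mono2) auto
    finally show ?thesis .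
  qed
  show ?case
  proof (intro conjI ballI allI impI)
    show "length (concat (map B [1..<Suc (Suc k)])) = (\<Sum>i\<in>{1..Suc k}. length (B i))"
      unfolding split by (simp add: c(1))
    fix i t assume i: "i \<in> {1..Suc k}" and t: "t < length (B i)"
    show "concat (map B [1..<Suc (Suc k)]) ! ((\<Sum>l\<in>{1..<i}. length (B l)) + t) = B i ! t"
    proof (cases "i = Suc k")
      case True
      have "{1..<Suc k} = {1..k}" by auto
      then show ?thesis using True unfolding split by (simp add: nth_append c(1))
    next
      case False
      then have "i \<in> {1..k}" using i by auto
      then show ?thesis using c(2)[of i t] len[of i t] t unfolding split by (simp add: nth_append c(1))
    qed
  qed
qed simp

lemma sum_add_index: "(\<Sum>l<a + b. g l) = (\<Sum>l<a. g l) + (\<Sum>j<b. g (a + j :: nat))"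
  for g :: "nat \<Rightarrow> real"
  by (induction b) auto

section \<open>From the input list to days and layers\<close>

locale encoded =
  fixes k :: nat and f :: "nat \<Rightarrow> real pmf" and \<epsilon> :: real
  assumes ok: "instance_ok k f" and eps: "0 < \<epsilon>"
begin

definition M :: nat where "M = (\<Sum>i\<in>{1..k}. supp f i)"
definition L :: nat where "L = Suc (2 * M)"
definition rl :: "real list" where "rl = snd (encode_instance k f \<epsilon>)"
definition R0 :: "nat \<Rightarrow> real" where "R0 a = (if a < L then rl ! a else 0)"
definition total :: real where "total = (\<Sum>i\<in>{1..k}. \<Sum>a\<in>set_pmf (f i). a)"
text \<open>Chosen so that the total error \<open>4 * (1 + 2 * types) * h\<close> equals \<epsilon>:
  \<open>L\<close> is one more than twice the number of support points.\<close>

definition h :: real where "h = \<epsilon> / (4 * real L)"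
definition n :: nat where "n = (LEAST n. 0 < n \<and> total + \<epsilon> \<le> real n * h)"
definition off :: "nat \<Rightarrow> nat" where "off i = (\<Sum>l\<in>{1..<i}. supp f l)"
text \<open>Reverses the order in time. Position \<open>supp f i\<close> is one past the end of day
  \<open>i\<close> and coincides with the start of day \<open>i + 1\<close>.\<close>

definition layer :: "nat \<Rightarrow> nat \<Rightarrow> nat" where "layer i j = M - (off i + j)"

lemma k_pos: "1 \<le> k" using ok by (simp add: instance_ok_def)

lemma off_Suc: "1 \<le> i \<Longrightarrow> off (Suc i) = off i + supp f i"
  by (simp add: off_def)

lemma off_end: "off (Suc k) = M"
  by (simp add: off_def M_def atLeastLessThanSuc_atLeastAtMost)

lemma off_mono: "i \<le> i' \<Longrightarrow> off i \<le> off i'"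
  unfolding off_def by (intro sum_mono2) auto

lemma off_less: "i \<in> {1..k} \<Longrightarrow> j \<le> supp f i \<Longrightarrow> off i + j \<le> M"
  using off_mono[of "Suc i" "Suc k"] off_Suc[of i] off_end by auto

lemma length_block: "length (concat (map (\<lambda>a. [a, pmf (f i) a]) (sorted_list_of_set (set_pmf (f i))))) = 2 * supp f i"
  by (simp only: length_concat_pairs length_sorted_list_of_set supp_def)

lemma length_rl: "length rl = L"
  using concat_blocks[where k = k and B = "\<lambda>i. concat (map (\<lambda>a. [a, pmf (f i) a]) (sorted_list_of_set (set_pmf (f i))))"]
  unfolding length_block rl_def encode_instance_def L_def M_def by (simp add: sum_distrib_left)

lemma rl_0: "rl ! 0 = \<epsilon>"
  by (simp add: rl_def encode_instance_def)

lemma rl_nth: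
  assumes i: "i \<in> {1..k}" and j: "j < supp f i"
  shows "rl ! Suc (2 * (off i + j)) = val f i j" "rl ! Suc (Suc (2 * (off i + j))) = prob f i j"
proof -
  let ?B = "\<lambda>i. concat (map (\<lambda>a. [a, pmf (f i) a]) (sorted_list_of_set (set_pmf (f i))))"
  have *: "concat (map ?B [1..<Suc k]) ! ((\<Sum>l\<in>{1..<i}. 2 * supp f l) + t) = ?B i ! t" if "t < 2 * supp f i" for t
    using concat_blocks[where k = k and B = ?B] i that unfolding length_block by blast
  have o: "(\<Sum>l\<in>{1..<i}. 2 * supp f l) = 2 * off i" by (simp add: off_def sum_distrib_left)
  have len: "j < length (sorted_list_of_set (set_pmf (f i)))" using j by (simp add: supp_def)
  have "rl = \<epsilon> # concat (map ?B [1..<Suc k])" by (simp add: rl_def encode_instance_def)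
  then show "rl ! Suc (2 * (off i + j)) = val f i j" "rl ! Suc (Suc (2 * (off i + j))) = prob f i j"
    using *[of "2 * j"] *[of "Suc (2 * j)"] j nth_concat_pairs[OF len, of "pmf (f i)"] unfolding o
    by (simp_all add: val_def prob_def)
qed

lemma h_pos: "0 < h" using eps by (simp add: h_def L_def)

lemma total_nonneg: "0 \<le> total"
  unfolding total_def using ok by (intro sum_nonneg) (auto simp: instance_ok_def)

lemma n_props: "0 < n" "total + \<epsilon> \<le> real n * h" "\<And>j. 0 < j \<Longrightarrow> j < n \<Longrightarrow> real j * h < total + \<epsilon>"
proof -
  define N where "N = Suc (nat \<lceil>(total + \<epsilon>) / h\<rceil>)"
  have "(total + \<epsilon>) / h \<le> real N" unfolding N_def by linarith
  then have "0 < N \<and> total + \<epsilon> \<le> real N * h" using h_pos by (simp add: N_def field_simps)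
  then have "0 < n \<and> total + \<epsilon> \<le> real n * h" unfolding n_def by (rule LeastI)
  then show "0 < n" "total + \<epsilon> \<le> real n * h" by auto
  show "real j * h < total + \<epsilon>" if "0 < j" "j < n" for j
    using not_less_Least[of j "\<lambda>n. 0 < n \<and> total + \<epsilon> \<le> real n * h"] that unfolding n_def[symmetric] by auto
qed

lemma M_pos: "0 < M"
proof -
  have "supp f 1 \<le> M" unfolding M_def using k_pos by (intro member_le_sum) auto
  then show ?thesis using supp_pos[OF ok, of 1] k_pos by simp
qed

lemma input_sum: "(\<Sum>l<M. R0 (Suc (2 * l))) = total"
proof -
  have "(\<Sum>l<off (Suc i). R0 (Suc (2 * l))) = (\<Sum>i\<in>{1..i}. \<Sum>a\<in>set_pmf (f i). a)" if "i \<le> k" for i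
    using that
  proof (induction i)
    case (Suc i)
    have S: "Suc i \<in> {1..k}" using Suc by simp
    have "R0 (Suc (2 * (off (Suc i) + j))) = val f (Suc i) j" if "j < supp f (Suc i)" for j
      using rl_nth[OF S that] off_less[OF S, of "Suc j"] that by (simp add: R0_def L_def)
    then show ?case using Suc
      by (simp add: off_Suc[of "Suc i"] sum_add_index sum_support[OF ok S])
  qed (simp add: off_def)
  from this[of k] show ?thesis by (simp add: off_end total_def)
qed

sublocale layers_run M L n R0 h
proof
  show "L = Suc (2 * M)" by (simp add: L_def)
  show "0 < M" by (rule M_pos)
  show "h = R0 0 / (4 * real L)" by (simp add: h_def R0_def rl_0 L_def)
  show "0 < h" by (rule h_pos)
  show "0 < n" by (rule n_props)
  have "R0 0 = \<epsilon>" by (simp add: R0_def rl_0 L_def)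
  then show "(\<Sum>l<M. R0 (Suc (2 * l))) + R0 0 \<le> real n * h"
    "\<And>j. 0 < j \<Longrightarrow> j < n \<Longrightarrow> real j * h < (\<Sum>l<M. R0 (Suc (2 * l))) + R0 0"
    using n_props by (simp_all add: input_sum)
qed

lemma layer_end: "layer (Suc k) 0 = 0" by (simp add: layer_def off_end)

lemma layer_wrap: "1 \<le> i \<Longrightarrow> layer i (supp f i) = layer (Suc i) 0"
  by (simp add: layer_def off_Suc)

lemma layer_Suc: "i \<in> {1..k} \<Longrightarrow> j < supp f i \<Longrightarrow> layer i j = Suc (layer i (Suc j))"
  using off_less[of i "Suc j"] by (simp add: layer_def)

lemma layer_range: "i \<in> {1..k} \<Longrightarrow> j < supp f i \<Longrightarrow> layer i j \<in> {1..M}"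
  using layer_Suc[of i j] by (auto simp: layer_def)

lemma layer_val:
  assumes "i \<in> {1..k}" "j < supp f i"
  shows "lval (layer i j) = val f i j" "lprob (layer i j) = prob f i j"
proof -
  have le: "off i + Suc j \<le> M" using off_less[of i "Suc j"] assms by simp
  then have "L - 2 * layer i j = Suc (2 * (off i + j))" by (simp add: L_def layer_def)
  moreover have "Suc (2 * (off i + j)) < L" "Suc (Suc (2 * (off i + j))) < L" using le by (simp_all add: L_def)
  ultimately show "lval (layer i j) = val f i j" "lprob (layer i j) = prob f i j"
    using rl_nth[OF assms] by (simp_all add: lval_def lprob_def R0_def)
qed

text \<open>The strict inequality, due to positive probabilities, is what lets an exact comparison
  with 1 recognise the ends of the days.\<close>

lemma tail_less:
  assumes "i \<in> {1..k}" "Suc j < supp f i"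
  shows "(\<Sum>l\<in>{Suc j..<supp f i}. prob f i l) < 1"
proof -
  have "(\<Sum>l\<in>{Suc j..<supp f i}. prob f i l) < (\<Sum>l<supp f i. prob f i l)"
    by (rule sum_strict_mono2[where b = 0]) (use assms prob_pos[OF ok assms(1)] in \<open>auto intro: less_imp_le\<close>)
  then show ?thesis by (simp add: prob_sum[OF ok assms(1)])
qed

lemma mass_layer_step:
  assumes i: "i \<in> {1..k}" and start: "mass (layer (Suc i) 0) = 1" and "j < supp f i"
  shows "mass (layer i j) = (\<Sum>l\<in>{j..<supp f i}. prob f i l)"
proof -
  have "j \<le> supp f i - 1" using assms(3) by simp
  then show ?thesis
  proof (induction rule: inc_induct)
    case base
    have "supp f i - 1 < supp f i" using assms(3) by simp
    note l = layer_Suc[OF i this] layer_val(2)[OF i this]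
    have "Suc (supp f i - 1) = supp f i" using assms(3) by simp
    then have "layer i (Suc (supp f i - 1)) = layer (Suc i) 0" using layer_wrap[of i] i by simp
    then show ?case using l start assms(3) by (simp add: sum.atLeast_Suc_lessThan)
  next
    case (step j)
    then have j: "j < supp f i" "Suc j < supp f i" by auto
    show ?case using layer_Suc[OF i j(1)] layer_val(2)[OF i j(1)] tail_less[OF i j(2)] step.IH j
      by (simp add: sum.atLeast_Suc_lessThan)
  qed
qed

lemma mass_day: "i \<in> {1..Suc k} \<Longrightarrow> mass (layer i 0) = 1"
proof -
  assume i: "i \<in> {1..Suc k}"
  then have "i \<le> Suc k" by simp
  then show ?thesis using i
  proof (induction rule: inc_induct)
    case (step i)
    then have i: "i \<in> {1..k}" by auto
    have "mass (layer (Suc i) 0) = 1" using step by auto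
    from mass_layer_step[OF i this supp_pos[OF ok i]] show ?case
      using prob_sum[OF ok i] by (simp add: lessThan_atLeast0)
  qed (simp add: layer_end)
qed

text \<open>Here the flat sequence of layers, all that the planner sees, is matched with the
  division into days.\<close>

lemma layer_params:
  assumes i: "i \<in> {1..k}" and j: "j < supp f i"
  shows "ltail (layer i j) = (\<Sum>l\<in>{Suc j..<supp f i}. prob f i l)"
    "lgap (layer i j) = (if Suc j < supp f i then val f i (Suc j) - val f i j else 0)"
    "lnext (layer i j) = (if Suc j < supp f i then layer i (Suc j) else 0)"
    "lday (layer i j) = layer (Suc i) 0"
proof -
  have m: "mass (layer i (Suc j')) = (if Suc j' < supp f i then \<Sum>l\<in>{Suc j'..<supp f i}. prob f i l else 1)"
    if "j' < supp f i" for j'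
  proof (cases "Suc j' < supp f i")
    case True
    then show ?thesis using mass_layer_step[OF i mass_day[of "Suc i"], of "Suc j'"] i by simp
  next
    case False
    then have "Suc j' = supp f i" using that by simp
    then show ?thesis using mass_day[of "Suc i"] layer_wrap[of i] i by simp
  qed
  have lt: "mass (layer i (Suc j')) < 1 \<longleftrightarrow> Suc j' < supp f i" if "j' < supp f i" for j'
    using m[OF that] tail_less[OF i, of j'] by simp
  note r = layer_Suc[OF i j]
  show "ltail (layer i j) = (\<Sum>l\<in>{Suc j..<supp f i}. prob f i l)"
    unfolding r ltail_def using m[OF j] lt[OF j] by auto
  show "lgap (layer i j) = (if Suc j < supp f i then val f i (Suc j) - val f i j else 0)"
    using lt[OF j] layer_val(1)[OF i j] layer_val(1)[OF i, of "Suc j"] unfolding lgap_def by (simp add: r)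
  show "lnext (layer i j) = (if Suc j < supp f i then layer i (Suc j) else 0)"
    unfolding r lnext_def using lt[OF j] by simp
  have "j \<le> supp f i - 1" using j by simp
  then show "lday (layer i j) = layer (Suc i) 0"
  proof (induction rule: inc_induct)
    case base
    have "supp f i - 1 < supp f i" "Suc (supp f i - 1) = supp f i" using j by simp_all
    then show ?case using lt[of "supp f i - 1"] layer_Suc[OF i, of "supp f i - 1"] layer_wrap[of i] i by simp
  next
    case (step j)
    then have "j < supp f i" "Suc j < supp f i" by auto
    then show ?case using lt[of j] layer_Suc[OF i, of j] step.IH by simp
  qed
qed

lemma coords_le: "q < K \<Longrightarrow> bi q \<le> n \<and> xi q \<le> n \<and> si q \<le> n"
  using bi_le by (simp add: xi_def si_def less_Suc_eq_le[symmetric])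

lemma coords_ex:
  assumes "\<beta> \<le> n" "\<xi> \<le> n" "\<sigma> \<le> n"
  shows "\<exists>q<K. bi q = \<beta> \<and> xi q = \<xi> \<and> si q = \<sigma>"
proof -
  define q where "q = (\<beta> * (n + 1) + \<xi>) * (n + 1) + \<sigma>"
  have d: "q div (n + 1) = \<beta> * (n + 1) + \<xi>" using assms by (simp add: q_def div_mult_self3 del: mult_Suc_right mult_Suc)
  have "bi q = \<beta>" unfolding bi_def d using assms by (simp add: div_mult_self3 del: mult_Suc_right mult_Suc)
  moreover have "xi q = \<xi>" unfolding xi_def d using assms by (simp del: mult_Suc_right mult_Suc)
  moreover have "si q = \<sigma>" unfolding si_def q_def using assms by (simp del: mult_Suc_right mult_Suc)
  moreover have "q < K"
  proof -
    have "\<beta> * (n + 1) + \<xi> \<le> n * (n + 1) + n" using assms by (intro add_mono mult_le_mono) auto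
    then have "(\<beta> * (n + 1) + \<xi>) * (n + 1) + \<sigma> \<le> (n * (n + 1) + n) * (n + 1) + n"
      using assms by (intro add_mono mult_le_mono) auto
    also have "\<dots> < K" by (simp add: K_def algebra_simps)
    finally show ?thesis by (simp add: q_def)
  qed
  ultimately show ?thesis by blast
qed

section \<open>The final memory solves the dynamic program\<close>

definition table :: "nat \<Rightarrow> nat set" where "table r = ad r ` {..<K}"

context
  fixes N :: "nat \<Rightarrow> nat" and R :: "nat \<Rightarrow> real"
  assumes tables: "tables_ok M (N, R)"
begin

lemma cell_coords:
  assumes "r \<le> M" "q < K"
  shows "R (ad r q) = real (bi q) * h" "R (ad r q + 1) = real (xi q) / real n" "R (ad r q + 2) = real (si q) * h"
  using tables assms by (cases r; auto simp: tables_ok_def grid_ok_def row_ok_def)+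

lemma cell_value: "i \<in> {1..k} \<Longrightarrow> j < supp f i \<Longrightarrow> e \<in> table (layer i j) \<Longrightarrow> R (e + 4) = val f i j"
  using tables layer_range[of i j] layer_val(1)[of i j] by (auto simp: table_def tables_ok_def row_ok_def)

text \<open>Addresses are the cells, memory reads their fields. The two halves of
  \<open>best_of\<close>, lower bound and attainment, give the two halves of the Bellman
  equation.\<close>

lemma day_tables:
  assumes i: "i \<in> {1..k}"
  shows "day_dp (supp f i) (val f i) (prob f i) h n R (\<lambda>e. R (e + 1)) (\<lambda>e. R (e + 2)) (\<lambda>e. R (e + 3)) N (\<lambda>e. N (e + 1))
      (\<lambda>j. if j = supp f i then table 0 else table (layer i j)) (if i = k then table 0 else table (layer (Suc i) 0))"
proof
  have ND: "(if i = k then table 0 else table (layer (Suc i) 0)) = table (layer (Suc i) 0)"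
    using layer_end by auto
  have T: "\<exists>r\<le>M. (if j = supp f i then table 0 else table (layer i j)) = table r" if "j \<le> supp f i" for j
  proof (cases "j = supp f i")
    case False
    then show ?thesis by (intro exI[of _ "layer i j"]) (simp add: layer_def)
  qed auto
  show "0 < supp f i" using supp_pos[OF ok i] .
  show "val f i j < val f i j'" if "j < j'" "j' < supp f i" for j j' using val_less[OF ok i that] .
  show "0 \<le> val f i j" "0 < prob f i j" if "j < supp f i" for j
    using val_nonneg[OF ok i that] prob_pos[OF ok i that] by auto
  show "(\<Sum>j<supp f i. prob f i j) = 1" by (rule prob_sum[OF ok i])
  show "0 < h" "0 < n" by (rule h_pos n_pos)+
  show "\<exists>\<beta>\<le>n. \<exists>\<xi>\<le>n. \<exists>\<sigma>\<le>n. R e = real \<beta> * h \<and> R (e + 1) = real \<xi> / real n \<and> R (e + 2) = real \<sigma> * h"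
    if j: "j \<le> supp f i" and e: "e \<in> (if j = supp f i then table 0 else table (layer i j))" for j e
  proof -
    obtain r q where "r \<le> M" "q < K" "e = ad r q" using T[OF j] e by (auto simp: table_def)
    then show ?thesis using cell_coords[of r q] coords_le[of q] by blast
  qed
  show "\<exists>e\<in>(if j = supp f i then table 0 else table (layer i j)).
      R e = real \<beta> * h \<and> R (e + 1) = real \<xi> / real n \<and> R (e + 2) = real \<sigma> * h"
    if j: "j \<le> supp f i" and le: "\<beta> \<le> n" "\<xi> \<le> n" "\<sigma> \<le> n" for j \<beta> \<xi> \<sigma>
  proof -
    obtain r where r: "r \<le> M" "(if j = supp f i then table 0 else table (layer i j)) = table r" using T[OF j] by blast
    obtain q where q: "q < K" "bi q = \<beta>" "xi q = \<xi>" "si q = \<sigma>" using coords_ex[OF le] by blast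
    show ?thesis unfolding r(2) using cell_coords[OF r(1) q(1)] q by (auto simp: table_def)
  qed
  show "R (e + 3) = (if R e = 0 \<and> R (e + 2) = 0 then 0 else (real n + 1) * h)"
    if "e \<in> (if supp f i = supp f i then table 0 else table (layer i (supp f i)))" for e
    using that tables h_pos by (auto simp: table_def tables_ok_def grid_ok_def big_def)
  fix j e assume j: "j < supp f i" and e: "e \<in> (if j = supp f i then table 0 else table (layer i j))"
  then obtain q where q: "q < K" "e = ad (layer i j) q" by (auto simp: table_def)
  have next_table: "(if Suc j = supp f i then table 0 else table (layer i (Suc j))) = table (lnext (layer i j))"
    using layer_params(3)[OF i j] j by auto
  have in_table: "e' \<in> table r \<longleftrightarrow> (\<exists>q<K. e' = ad r 0 + 5 * q)" for e' r
    unfolding ad_q[symmetric] by (auto simp: table_def)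
  have best: "best_of K big N R (lgap (layer i j)) (ltail (layer i j)) (prob f i j) (val f i j)
      (ad (lnext (layer i j)) 0) (ad (layer (Suc i) 0) 0) e ({..<K} \<times> {..<K}) (R (e + 3))"
  proof -
    have "row_ok N R (layer i j) q" using tables layer_range[OF i j] q(1) by (simp add: tables_ok_def)
    then show ?thesis unfolding row_ok_def q(2)[symmetric] layer_val[OF i j] layer_params(4)[OF i j] by blast
  qed
  note lp = layer_params(1,2)[OF i j]
  show "R (e + 3) \<le> R (e' + 1) * (if Suc j < supp f i then val f i (Suc j) - val f i j else 0) *
      (\<Sum>l\<in>{Suc j..<supp f i}. prob f i l) + R (e' + 3)"
    if pre: "e' \<in> (if Suc j = supp f i then table 0 else table (layer i (Suc j)))"
      "e'' \<in> (if i = k then table 0 else table (layer (Suc i) 0))"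
      "R (e + 1) \<le> R (e' + 1)"
      "R e' \<le> R e + R (e' + 1) * (if Suc j < supp f i then val f i (Suc j) - val f i j else 0)"
      "R e'' + R (e'' + 3) \<le> R e"
      "R (e + 2) \<le> prob f i j * (val f i j * R (e' + 1) + R (e'' + 2)) + R (e' + 2)" for e' e''
  proof -
    obtain q1 where q1: "q1 < K" "e' = ad (lnext (layer i j)) 0 + 5 * q1" using pre(1) unfolding next_table in_table by blast
    obtain q2 where q2: "q2 < K" "e'' = ad (layer (Suc i) 0) 0 + 5 * q2" using pre(2) unfolding ND in_table by blast
    have "valid R (lgap (layer i j)) (prob f i j) (val f i j) e e' e''"
      unfolding valid_def lp using pre(3-6) by blast
    then have "R (e + 3) \<le> through R (lgap (layer i j)) (ltail (layer i j)) e'"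
      using best q1 q2 unfolding best_of_def by auto
    then show ?thesis unfolding through_def lp .
  qed
  assume "R (e + 3) < (real n + 1) * h"
  then have "R (e + 3) < big" unfolding big_def .
  from conjunct2[OF conjunct2[OF best[unfolded best_of_def]], THEN mp, OF this] obtain q1 q2 where qs: "q1 < K" "q2 < K" "N e = ad (lnext (layer i j)) 0 + 5 * q1" "N (e + 1) = ad (layer (Suc i) 0) 0 + 5 * q2"
    and "valid R (lgap (layer i j)) (prob f i j) (val f i j) e (ad (lnext (layer i j)) 0 + 5 * q1) (ad (layer (Suc i) 0) 0 + 5 * q2)"
    "R (e + 3) = through R (lgap (layer i j)) (ltail (layer i j)) (ad (lnext (layer i j)) 0 + 5 * q1)"
    by blast
  note chosen = this(5,6)[folded qs(3,4)]
  have "N e \<in> table (lnext (layer i j))" "N (e + 1) \<in> table (layer (Suc i) 0)"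
    unfolding in_table using qs(1-4) by blast+
  then show "N e \<in> (if Suc j = supp f i then table 0 else table (layer i (Suc j))) \<and>
      N (e + 1) \<in> (if i = k then table 0 else table (layer (Suc i) 0)) \<and>
      R (e + 1) \<le> R (N e + 1) \<and>
      R (N e) \<le> R e + R (N e + 1) * (if Suc j < supp f i then val f i (Suc j) - val f i j else 0) \<and>
      R (N (e + 1)) + R (N (e + 1) + 3) \<le> R e \<and>
      R (e + 2) \<le> prob f i j * (val f i j * R (N e + 1) + R (N (e + 1) + 2)) + R (N e + 2) \<and>
      R (e + 3) = R (N e + 1) * (if Suc j < supp f i then val f i (Suc j) - val f i j else 0) *
        (\<Sum>l\<in>{Suc j..<supp f i}. prob f i l) + R (N e + 3)"
    unfolding next_table ND using chosen unfolding valid_def through_def lp by blast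
qed

lemma dp: "dp_tables k f h n R (\<lambda>e. R (e + 1)) (\<lambda>e. R (e + 2)) (\<lambda>e. R (e + 3)) N (\<lambda>e. N (e + 1))
   (\<lambda>i j. table (layer i j)) (table 0)"
proof (rule dp_tables.intro)
  show "instance_ok k f" by (rule ok)
  show "0 < h" "0 < n" by (rule h_pos n_pos)+
  have "4 * (1 + 2 * real M) * h = \<epsilon>" by (simp add: h_def L_def)
  then show "(\<Sum>i\<in>{1..k}. \<Sum>a\<in>set_pmf (f i). a) + 4 * (1 + 2 * real (\<Sum>i\<in>{1..k}. supp f i)) * h \<le> real n * h"
    using n_props(2) unfolding total_def M_def by simp
qed (rule day_tables)

end

section \<open>The computed mechanism and its running time\<close>

lemma cell_range: "r \<le> M \<Longrightarrow> e \<in> table r \<Longrightarrow> 20 < e \<and> e + 5 \<le> ad (Suc M) 0"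
proof -
  assume r: "r \<le> M" and "e \<in> table r"
  then obtain q where q: "q < K" "e = ad r q" by (auto simp: table_def)
  have "ad r q + 5 \<le> ad r 0 + 5 * K" using q(1) unfolding ad_q[of r q] by simp
  also have "\<dots> \<le> ad (Suc M) 0" using r by (intro ad_table) simp
  finally show ?thesis using ad_ge[of r q] q(2) by (simp add: L_def)
qed

lemma shifted_memory:
  fixes N :: "nat \<Rightarrow> nat" and R :: "nat \<Rightarrow> real"
  assumes "2 \<le> a" "a < E"
  shows "fst (init_mem (i # map N [2..<E], c # v # map R [1..<E])) (Suc a) = N a"
    "snd (init_mem (i # map N [2..<E], c # v # map R [1..<E])) (Suc a) = R a"
proof -
  obtain t where t: "a = Suc (Suc t)" using assms(1) by (metis add_2_eq_Suc le_Suc_ex)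
  show "fst (init_mem (i # map N [2..<E], c # v # map R [1..<E])) (Suc a) = N a"
    "snd (init_mem (i # map N [2..<E], c # v # map R [1..<E])) (Suc a) = R a"
    using assms(2) unfolding t by (simp_all add: init_mem_def Let_def nth_append del: upt_Suc)
qed

text \<open>One bound for the planner, for a day of the executor and for the length of the
  description.\<close>

definition time :: nat where "time = 300 * (M + 1) * (K + 1) ^ 3"

lemma time_bounds: "2 * ad (Suc M) 0 + 4 * M + 11 \<le> time" "100 * (M + 1) * (K + 1) ^ 3 \<le> time"
proof -
  have "2 * ad (Suc M) 0 + 4 * M + 11 = 8 * M + 53 + 10 * (K * (M + 1))"
    unfolding ad_def by (simp add: L_def algebra_simps)
  also have "K * (M + 1) \<le> (M + 1) * (K + 1) ^ 3"
  proof -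
    have "K \<le> (K + 1) ^ 3" using self_le_power[of "K + 1" 3] by simp
    then have "(M + 1) * K \<le> (M + 1) * (K + 1) ^ 3" by (intro mult_le_mono order_refl)
    then show ?thesis by (simp only: mult.commute)
  qed
  also have "8 * M + 53 + 10 * ((M + 1) * (K + 1) ^ 3) \<le> 300 * ((M + 1) * (K + 1) ^ 3)"
  proof -
    define y where "y = (M + 1) * (K + 1) ^ 3"
    have "(M + 1) * 1 \<le> y" unfolding y_def by (intro mult_le_mono) auto
    then have le: "M + 1 \<le> y" by simp
    have "a + 1 \<le> b \<Longrightarrow> 8 * a + 53 + 10 * b \<le> 300 * b" for a b :: nat by linarith
    from this[OF le] have "8 * M + 53 + 10 * y \<le> 300 * y" .
    then show ?thesis unfolding y_def .
  qed
  finally show "2 * ad (Suc M) 0 + 4 * M + 11 \<le> time" by (simp only: time_def mult.assoc)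
  show "100 * (M + 1) * (K + 1) ^ 3 \<le> time" unfolding time_def by (intro mult_le_mono) auto
qed

lemma near_optimal:
  "\<exists>x p. feasible k f x p \<and> (\<forall>x' p'. feasible k f x' p' \<longrightarrow> revenue k f p \<ge> revenue k f p' - \<epsilon>) \<and>
     computes_mechanism planner executor k f \<epsilon> (real time) x p"
proof -
  have init: "fst (init_mem (encode_instance k f \<epsilon>)) 1 = L"
    "\<forall>a<L. snd (init_mem (encode_instance k f \<epsilon>)) a = R0 a"
    using length_rl unfolding rl_def R0_def init_mem_def by (auto simp: Let_def split_beta)
  then have "(\<lambda>(N, R). N 1 = L \<and> (\<forall>a<L. R a = R0 a)) (init_mem (encode_instance k f \<epsilon>))"
    unfolding split_beta by blast
  from planner_exec[unfolded triple_def, rule_format, OF this] obtain t s where exec: "exec planner (init_mem (encode_instance k f \<epsilon>)) t s"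
    and t: "t \<le> 100 * (M + 1) * (K + 1) ^ 3" and s: "planned s"
    by blast
  obtain N R where NR: "s = (N, R)" by (cases s)
  define E where "E = ad (Suc M) 0"
  have tables: "tables_ok M (N, R)" and N01: "N 0 = E - 2" "N 1 = E"
    using s unfolding planned_def NR E_def by simp_all
  obtain q where q: "q < K" "R 0 = real (ad M q)" "\<And>q'. q' < K \<Longrightarrow> score R (ad M q') \<le> score R (ad M q)"
    using s unfolding planned_def NR by auto
  define e0 where "e0 = ad M q"
  interpret dp: dp_tables k f h n R "\<lambda>e. R (e + 1)" "\<lambda>e. R (e + 2)" "\<lambda>e. R (e + 3)" N "\<lambda>e. N (e + 1)"
    "\<lambda>i j. table (layer i j)" "table 0"
    by (rule dp[OF tables])
  have first: "dp.first i = table (layer (Suc i) 0)" for i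
    by (simp add: dp.first_def layer_end)
  have "layer (Suc 0) 0 = M" by (simp add: layer_def off_def)
  then have first0: "dp.first 0 = table M" by (simp add: first)
  have "e0 \<in> table M" using q(1) by (simp add: table_def e0_def)
  then have e0: "e0 \<in> dp.first 0" unfolding first0 .
  have best: "R (e + 2) - R e - R (e + 3) \<le> R (e0 + 2) - R e0 - R (e0 + 3)" if "e \<in> dp.first 0" for e
    using that q(3) unfolding first0 by (auto simp: table_def score_def e0_def)
  interpret sm: state_mechanism k f dp.good dp.pol_alloc dp.pol_interim dp.pol_next
    "\<lambda>i e. R e + R (e + 3)" "\<lambda>i e. R (e + 2)" e0
    by (rule dp.policy[OF e0 best])
  have "revenue k f sm.pay_rule \<ge> revenue k f p' - \<epsilon>" if "feasible k f x' p'" for x' p'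
  proof -
    have "dp.types = real M" by (simp add: dp.types_def M_def)
    moreover have "4 * (1 + 2 * real M) * h = \<epsilon>" by (simp add: h_def L_def)
    ultimately have "4 * (1 + 2 * dp.types) * h = \<epsilon>" by (simp only:)
    then show ?thesis using dp.start_bound[OF that best] sm.mechanism_revenue by simp
  qed
  moreover have "computes_mechanism planner executor k f \<epsilon> (real time) sm.alloc_rule sm.pay_rule"
    unfolding computes_mechanism_def
  proof (intro exI conjI ballI allI impI)
    let ?ns = "map N [2..<E]" and ?rs = "map R [1..<E]" and ?c = "\<lambda>l. real (sm.st l)"
    have E: "20 < E" using ad_ge[of "Suc M" 0] by (simp add: E_def L_def)
    \<comment> \<open>The planner left the address of the start cell in real cell 0, so the initial
      state and the rest of the description form one contiguous block.\<close>
    have e0E: "?c [] # ?rs = map R [0..<E]"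
      using E q(2) by (simp add: upt_conv_Cons e0_def)
    show "real (length ?ns + length (?c [] # ?rs)) \<le> real time"
      using time_bounds(1) E unfolding E_def[symmetric] by simp
    show "computes_in planner (encode_instance k f \<epsilon>) (real time) (?ns, ?c [] # ?rs)"
      unfolding computes_in_def
    proof (intro exI conjI)
      show "exec planner (init_mem (encode_instance k f \<epsilon>)) t s" by (rule exec)
      show "real t \<le> real time" using t time_bounds(2) by simp
      have "map N [0..<E] = N 0 # N 1 # map N [2..<E]"
        using E by (simp add: upt_conv_Cons numeral_2_eq_2)
      moreover have "length ?ns + 2 = E" "length (map R [0..<E]) = E" using E by simp_all
      ultimately show "holds_output s (?ns, ?c [] # ?rs)"
        unfolding e0E holds_output_def NR prod.case fst_conv snd_conv using N01 by simp
    qed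
    fix i v assume i: "i \<in> {1..k}" and v: "supported f i v"
    obtain i' where i': "i = Suc i'" using i by (cases i) auto
    define e where "e = sm.st (hist v i')"
    have eg: "e \<in> dp.good i" using sm.st_in[of i' v] v i unfolding e_def i' by (auto dest: supported_SucD)
    obtain J where J: "J < supp f i" "v i = val f i J" "idx f i (v i) = J"
      using supportE[OF ok i, of "v i"] v i by (auto simp: supported_def)
    interpret d: day_dp "supp f i" "val f i" "prob f i" h n R "\<lambda>e. R (e + 1)" "\<lambda>e. R (e + 2)" "\<lambda>e. R (e + 3)" N "\<lambda>e. N (e + 1)"
      "\<lambda>j. if j = supp f i then table 0 else table (layer i j)" "if i = k then table 0 else table (layer (Suc i) 0)"
      by (rule day_tables[OF tables i])
    have e1: "e \<in> (if 0 = supp f i then table 0 else table (layer i 0))" and De: "R (e + 3) < (real n + 1) * h"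
      using eg supp_pos[OF ok i] unfolding dp.good_def first i' by auto
    define ce where "ce j = (N ^^ j) e" for j
    have ce_in: "ce j \<in> (if j = supp f i then table 0 else table (layer i j))" if "j \<le> supp f i" for j
      using d.cell_in[OF e1 De that] unfolding d.cell_def ce_def by blast
    have le_M: "layer i j \<le> M" for j by (simp add: layer_def)
    have range: "20 < ce j \<and> ce j + 5 \<le> E" if "j \<le> supp f i" for j
      using cell_range[of 0 "ce j"] cell_range[OF le_M, of "ce j" j] ce_in[OF that] unfolding E_def by (auto split: if_splits)
    define nd where "nd = N (ce J + 1)"
    have "nd \<in> table (layer (Suc i) 0)"
      using d.cell_step(1)[OF e1 De J(1)] layer_end unfolding d.succ_def d.cell_def nd_def ce_def by (auto split: if_splits)
    then have nd: "20 < nd" "nd + 5 \<le> E"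
      using cell_range[of "layer (Suc i) 0" nd] by (auto simp: layer_def E_def)
    define s1 where "s1 = init_mem (i # ?ns, ?c (hist v (i - 1)) # v i # ?rs)"
    have mem: "fst s1 (Suc a) = N a" "snd s1 (Suc a) = R a" if "20 < a" "a < E" for a
      using that shifted_memory[of a E] unfolding s1_def by auto
    have mem_off: "snd s1 (a + 1) = R a" "snd s1 (a + 2) = R (a + 1)" "snd s1 (a + 4) = R (a + 3)" "snd s1 (a + 5) = R (a + 4)"
      if "20 < a" "a + 5 \<le> E" for a
    proof -
      have "a + 1 = Suc a" "a + 2 = Suc (a + 1)" "a + 4 = Suc (a + 3)" "a + 5 = Suc (a + 4)" by simp_all
      then show "snd s1 (a + 1) = R a" "snd s1 (a + 2) = R (a + 1)" "snd s1 (a + 4) = R (a + 3)" "snd s1 (a + 5) = R (a + 4)"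
        using that by (simp_all only: mem(2))
    qed
    have mem0: "snd s1 0 = real e" "snd s1 1 = v i" by (simp_all add: s1_def init_mem_def e_def i')
    have cellval: "R (ce j + 4) = val f i j" if "j < supp f i" for j
      using cell_value[OF tables i that] ce_in[of j] that by auto
    have "triple (\<lambda>s. s = (fst s1, snd s1)) executor (2 * ce 0 + 4 * J + 11) (\<lambda>(N', R'). N' 0 = 0 \<and> N' 1 = 3 \<and>
      R' 0 = snd s1 (ce (Suc J) + 2) \<and>
      R' 1 = v i * snd s1 (ce (Suc J) + 2) - (snd s1 (ce 0 + 1) +
        (\<Sum>l<J. snd s1 (ce (Suc l) + 2) * (snd s1 (ce (Suc l) + 5) - snd s1 (ce l + 5))) -
        (snd s1 (nd + 1) + snd s1 (nd + 4))) \<and> R' 2 = real nd)"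
    proof (rule executor_exec)
      show "20 < ce j" if "j \<le> Suc J" for j using range[of j] that J(1) by simp
      show "fst s1 (ce j + 1) = ce (Suc j)" if "j \<le> J" for j
        using range[of j] mem(1)[of "ce j"] that J(1) by (simp add: ce_def)
      show "fst s1 (ce J + 2) = nd" using range[of J] mem(1)[of "ce J + 1"] J(1) by (simp add: nd_def)
      show "20 < nd" by (rule nd)
      show "snd s1 0 = real (ce 0)" using mem0 by (simp add: ce_def)
      show "snd s1 1 = v i" by (rule mem0)
      have v5: "snd s1 (ce j + 5) = val f i j" if "j < supp f i" for j
        using range[of j] mem_off(4)[of "ce j"] cellval[OF that] that by simp
      show "snd s1 (ce J + 5) = v i" using v5[OF J(1)] J(2) by simp
      show "snd s1 (ce j + 5) \<noteq> v i" if "j < J" for j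
        using v5[of j] val_less[OF ok i that J(1)] that J(1,2) by simp
    qed
    then obtain t1 N1 R1 where ex: "exec executor s1 t1 (N1, R1)" and t1: "t1 \<le> 2 * ce 0 + 4 * J + 11"
      and out: "N1 0 = 0" "N1 1 = 3" "R1 0 = snd s1 (ce (Suc J) + 2)"
       "R1 1 = v i * snd s1 (ce (Suc J) + 2) - (snd s1 (ce 0 + 1) +
        (\<Sum>l<J. snd s1 (ce (Suc l) + 2) * (snd s1 (ce (Suc l) + 5) - snd s1 (ce l + 5))) -
        (snd s1 (nd + 1) + snd s1 (nd + 4)))" "R1 2 = real nd"
      unfolding triple_def by auto
    have f2: "snd s1 (ce j + 2) = R (ce j + 1)" if "j \<le> supp f i" for j
      using range[OF that] mem_off(2)[of "ce j"] by simp
    have f5: "snd s1 (ce j + 5) = val f i j" if "j < supp f i" for j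
      using range[of j] mem_off(4)[of "ce j"] cellval[OF that] that by simp
    have f1: "snd s1 (ce 0 + 1) = R e" using range[of 0] mem_off(1)[of "ce 0"] by (simp add: ce_def)
    have fd: "snd s1 (nd + 1) = R nd" "snd s1 (nd + 4) = R (nd + 3)"
      using nd mem_off(1,3)[of nd] by simp_all
    have al: "dp.pol_alloc i e (v i) = R (ce (Suc J) + 1)"
      by (simp only: dp.pol_alloc_def J(3) ce_def)
    have ne: "dp.pol_next i e (v i) = nd"
      by (simp only: dp.pol_next_def J(3) ce_def nd_def)
    have int: "dp.pol_interim i e (v i) = R e + (\<Sum>l<J. snd s1 (ce (Suc l) + 2) * (snd s1 (ce (Suc l) + 5) - snd s1 (ce l + 5)))"
      unfolding dp.pol_interim_def J(3) ce_def[symmetric]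
    proof (intro arg_cong2[where f = "(+)"] sum.cong refl)
      fix l assume "l \<in> {..<J}"
      then have "Suc l \<le> supp f i" "Suc l < supp f i" "l < supp f i" using J(1) by auto
      then show "R (ce (Suc l) + 1) * (val f i (Suc l) - val f i l) =
        snd s1 (ce (Suc l) + 2) * (snd s1 (ce (Suc l) + 5) - snd s1 (ce l + 5))"
        by (simp only: f2 f5)
    qed
    have st: "sm.st (hist v i) = nd"
      using ne unfolding i' sm.st_hist_Suc e_def .
    have r0: "R1 0 = sm.alloc_rule i (hist v i)"
      using out(3) f2[of "Suc J"] J(1) al unfolding i' sm.alloc_hist e_def by simp
    have r1: "R1 1 = sm.pay_rule i (hist v i)"
    proof -
      have "sm.pay_rule i (hist v i) = v i * dp.pol_alloc i e (v i) - (dp.pol_interim i e (v i) - (R nd + R (nd + 3)))"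
        using st unfolding i' sm.pay_hist e_def by simp
      then show ?thesis using out(4) f2[of "Suc J"] J(1) al int f1 fd by simp
    qed
    show "computes_in executor (i # ?ns, ?c (hist v (i - 1)) # v i # ?rs) (real time)
      ([], [sm.alloc_rule i (hist v i), sm.pay_rule i (hist v i), ?c (hist v i)])"
      unfolding computes_in_def s1_def[symmetric]
    proof (intro exI conjI)
      show "exec executor s1 t1 (N1, R1)" by (rule ex)
      have "J < M" using J(1) off_less[OF i, of "Suc J"] by simp
      then show "real t1 \<le> real time" using t1 time_bounds(1) range[of 0] unfolding E_def[symmetric] by simp
      show "holds_output (N1, R1) ([], [sm.alloc_rule i (hist v i), sm.pay_rule i (hist v i), ?c (hist v i)])"
        using out(1,2,5) r0 r1 st by (simp add: holds_output_def upt_conv_Cons numeral_2_eq_2 numeral_3_eq_3)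
    qed
  qed
  ultimately show ?thesis using sm.mechanism_feasible by blast
qed

text \<open>With \<open>z\<close> the instance size, \<open>L\<close> is O(z) and the sum of all
  values is at most z^2, so \<open>n\<close> is O(z^4) and \<open>K\<close> is O(z^12); the time, of
  order M K^3, is O(z^37).\<close>

lemma time_poly: "real time \<le> real (2400 * 19 ^ 9) * instance_size k f \<epsilon> ^ 37"
proof -
  define z where "z = instance_size k f \<epsilon>"
  have mx: "0 \<le> Max (set_pmf (f i)) \<and> (\<forall>a\<in>set_pmf (f i). a \<le> Max (set_pmf (f i)))" if "i \<in> {1..k}" for i
    using fin[OF ok that] set_pmf_not_empty[of "f i"] ok that by (auto simp: instance_ok_def)
  have z_eq: "z = real k + (real M + (\<Sum>i\<in>{1..k}. Max (set_pmf (f i)))) + 1 / \<epsilon>"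
    by (simp add: z_def instance_size_def M_def supp_def sum.distrib)
  have mx_sum: "0 \<le> (\<Sum>i\<in>{1..k}. Max (set_pmf (f i)))" using mx by (intro sum_nonneg) auto
  have k1: "1 \<le> real k" using k_pos by simp
  have e1: "0 < 1 / \<epsilon>" using eps by simp
  have Mz: "real M + 1 \<le> z" and ez: "1 / \<epsilon> \<le> z" and mz: "(\<Sum>i\<in>{1..k}. Max (set_pmf (f i))) \<le> z" and z1: "1 \<le> z"
    using z_eq mx_sum k1 e1 by linarith+
  have tz: "total \<le> z * z"
  proof -
    have "total \<le> (\<Sum>i\<in>{1..k}. real (supp f i) * Max (set_pmf (f i)))"
      unfolding total_def
    proof (intro sum_mono)
      fix i assume i: "i \<in> {1..k}"
      have "(\<Sum>a\<in>set_pmf (f i). a) \<le> (\<Sum>a\<in>set_pmf (f i). Max (set_pmf (f i)))" using mx[OF i] by (intro sum_mono) auto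
      then show "(\<Sum>a\<in>set_pmf (f i). a) \<le> real (supp f i) * Max (set_pmf (f i))" by (simp add: supp_def)
    qed
    also have "\<dots> \<le> (\<Sum>i\<in>{1..k}. real M * Max (set_pmf (f i)))"
    proof (intro sum_mono mult_right_mono)
      fix i assume i: "i \<in> {1..k}"
      have "supp f i \<le> M" unfolding M_def using i by (intro member_le_sum) auto
      then show "real (supp f i) \<le> real M" by simp
    qed (use mx in auto)
    also have "\<dots> = real M * (\<Sum>i\<in>{1..k}. Max (set_pmf (f i)))" by (simp add: sum_distrib_left)
    also have "\<dots> \<le> z * z" using Mz mz mx_sum z1 by (intro mult_mono) auto
    finally show ?thesis .
  qed
  have Lz: "real L \<le> 2 * z" using Mz by (simp add: L_def)
  have n_le: "real n \<le> 2 + (total + \<epsilon>) / h"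
  proof (cases "n = 1")
    case False
    then have "real (n - 1) * h < total + \<epsilon>" using n_props(1) by (intro n_props(3)) auto
    then have "real (n - 1) < (total + \<epsilon>) / h" using h_pos by (simp add: field_simps)
    then show ?thesis using n_props(1) by simp
  qed (use total_nonneg eps h_pos in simp)
  have "(total + \<epsilon>) / h = 4 * real L * (total * (1 / \<epsilon>) + 1)"
    using eps by (simp add: h_def field_simps)
  also have "\<dots> \<le> 4 * (2 * z) * (z * z * z + 1)"
    using Lz tz ez z1 total_nonneg e1 by (intro mult_mono add_mono order_refl) (auto intro!: mult_nonneg_nonneg add_nonneg_nonneg)
  also have "\<dots> = 8 * z ^ 4 + 8 * z" by (simp add: power4_eq_xxxx algebra_simps)
  finally have "real n + 1 \<le> 3 + 8 * z + 8 * z ^ 4" using n_le by simp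
  moreover have "1 \<le> z ^ 4" "z \<le> z ^ 4" using z1 self_le_power[of z 4] by auto
  ultimately have n19: "real n + 1 \<le> 19 * z ^ 4" by linarith
  have "real K = (real n + 1) ^ 3" by (simp add: K_def power3_eq_cube algebra_simps)
  also have "\<dots> \<le> (19 * z ^ 4) ^ 3" using n19 by (intro power_mono) auto
  also have "\<dots> = 19 ^ 3 * z ^ 12" by (simp add: power_mult_distrib power_mult[symmetric])
  finally have "real K + 1 \<le> 19 ^ 3 * z ^ 12 + 19 ^ 3 * z ^ 12" using one_le_power[OF z1, of 12] by simp
  then have "real K + 1 \<le> 2 * 19 ^ 3 * z ^ 12" by simp
  then have "(real K + 1) ^ 3 \<le> (2 * 19 ^ 3 * z ^ 12) ^ 3" by (intro power_mono) auto
  also have "\<dots> = 8 * 19 ^ 9 * z ^ 36" by (simp add: power_mult_distrib power_mult[symmetric])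
  finally have K3: "(real K + 1) ^ 3 \<le> 8 * 19 ^ 9 * z ^ 36" .
  have "real time = 300 * ((real M + 1) * (real K + 1) ^ 3)" by (simp add: time_def add.commute)
  also have "\<dots> \<le> 300 * (z * (8 * 19 ^ 9 * z ^ 36))"
    using Mz K3 z1 by (intro mult_left_mono mult_mono) auto
  also have "\<dots> = real (2400 * 19 ^ 9) * z ^ 37" by (simp add: power_Suc[symmetric] del: power_Suc)
  finally show ?thesis unfolding z_def .
qed

end

lemma computes_mechanism_mono:
  "computes_mechanism P Q k f \<epsilon> T x p \<Longrightarrow> T \<le> T' \<Longrightarrow> computes_mechanism P Q k f \<epsilon> T' x p"
  unfolding computes_mechanism_def computes_in_def by (meson order_trans)

theorem theorem24:
  "\<exists>(P :: prog) (Q :: prog) (C :: nat) (d :: nat).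
     \<forall>(k :: nat) (f :: nat \<Rightarrow> real pmf) (\<epsilon> :: real).
       instance_ok k f \<and> \<epsilon> > 0 \<longrightarrow>
       (\<exists>x p. feasible k f x p \<and>
              (\<forall>x' p'. feasible k f x' p' \<longrightarrow> revenue k f p \<ge> revenue k f p' - \<epsilon>) \<and>
              computes_mechanism P Q k f \<epsilon> (real C * instance_size k f \<epsilon> ^ d) x p)"
proof -
  have "\<exists>x p. feasible k f x p \<and> (\<forall>x' p'. feasible k f x' p' \<longrightarrow> revenue k f p \<ge> revenue k f p' - \<epsilon>) \<and>
      computes_mechanism planner executor k f \<epsilon> (real (2400 * 19 ^ 9) * instance_size k f \<epsilon> ^ 37) x p"
    if "instance_ok k f \<and> \<epsilon> > 0" for k :: nat and f :: "nat \<Rightarrow> real pmf" and \<epsilon> :: real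
  proof -
    interpret encoded k f \<epsilon> using that by unfold_locales auto
    show ?thesis using near_optimal time_poly computes_mechanism_mono by blast
  qed
  then show ?thesis by blast
qed

end
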